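(* For each $N\in\mathbb N$ let $\mathbf c^N:[0,\infty)\to\mathcal P(\mathcal X^N)$ be a solution of the $N$-particle evolution $\dot{\mathbf c}^N(t)=\mathbf c^N(t)\bm Q^N$. Let $\mathbb C(0)\in\mathcal P(\mathcal P(\mathcal X))$ and assume the initial data are well-prepared: $$\frac1N\bm{\mathcal F}^N(\mathbf c^N(0))\to\mathbb F(\mathbb C(0))-\mathcal F_0\quad\text{and}\quad L^N_\#\mathbf c^N(0)\rightharpoonup\mathbb C(0)\quad\text{as }N\to\infty.$$ Then $L^N_\#\mathbf c^N(t)\rightharpoonup\mathbb C(t)$ for all $t\in(0,\infty)$, where $\mathbb C$ is a weak solution of the Liouville equation starting from $\mathbb C(0)$, and moreover $\frac1N\bm{\mathcal F}^N(\mathbf c^N(t))\to\mathbb F(\mathbb C(t))-\mathcal F_0$ for all $t\in(0,\infty)$.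
   Context: Let $\mathcal X=\{1,\dots,d\}$ be finite, $\mathcal P(\mathcal X)\subset\mathbb R^{\mathcal X}$ the probability measures on $\mathcal X$. Let $K:\mathcal P(\mathcal X)\times\mathcal X\to\mathbb R$ with each $K_x$ twice continuously differentiable on a neighbourhood of $\mathcal P(\mathcal X)$; $U(\mu)=\sum_x\mu_xK_x(\mu)$, $H_x=\partial_{\mu_x}U$, $\pi_x(\mu)=e^{-H_x(\mu)}/\sum_ze^{-H_z(\mu)}$. Free energy $\mathcal F(\mu)=\sum_x\mu_x\log\mu_x+U(\mu)$, $\mathcal F_0=\inf_{\mu\in\mathcal P(\mathcal X)}\mathcal F(\mu)$, and for $\mathbb M\in\mathcal P(\mathcal P(\mathcal X))$, $\mathbb F(\mathbb M)=\int\mathcal F\,d\mathbb M$. Particle system: for $\bm x=(x_1,\dots,x_N)\in\mathcal X^N$ let $L^N(\bm x)=\frac1N\sum_i\delta_{x_i}$, $\mathcal P_N(\mathcal X)=L^N(\mathcal X^N)$, and $\bm x^{i;y}$ the configuration with $x_i$ replaced by $y$. Let $\bm\pi^N_{\bm x}=\exp(-NU(L^N\bm x))/\bm Z^N$ with $\bm Z^N$ the normalization. Let $\{A(\mu)\}_{\mu\in\mathcal P(\mathcal X)}$ be irreducible symmetric matrices with nonnegative entries, depending Lipschitz continuously on $\mu$, and $\{A^N(\mu)\}$ irreducible symmetric nonnegative matrices with $A^N_{xy}\to A_{xy}$ uniformly on $\mathcal P(\mathcal X)$ for all $x,y$. For $\mu\in\mathcal P_N(\mathcal X)$ with $\mu_x>0$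 and $y\ne x$ set $Q^N_{xy}(\mu)=\exp\big(-\frac N2(U(\mu+\frac{\delta_y-\delta_x}{N})-U(\mu))\big)A^N_{xy}(\mu)$, and let $\bm Q^N\in\mathbb R^{\mathcal X^N\times\mathcal X^N}$ have off-diagonal entries $\bm Q^N_{\bm x,\bm x^{i;y}}=Q^N_{x_i,y}(L^N\bm x)$ ($y\ne x_i$), all other off-diagonal entries $0$, and rows summing to $0$. Relative entropy: $\bm{\mathcal F}^N(\bm\mu)=\sum_{\bm x}\bm\mu_{\bm x}\log(\bm\mu_{\bm x}/\bm\pi^N_{\bm x})$. $L^N_\#\bm\mu\in\mathcal P(\mathcal P(\mathcal X))$ is the push-forward; $\rightharpoonup$ is weak convergence. Limit rates: $Q_{xy}(\mu)=\sqrt{\pi_y(\mu)/\pi_x(\mu)}\,A_{xy}(\mu)$ for $x\ne y$, $Q_{xx}=-\sum_{y\ne x}Q_{xy}$. Weak solution of the Liouville equation $\partial_t\mathbb C+\mathrm{div}(\mathbb C\,b)=0$, $b_x(\nu)=\sum_y\nu_yQ_{yx}(\nu)$: a weakly continuous curve $t\mapsto\mathbb C(t)\in\mathcal P(\mathcal P(\mathcal X))$ with the given $\mathbb C(0)$ such that $\int\int(\partial_t\varphi(t,\nu)+\langle\nabla\varphi(t,\nu),b(\nu)\rangle)\mathbb C(t,d\nu)dt=0$ for all $\varphi\in C^1_c((0,\infty)\times\mathbb R^{\mathcal X})$. *)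

theory Defs
  imports "HOL-Probability.Probability"
begin

(* The finite state space X is a finite type 'x; R^X is real^'x. *)

definition PX :: "(real^'x::finite) set" where
  "PX = {\<mu>. (\<forall>x. 0 \<le> \<mu>$x) \<and> (\<Sum>x\<in>UNIV. \<mu>$x) = 1}"

(* twice continuously (Frechet) differentiable on an open set S *)
definition C2_on :: "(real^'x::finite) set \<Rightarrow> (real^'x \<Rightarrow> real) \<Rightarrow> bool" where
  "C2_on S f \<longleftrightarrow> (\<exists>(f' :: real^'x \<Rightarrow> ((real^'x) \<Rightarrow>\<^sub>L real))
       (f'' :: real^'x \<Rightarrow> ((real^'x) \<Rightarrow>\<^sub>L ((real^'x) \<Rightarrow>\<^sub>L real))).
       (\<forall>\<nu>\<in>S. (f has_derivative blinfun_apply (f' \<nu>)) (at \<nu>)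
              \<and> (f' has_derivative blinfun_apply (f'' \<nu>)) (at \<nu>))
       \<and> continuous_on S f'')"

(* U(mu) = sum_x mu_x K_x(mu) *)
definition UU :: "('x::finite \<Rightarrow> real^'x \<Rightarrow> real) \<Rightarrow> real^'x \<Rightarrow> real" where
  "UU K \<mu> = (\<Sum>x\<in>UNIV. \<mu>$x * K x \<mu>)"

(* H_x = partial derivative of U in direction mu_x *)
definition HH :: "('x::finite \<Rightarrow> real^'x \<Rightarrow> real) \<Rightarrow> 'x \<Rightarrow> real^'x \<Rightarrow> real" where
  "HH K x \<mu> = frechet_derivative (UU K) (at \<mu>) (axis x 1)"

definition piK :: "('x::finite \<Rightarrow> real^'x \<Rightarrow> real) \<Rightarrow> 'x \<Rightarrow> real^'x \<Rightarrow> real" where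
  "piK K x \<mu> = exp (- HH K x \<mu>) / (\<Sum>z\<in>UNIV. exp (- HH K z \<mu>))"

(* free energy; note 0 * ln 0 = 0 in Isabelle *)
definition FE :: "('x::finite \<Rightarrow> real^'x \<Rightarrow> real) \<Rightarrow> real^'x \<Rightarrow> real" where
  "FE K \<mu> = (\<Sum>x\<in>UNIV. \<mu>$x * ln (\<mu>$x)) + UU K \<mu>"

definition FE0 :: "('x::finite \<Rightarrow> real^'x \<Rightarrow> real) \<Rightarrow> real" where
  "FE0 K = (INF \<mu>\<in>(PX :: (real^'x) set). FE K \<mu>)"

(* probability measures on P(X): Borel probability measures on R^X concentrated on the PX *)
definition prob_on_simplex :: "(real^'x::finite) measure \<Rightarrow> bool" where
  "prob_on_simplex M \<longleftrightarrow> prob_space M \<and> sets M = sets borel \<and> emeasure M PX = 1"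

(* F(M) = integral of the free energy *)
definition FFbig :: "('x::finite \<Rightarrow> real^'x \<Rightarrow> real) \<Rightarrow> (real^'x) measure \<Rightarrow> real" where
  "FFbig K M = (LINT \<nu>:PX|M. FE K \<nu>)"

(* weak convergence of probability measures along a filter *)
definition weak_conv_along :: "'a filter \<Rightarrow> ('a \<Rightarrow> (real^'x::finite) measure) \<Rightarrow> (real^'x) measure \<Rightarrow> bool" where
  "weak_conv_along F Ms M \<longleftrightarrow>
     (\<forall>f :: real^'x \<Rightarrow> real. continuous_on UNIV f \<and> bounded (range f) \<longrightarrow>
        ((\<lambda>n. integral\<^sup>L (Ms n) f) \<longlongrightarrow> integral\<^sup>L M f) F)"

(* irreducible nonnegative matrix: the graph of positive entries is strongly connected *)
definition irreducible_mat :: "('x \<Rightarrow> 'x \<Rightarrow> real) \<Rightarrow> bool" where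
  "irreducible_mat A \<longleftrightarrow> (\<forall>x y. (x, y) \<in> {(a, b). 0 < A a b}\<^sup>*)"

definition good_mat :: "('x \<Rightarrow> 'x \<Rightarrow> real) \<Rightarrow> bool" where
  "good_mat A \<longleftrightarrow> irreducible_mat A \<and> (\<forall>x y. A x y = A y x) \<and> (\<forall>x y. 0 \<le> A x y)"

(* ---------- N-particle system ---------- *)

definition configs :: "nat \<Rightarrow> (nat \<Rightarrow> 'x::finite) set" where
  "configs N = PiE {..<N} (\<lambda>_. UNIV)"

definition LN :: "nat \<Rightarrow> (nat \<Rightarrow> 'x::finite) \<Rightarrow> real^'x" where
  "LN N c = (\<chi> y. real (card {i\<in>{..<N}. c i = y}) / real N)"

(* Q^N_{xy}(mu) *)
definition QsN :: "('x::finite \<Rightarrow> real^'x \<Rightarrow> real) \<Rightarrow> (nat \<Rightarrow> real^'x \<Rightarrow> 'x \<Rightarrow> 'x \<Rightarrow> real)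
                   \<Rightarrow> nat \<Rightarrow> 'x \<Rightarrow> 'x \<Rightarrow> real^'x \<Rightarrow> real" where
  "QsN K AN N x y \<mu> =
     exp (- (real N / 2) * (UU K (\<mu> + (1 / real N) *\<^sub>R (axis y 1 - axis x 1)) - UU K \<mu>)) * AN N \<mu> x y"

(* off-diagonal entries of the generator bold Q^N *)
definition QBoff :: "('x::finite \<Rightarrow> real^'x \<Rightarrow> real) \<Rightarrow> (nat \<Rightarrow> real^'x \<Rightarrow> 'x \<Rightarrow> 'x \<Rightarrow> real)
                   \<Rightarrow> nat \<Rightarrow> (nat \<Rightarrow> 'x) \<Rightarrow> (nat \<Rightarrow> 'x) \<Rightarrow> real" where
  "QBoff K AN N cx cy =
     (\<Sum>i<N. if cy i \<noteq> cx i \<and> cy = cx(i := cy i) then QsN K AN N (cx i) (cy i) (LN N cx) else 0)"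

definition QB :: "('x::finite \<Rightarrow> real^'x \<Rightarrow> real) \<Rightarrow> (nat \<Rightarrow> real^'x \<Rightarrow> 'x \<Rightarrow> 'x \<Rightarrow> real)
                   \<Rightarrow> nat \<Rightarrow> (nat \<Rightarrow> 'x) \<Rightarrow> (nat \<Rightarrow> 'x) \<Rightarrow> real" where
  "QB K AN N cx cy =
     (if cx = cy then - (\<Sum>cz\<in>configs N - {cx}. QBoff K AN N cx cz) else QBoff K AN N cx cy)"

definition ZN :: "('x::finite \<Rightarrow> real^'x \<Rightarrow> real) \<Rightarrow> nat \<Rightarrow> real" where
  "ZN K N = (\<Sum>c\<in>configs N. exp (- real N * UU K (LN N c)))"

definition piN :: "('x::finite \<Rightarrow> real^'x \<Rightarrow> real) \<Rightarrow> nat \<Rightarrow> (nat \<Rightarrow> 'x) \<Rightarrow> real" where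
  "piN K N c = exp (- real N * UU K (LN N c)) / ZN K N"

(* relative entropy w.r.t. bold pi^N; 0 * ln 0 = 0 *)
definition FN :: "('x::finite \<Rightarrow> real^'x \<Rightarrow> real) \<Rightarrow> nat \<Rightarrow> ((nat \<Rightarrow> 'x) \<Rightarrow> real) \<Rightarrow> real" where
  "FN K N m = (\<Sum>c\<in>configs N. m c * ln (m c / piN K N c))"

definition is_prob_configs :: "nat \<Rightarrow> ((nat \<Rightarrow> 'x::finite) \<Rightarrow> real) \<Rightarrow> bool" where
  "is_prob_configs N m \<longleftrightarrow> (\<forall>c\<in>configs N. 0 \<le> m c) \<and> (\<Sum>c\<in>configs N. m c) = 1"

(* push-forward L^N_# m *)
definition pushLN :: "nat \<Rightarrow> ((nat \<Rightarrow> 'x::finite) \<Rightarrow> real) \<Rightarrow> (real^'x) measure" where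
  "pushLN N m = distr (point_measure (configs N) (\<lambda>c. ennreal (m c))) borel (LN N)"

(* ---------- limit dynamics ---------- *)

definition Qlim :: "('x::finite \<Rightarrow> real^'x \<Rightarrow> real) \<Rightarrow> (real^'x \<Rightarrow> 'x \<Rightarrow> 'x \<Rightarrow> real)
                    \<Rightarrow> 'x \<Rightarrow> 'x \<Rightarrow> real^'x \<Rightarrow> real" where
  "Qlim K A x y \<mu> =
     (if x = y then - (\<Sum>z\<in>UNIV - {x}. sqrt (piK K z \<mu> / piK K x \<mu>) * A \<mu> x z)
      else sqrt (piK K y \<mu> / piK K x \<mu>) * A \<mu> x y)"

definition bfield :: "('x::finite \<Rightarrow> real^'x \<Rightarrow> real) \<Rightarrow> (real^'x \<Rightarrow> 'x \<Rightarrow> 'x \<Rightarrow> real)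
                    \<Rightarrow> real^'x \<Rightarrow> real^'x" where
  "bfield K A \<nu> = (\<chi> x. \<Sum>y\<in>UNIV. \<nu>$y * Qlim K A y x \<nu>)"

(* C^1_c((0,oo) x R^X), extended by zero *)
definition test_fun :: "(real \<times> (real^'x::finite) \<Rightarrow> real) \<Rightarrow> bool" where
  "test_fun \<phi> \<longleftrightarrow>
     (\<exists>\<phi>' :: real \<times> (real^'x) \<Rightarrow> ((real \<times> (real^'x)) \<Rightarrow>\<^sub>L real).
        (\<forall>p. (\<phi> has_derivative blinfun_apply (\<phi>' p)) (at p)) \<and> continuous_on UNIV \<phi>')
     \<and> (\<exists>Kc. compact Kc \<and> Kc \<subseteq> {0<..} \<times> UNIV \<and> (\<forall>p. p \<notin> Kc \<longrightarrow> \<phi> p = 0))"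

definition liouville_weak_sol :: "('x::finite \<Rightarrow> real^'x \<Rightarrow> real) \<Rightarrow> (real^'x \<Rightarrow> 'x \<Rightarrow> 'x \<Rightarrow> real)
        \<Rightarrow> (real \<Rightarrow> (real^'x) measure) \<Rightarrow> (real^'x) measure \<Rightarrow> bool" where
  "liouville_weak_sol K A C C0 \<longleftrightarrow>
     C 0 = C0
     \<and> (\<forall>t\<ge>0. prob_on_simplex (C t))
     \<and> (\<forall>s\<ge>0. weak_conv_along (at s within {0..}) C (C s))
     \<and> (\<forall>\<phi>. test_fun \<phi> \<longrightarrow>
          (LBINT t:{0<..}. (LINT \<nu>:PX|C t.
              frechet_derivative \<phi> (at (t, \<nu>)) (1, 0)
            + frechet_derivative \<phi> (at (t, \<nu>)) (0, bfield K A \<nu>))) = 0)"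

end

theory Submission
  imports Defs "HOL-Combinatorics.Multiset_Permutations" "HOL-Real_Asymp.Real_Asymp"
begin

text \<open>
  The limit curve is the push-forward of \<open>C0\<close> under the flow of the vector field \<open>b\<close>. Applying the
  generator to the squared distance between the empirical measure and the flow line started at the
  initial empirical measure, Gronwall's inequality shows that this distance vanishes in mean square,
  which gives the weak convergence.

  Detailed balance is not available, because \<open>AN\<close> is evaluated before the jump only. The entropy is
  controlled by exchangeability instead. By counting types, \<open>\<Sum> m ln m\<close> is up to \<open>O(ln N)\<close> at least \<open>- N\<close>
  times the mean Shannon entropy of the empirical measure, with equality up to \<open>O(ln N)\<close> if \<open>m\<close> is
  exchangeable. Well-preparedness says that initially the excess is \<open>o(N)\<close>. The excess is, up to
  \<open>O(ln N)\<close>, the relative entropy of the law with respect to its average over permutations of the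
  particles; since the evolution commutes with this averaging, the data processing inequality keeps
  the excess \<open>o(N)\<close> at all later times.
\<close>

subsection \<open>Relative entropy on finite sets\<close>

definition relative_entropy :: "'a set \<Rightarrow> ('a \<Rightarrow> real) \<Rightarrow> ('a \<Rightarrow> real) \<Rightarrow> real" where
  "relative_entropy S a b = (\<Sum>x\<in>S. a x * ln (a x / b x))"

lemma ln_ratio_ge_tangent:
  fixes a b k :: real
  assumes "0 \<le> a" "0 \<le> b" "0 < k" "b = 0 \<Longrightarrow> a = 0"
  shows "a * ln k + a - b * k \<le> a * ln (a / b)"
proof (cases "a = 0")
  case False
  then have pos: "0 < a" "0 < b" using assms by force+
  then have "ln (b * k / a) \<le> b * k / a - 1" using assms(3) by (intro ln_le_minus_one) simp
  then have "a * ln (b * k / a) \<le> a * (b * k / a - 1)" using pos by (intro mult_left_mono) auto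
  also have "\<dots> = b * k - a" using pos by (simp add: field_simps)
  finally show ?thesis using pos assms(3) by (simp add: ln_mult ln_div algebra_simps)
qed (use assms in auto)

lemma log_sum_inequality:
  assumes "finite S" and a: "\<And>x. x \<in> S \<Longrightarrow> 0 \<le> a x" and b: "\<And>x. x \<in> S \<Longrightarrow> 0 \<le> b x"
    and ac: "\<And>x. x \<in> S \<Longrightarrow> b x = 0 \<Longrightarrow> a x = 0"
  shows "sum a S * ln (sum a S / sum b S) \<le> relative_entropy S a b"
proof (cases "sum a S = 0")
  case True
  then have "a x = 0" if "x \<in> S" for x
    using that assms(1) a by (simp add: sum_nonneg_eq_0_iff)
  then show ?thesis using True by (simp add: relative_entropy_def)
next
  case False
  then have A: "0 < sum a S" using sum_nonneg[of S a] a by fastforce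
  have "sum b S \<noteq> 0" using False assms by (auto simp: sum_nonneg_eq_0_iff)
  then have B: "0 < sum b S" using sum_nonneg[of S b] b by fastforce
  define k where "k = sum a S / sum b S"
  have "sum a S * ln k = sum a S * ln k + sum a S - sum b S * k"
    using B by (simp add: k_def)
  also have "\<dots> = (\<Sum>x\<in>S. a x * ln k + a x - b x * k)"
    by (simp add: sum.distrib sum_subtractf sum_distrib_right)
  also have "\<dots> \<le> relative_entropy S a b"
    unfolding relative_entropy_def using a b ac A B
    by (intro sum_mono ln_ratio_ge_tangent) (auto simp: k_def)
  finally show ?thesis by (simp add: k_def)
qed

lemma relative_entropy_nonneg:
  assumes "finite S" "\<And>x. x \<in> S \<Longrightarrow> 0 \<le> a x" "\<And>x. x \<in> S \<Longrightarrow> 0 \<le> b x"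
    and "\<And>x. x \<in> S \<Longrightarrow> b x = 0 \<Longrightarrow> a x = 0" and "sum b S \<le> sum a S"
  shows "0 \<le> relative_entropy S a b"
proof -
  have "0 \<le> sum a S * ln (sum a S / sum b S)"
  proof (cases "sum b S = 0")
    case False
    then have "0 < sum b S" using sum_nonneg[of S b] assms(3) by fastforce
    then show ?thesis using assms(5) by simp
  qed simp
  also have "\<dots> \<le> relative_entropy S a b" by (rule log_sum_inequality) (use assms in auto)
  finally show ?thesis .
qed

lemma relative_entropy_data_processing:
  assumes "finite S" and a: "\<And>x. x \<in> S \<Longrightarrow> 0 \<le> a x" and b: "\<And>x. x \<in> S \<Longrightarrow> 0 \<le> b x"
    and ac: "\<And>x. x \<in> S \<Longrightarrow> b x = 0 \<Longrightarrow> a x = 0"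
    and W: "\<And>x y. x \<in> S \<Longrightarrow> y \<in> S' \<Longrightarrow> 0 \<le> W x y"
    and W_row: "\<And>x. x \<in> S \<Longrightarrow> (\<Sum>y\<in>S'. W x y) = 1"
  shows "relative_entropy S' (\<lambda>y. \<Sum>x\<in>S. a x * W x y) (\<lambda>y. \<Sum>x\<in>S. b x * W x y)
    \<le> relative_entropy S a b"
proof -
  have "(\<Sum>x\<in>S. a x * W x y) * ln ((\<Sum>x\<in>S. a x * W x y) / (\<Sum>x\<in>S. b x * W x y))
      \<le> (\<Sum>x\<in>S. a x * ln (a x / b x) * W x y)" if "y \<in> S'" for y
  proof -
    have "(\<Sum>x\<in>S. a x * W x y) * ln ((\<Sum>x\<in>S. a x * W x y) / (\<Sum>x\<in>S. b x * W x y))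
        \<le> relative_entropy S (\<lambda>x. a x * W x y) (\<lambda>x. b x * W x y)"
      using \<open>y \<in> S'\<close> a b ac W by (intro log_sum_inequality \<open>finite S\<close>) auto
    also have "\<dots> = (\<Sum>x\<in>S. a x * ln (a x / b x) * W x y)"
      unfolding relative_entropy_def by (intro sum.cong) auto
    finally show ?thesis .
  qed
  then have "relative_entropy S' (\<lambda>y. \<Sum>x\<in>S. a x * W x y) (\<lambda>y. \<Sum>x\<in>S. b x * W x y)
      \<le> (\<Sum>y\<in>S'. \<Sum>x\<in>S. a x * ln (a x / b x) * W x y)"
    unfolding relative_entropy_def by (rule sum_mono)
  also have "\<dots> = (\<Sum>x\<in>S. a x * ln (a x / b x) * (\<Sum>y\<in>S'. W x y))"
    by (subst sum.swap) (simp add: sum_distrib_left)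
  also have "\<dots> = relative_entropy S a b" using W_row by (simp add: relative_entropy_def)
  finally show ?thesis .
qed

lemma relative_entropy_eq_diff:
  assumes "\<And>x. x \<in> S \<Longrightarrow> 0 \<le> a x" "\<And>x. x \<in> S \<Longrightarrow> 0 \<le> b x" "\<And>x. x \<in> S \<Longrightarrow> b x = 0 \<Longrightarrow> a x = 0"
  shows "relative_entropy S a b = (\<Sum>x\<in>S. a x * ln (a x)) - (\<Sum>x\<in>S. a x * ln (b x))"
  unfolding relative_entropy_def sum_subtractf[symmetric]
proof (intro sum.cong refl)
  fix x assume x: "x \<in> S"
  show "a x * ln (a x / b x) = a x * ln (a x) - a x * ln (b x)"
  proof (cases "a x = 0")
    case False
    then have "0 < a x" "0 < b x" using assms[OF x] by (auto simp: less_le)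
    then show ?thesis by (simp add: ln_div algebra_simps)
  qed simp
qed

subsection \<open>Markov semigroups on finite sets\<close>

lemma gronwall_exp:
  fixes g g' :: "real \<Rightarrow> real"
  assumes deriv: "\<And>s. 0 \<le> s \<Longrightarrow> (g has_real_derivative g' s) (at s within {0..})"
    and bound: "\<And>s. 0 \<le> s \<Longrightarrow> g' s \<le> a * g s" and "0 \<le> t"
  shows "g t \<le> g 0 * exp (a * t)"
proof -
  define k where "k s = g s * exp (- a * s)" for s
  have k_deriv: "(k has_real_derivative (g' s - a * g s) * exp (- a * s)) (at s within {0..})"
    if "0 \<le> s" for s
    unfolding k_def by (rule derivative_eq_intros deriv[OF that] refl)+ (simp add: algebra_simps)
  have "k t \<le> k 0"
  proof (rule DERIV_nonpos_imp_decreasing_open[OF \<open>0 \<le> t\<close>])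
    fix s assume s: "0 < s" "s < t"
    then have "at s within {0..} = at s" by (intro at_within_interior) simp
    then have "DERIV k s :> (g' s - a * g s) * exp (- a * s)" using k_deriv[of s] s by simp
    moreover have "(g' s - a * g s) * exp (- a * s) \<le> 0"
      using bound[of s] s by (intro mult_nonpos_nonneg) auto
    ultimately show "\<exists>y. DERIV k s :> y \<and> y \<le> 0" by blast
  next
    show "continuous_on {0..t} k"
      by (rule continuous_on_subset[of "{0..}"]) (auto intro!: DERIV_continuous_on k_deriv)
  qed
  then show ?thesis by (simp add: k_def exp_minus field_simps)
qed

locale finite_generator =
  fixes S :: "'a set" and Q :: "'a \<Rightarrow> 'a \<Rightarrow> real"
  assumes finite_states: "finite S"
    and off_diag_nonneg: "\<And>x y. x \<in> S \<Longrightarrow> y \<in> S \<Longrightarrow> x \<noteq> y \<Longrightarrow> 0 \<le> Q x y"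
    and row_sum: "\<And>x. x \<in> S \<Longrightarrow> (\<Sum>y\<in>S. Q x y) = 0"
begin

definition rate :: real where
  "rate = (\<Sum>x\<in>S. \<bar>Q x x\<bar>)"

definition jump :: "'a \<Rightarrow> 'a \<Rightarrow> real" where
  "jump x y = (if x = y then rate else 0) + Q x y"

primrec jump_power :: "nat \<Rightarrow> 'a \<Rightarrow> 'a \<Rightarrow> real" where
  "jump_power 0 x y = (if x = y then 1 else 0)"
| "jump_power (Suc n) x y = (\<Sum>z\<in>S. jump x z * jump_power n z y)"

definition jump_exp :: "real \<Rightarrow> 'a \<Rightarrow> 'a \<Rightarrow> real" where
  "jump_exp t x y = (\<Sum>n. jump_power n x y / fact n * t ^ n)"

text \<open>Uniformisation: \<open>exp (t Q) = exp (- rate t) exp (t (rate + Q))\<close>, where \<open>rate + Q\<close> has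
  nonnegative entries.\<close>

definition trans_prob :: "real \<Rightarrow> 'a \<Rightarrow> 'a \<Rightarrow> real" where
  "trans_prob t x y = exp (- rate * t) * jump_exp t x y"

lemma jump_nonneg:
  assumes "x \<in> S" "y \<in> S"
  shows "0 \<le> jump x y"
proof (cases "x = y")
  case True
  have "\<bar>Q x x\<bar> \<le> rate"
    unfolding rate_def using finite_states assms by (intro member_le_sum) auto
  then show ?thesis using True by (simp add: jump_def)
qed (use off_diag_nonneg assms in \<open>simp add: jump_def\<close>)

lemma sum_jump_left: "x \<in> S \<Longrightarrow> (\<Sum>z\<in>S. jump x z * f z) = rate * f x + (\<Sum>z\<in>S. Q x z * f z)"
  using finite_states
  by (simp add: jump_def distrib_right sum.distrib if_distrib[of "\<lambda>a. a * _"] cong: if_cong)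

lemma sum_jump_right: "y \<in> S \<Longrightarrow> (\<Sum>z\<in>S. f z * jump z y) = rate * f y + (\<Sum>z\<in>S. f z * Q z y)"
  using finite_states
  by (simp add: jump_def distrib_left sum.distrib mult.commute if_distrib[of "\<lambda>a. _ * a"] cong: if_cong)

lemma jump_power_Suc_right:
  assumes "x \<in> S" "y \<in> S"
  shows "jump_power (Suc n) x y = (\<Sum>z\<in>S. jump_power n x z * jump z y)"
  using assms
proof (induction n arbitrary: x)
  case 0
  then show ?case
    using finite_states
    by (simp add: if_distrib[of "\<lambda>a. a * _"] if_distrib[of "\<lambda>a. _ * a"] cong: if_cong)
next
  case (Suc n)
  have "jump_power (Suc (Suc n)) x y = (\<Sum>w\<in>S. jump x w * (\<Sum>z\<in>S. jump_power n w z * jump z y))"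
    unfolding jump_power.simps(2)[of "Suc n" x y] using Suc by (intro sum.cong) auto
  also have "\<dots> = (\<Sum>z\<in>S. \<Sum>w\<in>S. jump x w * jump_power n w z * jump z y)"
    by (subst sum.swap) (simp add: sum_distrib_left mult.assoc)
  also have "\<dots> = (\<Sum>z\<in>S. jump_power (Suc n) x z * jump z y)"
    by (simp add: sum_distrib_right)
  finally show ?case .
qed

lemma jump_power_nonneg: "x \<in> S \<Longrightarrow> y \<in> S \<Longrightarrow> 0 \<le> jump_power n x y"
  by (induction n arbitrary: x) (auto intro!: sum_nonneg mult_nonneg_nonneg jump_nonneg)

lemma jump_power_row_sum: "x \<in> S \<Longrightarrow> (\<Sum>y\<in>S. jump_power n x y) = rate ^ n"
proof (induction n arbitrary: x)
  case 0
  then show ?case using finite_states by simp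
next
  case (Suc n)
  have "(\<Sum>y\<in>S. jump_power (Suc n) x y) = (\<Sum>z\<in>S. jump x z * (\<Sum>y\<in>S. jump_power n z y))"
    by (simp add: sum_distrib_left, rule sum.swap)
  also have "\<dots> = (\<Sum>z\<in>S. jump x z * 1) * rate ^ n"
    using Suc by (simp add: sum_distrib_right)
  also have "(\<Sum>z\<in>S. jump x z * 1) = rate"
    unfolding sum_jump_left[OF Suc.prems] using row_sum Suc.prems by simp
  finally show ?case by simp
qed

lemma jump_power_le:
  assumes "x \<in> S" "y \<in> S"
  shows "jump_power n x y \<le> rate ^ n"
proof -
  have "jump_power n x y \<le> (\<Sum>y\<in>S. jump_power n x y)"
    using finite_states assms by (intro member_le_sum) (auto intro: jump_power_nonneg)
  then show ?thesis using jump_power_row_sum assms by simp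
qed

lemma summable_jump_exp:
  assumes "x \<in> S" "y \<in> S"
  shows "summable (\<lambda>n. jump_power n x y / fact n * t ^ n)"
proof (rule summable_comparison_test')
  show "summable (\<lambda>n. (rate * \<bar>t\<bar>) ^ n / fact n)"
    using summable_exp[of "rate * \<bar>t\<bar>"] by (simp add: field_simps)
next
  fix n
  have "jump_power n x y * \<bar>t\<bar> ^ n \<le> rate ^ n * \<bar>t\<bar> ^ n"
    using jump_power_le[OF assms] by (intro mult_right_mono) auto
  then show "norm (jump_power n x y / fact n * t ^ n) \<le> (rate * \<bar>t\<bar>) ^ n / fact n"
    using jump_power_nonneg[OF assms]
    by (simp add: abs_mult power_abs power_mult_distrib divide_right_mono)
qed

lemma sum_jump_exp:
  assumes "\<And>z. z \<in> S \<Longrightarrow> p z \<in> S \<and> q z \<in> S"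
  shows "(\<Sum>z\<in>S. w z * jump_exp t (p z) (q z))
    = (\<Sum>n. (\<Sum>z\<in>S. w z * jump_power n (p z) (q z)) / fact n * t ^ n)"
proof -
  have "(\<Sum>z\<in>S. w z * jump_exp t (p z) (q z))
      = (\<Sum>z\<in>S. \<Sum>n. w z * (jump_power n (p z) (q z) / fact n * t ^ n))"
    unfolding jump_exp_def using assms
    by (intro sum.cong refl suminf_mult[symmetric] summable_jump_exp) auto
  also have "\<dots> = (\<Sum>n. \<Sum>z\<in>S. w z * (jump_power n (p z) (q z) / fact n * t ^ n))"
    using assms by (intro suminf_sum[symmetric] summable_mult summable_jump_exp) auto
  finally show ?thesis by (simp add: sum_distrib_right sum_divide_distrib mult.assoc)
qed

lemma has_derivative_jump_exp:
  assumes "x \<in> S" "y \<in> S"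
  shows "((\<lambda>t. jump_exp t x y) has_real_derivative
    (\<Sum>n. jump_power (Suc n) x y / fact n * t ^ n)) (at t)"
proof -
  have "diffs (\<lambda>n. jump_power n x y / fact n) n = jump_power (Suc n) x y / fact n" for n
    unfolding diffs_def by (simp add: field_simps del: jump_power.simps of_nat_Suc)
  then show ?thesis
    unfolding jump_exp_def
    using termdiffs_strong_converges_everywhere[OF summable_jump_exp[OF assms], of t] by simp
qed

lemma jump_exp_backward:
  assumes "x \<in> S" "y \<in> S"
  shows "((\<lambda>t. jump_exp t x y) has_real_derivative (\<Sum>z\<in>S. jump x z * jump_exp t z y)) (at t)"
  using has_derivative_jump_exp[OF assms] sum_jump_exp[of "\<lambda>z. z" "\<lambda>_. y" "jump x" t] assms by simp

lemma jump_exp_forward: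
  assumes "x \<in> S" "y \<in> S"
  shows "((\<lambda>t. jump_exp t x y) has_real_derivative (\<Sum>z\<in>S. jump_exp t x z * jump z y)) (at t)"
  using has_derivative_jump_exp[OF assms] sum_jump_exp[of "\<lambda>_. x" "\<lambda>z. z" "\<lambda>z. jump z y" t] assms
  unfolding jump_power_Suc_right[OF assms] by (simp add: mult.commute)

lemma has_derivative_trans_prob:
  assumes "((\<lambda>t. jump_exp t x y) has_real_derivative rate * jump_exp t x y + d) (at t)"
  shows "((\<lambda>t. trans_prob t x y) has_real_derivative exp (- rate * t) * d) (at t)"
  unfolding trans_prob_def by (rule derivative_eq_intros assms refl)+ (simp add: algebra_simps)

lemma trans_prob_backward:
  assumes "x \<in> S" "y \<in> S"
  shows "((\<lambda>t. trans_prob t x y) has_real_derivative (\<Sum>z\<in>S. Q x z * trans_prob t z y)) (at t)"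
  using has_derivative_trans_prob[OF jump_exp_backward[OF assms, unfolded sum_jump_left[OF assms(1)]]]
  by (simp add: trans_prob_def sum_distrib_left mult.left_commute)

lemma trans_prob_forward:
  assumes "x \<in> S" "y \<in> S"
  shows "((\<lambda>t. trans_prob t x y) has_real_derivative (\<Sum>z\<in>S. trans_prob t x z * Q z y)) (at t)"
  using has_derivative_trans_prob[OF jump_exp_forward[OF assms, unfolded sum_jump_right[OF assms(2)]]]
  by (simp add: trans_prob_def sum_distrib_left mult.assoc)

lemma trans_prob_0: "trans_prob 0 x y = (if x = y then 1 else 0)"
  using powser_zero[of "\<lambda>n. jump_power n x y / fact n"] by (simp add: trans_prob_def jump_exp_def)

lemma trans_prob_nonneg: "x \<in> S \<Longrightarrow> y \<in> S \<Longrightarrow> 0 \<le> t \<Longrightarrow> 0 \<le> trans_prob t x y"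
  unfolding trans_prob_def jump_exp_def
  by (intro mult_nonneg_nonneg suminf_nonneg summable_jump_exp divide_nonneg_nonneg
      jump_power_nonneg) auto

lemma trans_prob_row_sum:
  assumes "x \<in> S"
  shows "(\<Sum>y\<in>S. trans_prob t x y) = 1"
proof -
  have "(\<Sum>y\<in>S. jump_exp t x y) = (\<Sum>n. rate ^ n / fact n * t ^ n)"
    using sum_jump_exp[of "\<lambda>_. x" "\<lambda>z. z" "\<lambda>_. 1" t] assms by (simp add: jump_power_row_sum)
  also have "\<dots> = exp (rate * t)"
    by (simp add: exp_def power_mult_distrib field_simps)
  finally show ?thesis
    unfolding trans_prob_def by (simp add: sum_distrib_left[symmetric] exp_add[symmetric])
qed

lemma sum_trans_prob_const: "x \<in> S \<Longrightarrow> (\<Sum>y\<in>S. trans_prob t x y * k) = k"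
  by (simp add: sum_distrib_right[symmetric] trans_prob_row_sum)

definition forward_solution :: "(real \<Rightarrow> 'a \<Rightarrow> real) \<Rightarrow> bool" where
  "forward_solution u \<longleftrightarrow> (\<forall>t\<ge>0. \<forall>y\<in>S.
     ((\<lambda>s. u s y) has_real_derivative (\<Sum>x\<in>S. u t x * Q x y)) (at t within {0..}))"

lemma forward_solution_eq:
  assumes u: "forward_solution u" and "0 \<le> t" "y \<in> S"
  shows "u t y = (\<Sum>x\<in>S. u 0 x * trans_prob t x y)"
proof -
  define g where "g s = (\<Sum>z\<in>S. u s z * trans_prob (t - s) z y)" for s
  have "(g has_real_derivative 0) (at s within {0..t})" if s: "s \<in> {0..t}" for s
  proof -
    have kernel_deriv: "((\<lambda>s. trans_prob (t - s) z y) has_real_derivative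
         - (\<Sum>w\<in>S. Q z w * trans_prob (t - s) w y)) (at s within {0..t})" if "z \<in> S" for z
      by (rule DERIV_cong[OF DERIV_chain2[where f = "\<lambda>r. trans_prob r z y" and g = "\<lambda>s. t - s",
              OF trans_prob_backward[OF that \<open>y \<in> S\<close>]]])
        (auto intro!: derivative_eq_intros)
    have u_deriv: "((\<lambda>s. u s z) has_real_derivative (\<Sum>x\<in>S. u s x * Q x z)) (at s within {0..t})"
      if "z \<in> S" for z
      by (rule has_field_derivative_subset[of _ _ _ "{0..}"])
        (use u s that in \<open>auto simp: forward_solution_def\<close>)
    have "(g has_real_derivative (\<Sum>z\<in>S. (\<Sum>x\<in>S. u s x * Q x z) * trans_prob (t - s) z y
         + - (\<Sum>w\<in>S. Q z w * trans_prob (t - s) w y) * u s z)) (at s within {0..t})"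
      unfolding g_def by (intro DERIV_sum DERIV_mult kernel_deriv u_deriv)
    moreover have "(\<Sum>z\<in>S. (\<Sum>x\<in>S. u s x * Q x z) * trans_prob (t - s) z y)
       = (\<Sum>z\<in>S. (\<Sum>w\<in>S. Q z w * trans_prob (t - s) w y) * u s z)"
      by (simp add: sum_distrib_right, subst sum.swap) (simp add: ac_simps)
    ultimately show ?thesis by (simp add: sum_subtractf)
  qed
  then have "\<exists>k. \<forall>s\<in>{0..t}. g s = k"
    by (intro has_field_derivative_zero_constant) auto
  then have "g t = g 0" using \<open>0 \<le> t\<close> by fastforce
  then show ?thesis
    using finite_states \<open>y \<in> S\<close>
    by (simp add: g_def trans_prob_0 if_distrib[of "\<lambda>a. _ * a"] cong: if_cong)
qed

lemma relative_entropy_forward_decreasing: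
  assumes "forward_solution u" "forward_solution v" and "0 \<le> t"
    and "\<And>x. x \<in> S \<Longrightarrow> 0 \<le> u 0 x" "\<And>x. x \<in> S \<Longrightarrow> 0 \<le> v 0 x" "\<And>x. x \<in> S \<Longrightarrow> v 0 x = 0 \<Longrightarrow> u 0 x = 0"
  shows "relative_entropy S (u t) (v t) \<le> relative_entropy S (u 0) (v 0)"
proof -
  have "relative_entropy S (u t) (v t)
      = relative_entropy S (\<lambda>y. \<Sum>x\<in>S. u 0 x * trans_prob t x y) (\<lambda>y. \<Sum>x\<in>S. v 0 x * trans_prob t x y)"
    unfolding relative_entropy_def using assms(1-3)
    by (intro sum.cong) (simp_all add: forward_solution_eq)
  also have "\<dots> \<le> relative_entropy S (u 0) (v 0)"
    using assms by (intro relative_entropy_data_processing finite_states trans_prob_nonneg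
        trans_prob_row_sum)
  finally show ?thesis .
qed

lemma gronwall_expectation:
  assumes x: "x \<in> S" and t: "0 \<le> t"
    and deriv: "\<And>y s. y \<in> S \<Longrightarrow> 0 \<le> s \<Longrightarrow> (f y has_real_derivative f' y s) (at s within {0..})"
    and bound: "\<And>y s. y \<in> S \<Longrightarrow> 0 \<le> s \<Longrightarrow> (\<Sum>z\<in>S. Q y z * f z s) + f' y s \<le> a * f y s"
  shows "(\<Sum>y\<in>S. trans_prob t x y * f y t) \<le> f x 0 * exp (a * t)"
proof -
  define g where "g s = (\<Sum>y\<in>S. trans_prob s x y * f y s)" for s
  define g' where "g' s = (\<Sum>y\<in>S. (\<Sum>z\<in>S. trans_prob s x z * Q z y) * f y s
      + f' y s * trans_prob s x y)" for s
  have "g t \<le> g 0 * exp (a * t)"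
  proof (rule gronwall_exp[OF _ _ t])
    fix s :: real assume s: "0 \<le> s"
    show "(g has_real_derivative g' s) (at s within {0..})"
      unfolding g_def g'_def using x s
      by (intro DERIV_sum DERIV_mult deriv has_field_derivative_at_within[OF trans_prob_forward])
    have "g' s = (\<Sum>y\<in>S. trans_prob s x y * ((\<Sum>z\<in>S. Q y z * f z s) + f' y s))"
    proof -
      have "(\<Sum>y\<in>S. (\<Sum>z\<in>S. trans_prob s x z * Q z y) * f y s)
          = (\<Sum>y\<in>S. trans_prob s x y * (\<Sum>z\<in>S. Q y z * f z s))"
        by (simp add: sum_distrib_right sum_distrib_left mult.assoc, rule sum.swap)
      then show ?thesis by (simp add: g'_def sum.distrib distrib_left mult.commute)
    qed
    also have "\<dots> \<le> (\<Sum>y\<in>S. trans_prob s x y * (a * f y s))"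
      using x s by (intro sum_mono mult_left_mono bound trans_prob_nonneg)
    also have "\<dots> = a * g s" by (simp add: g_def sum_distrib_left mult.left_commute)
    finally show "g' s \<le> a * g s" .
  qed
  moreover have "g 0 = f x 0"
    using x finite_states by (simp add: g_def trans_prob_0 if_distrib[of "\<lambda>a. a * _"] cong: if_cong)
  ultimately show ?thesis by (simp add: g_def)
qed

end

subsection \<open>Flows of Lipschitz vector fields\<close>

lemma integral_has_vector_derivative_atLeast:
  fixes g :: "real \<Rightarrow> 'a::banach"
  assumes g: "continuous_on {a..} g" and "a \<le> t"
  shows "((\<lambda>u. integral {a..u} g) has_vector_derivative g t) (at t within {a..})"
proof -
  have "((\<lambda>u. integral {a..u} g) has_vector_derivative g t) (at t within {a..t + 1})"
    using \<open>a \<le> t\<close> by (intro integral_has_vector_derivative continuous_on_subset[OF g]) auto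
  moreover have "at t within {a..t + 1} = at t within {a..}"
    using \<open>a \<le> t\<close> by (intro at_within_nhd[of _ "{..< t + 1}"]) auto
  ultimately show ?thesis by simp
qed

lemma norm_exp_weighted_integral_le:
  fixes g :: "real \<Rightarrow> 'a::euclidean_space"
  assumes "0 < a" "0 \<le> t" and g: "continuous_on {0..t} g"
    and bound: "\<And>s. s \<in> {0..t} \<Longrightarrow> norm (g s) \<le> B * exp (a * s)"
  shows "norm (exp (- a * t) *\<^sub>R integral {0..t} g) \<le> B / a"
proof -
  have int: "((\<lambda>s. B * exp (a * s)) has_integral (B / a * exp (a * t) - B / a * exp (a * 0))) {0..t}"
    using \<open>0 < a\<close> \<open>0 \<le> t\<close>
    by (intro fundamental_theorem_of_calculus)
       (auto intro!: derivative_eq_intros simp: has_real_derivative_iff_has_vector_derivative[symmetric])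
  have "norm (integral {0..t} g) \<le> B / a * exp (a * t) - B / a"
    using integral_norm_bound_integral[OF integrable_continuous_real[OF g]
        has_integral_integrable[OF int] bound]
    unfolding integral_unique[OF int] by simp
  moreover have "0 \<le> B" using bound[of 0] \<open>0 \<le> t\<close> norm_ge_zero[of "g 0"] by (simp del: norm_ge_zero)
  ultimately have "norm (integral {0..t} g) \<le> B / a * exp (a * t)"
    using \<open>0 < a\<close> divide_nonneg_pos[of B a] by linarith
  then have "exp (- a * t) * norm (integral {0..t} g) \<le> exp (- a * t) * (B / a * exp (a * t))"
    by (intro mult_left_mono) auto
  also have "\<dots> = B / a" by (simp add: exp_minus)
  finally show ?thesis by simp
qed

text \<open>Writing the solution as \<open>x + exp (a t) z t\<close> makes the integral equation a contraction for
  bounded continuous \<open>z\<close> on the whole half-line once \<open>a\<close> exceeds the Lipschitz constant.\<close>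

definition weighted_integrand :: "('a::euclidean_space \<Rightarrow> 'a) \<Rightarrow> 'a \<Rightarrow> real \<Rightarrow>
    (real \<Rightarrow>\<^sub>C 'a) \<Rightarrow> real \<Rightarrow> 'a" where
  "weighted_integrand F x a z s = F (x + exp (a * s) *\<^sub>R apply_bcontfun z s)"

definition weighted_picard :: "('a::euclidean_space \<Rightarrow> 'a) \<Rightarrow> 'a \<Rightarrow> real \<Rightarrow> (real \<Rightarrow>\<^sub>C 'a) \<Rightarrow> real \<Rightarrow> 'a" where
  "weighted_picard F x a z t = exp (- a * max 0 t) *\<^sub>R integral {0..max 0 t} (weighted_integrand F x a z)"

context
  fixes F :: "'a::euclidean_space \<Rightarrow> 'a" and L :: real
  assumes L: "L-lipschitz_on UNIV F"
begin

lemma continuous_on_weighted_integrand: "continuous_on A (weighted_integrand F x a z)"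
  unfolding weighted_integrand_def
  by (intro continuous_on_compose2[OF lipschitz_on_continuous_on[OF L]] continuous_intros) auto

lemma weighted_integrand_lipschitz:
  "norm (weighted_integrand F x a z s - weighted_integrand F x a w s) \<le> L * dist z w * exp (a * s)"
proof -
  have "norm (weighted_integrand F x a z s - weighted_integrand F x a w s)
      \<le> L * norm ((x + exp (a * s) *\<^sub>R z s) - (x + exp (a * s) *\<^sub>R w s))"
    unfolding weighted_integrand_def by (rule lipschitz_on_normD[OF L]) auto
  also have "(x + exp (a * s) *\<^sub>R z s) - (x + exp (a * s) *\<^sub>R w s) = exp (a * s) *\<^sub>R (z s - w s)"
    by (simp add: scaleR_diff_right)
  also have "L * norm \<dots> = L * (exp (a * s) * dist (z s) (w s))" by (simp add: dist_norm)
  also have "\<dots> \<le> L * (exp (a * s) * dist z w)"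
    using lipschitz_on_nonneg[OF L] by (intro mult_left_mono dist_bounded) auto
  finally show ?thesis by (simp add: ac_simps)
qed

lemma weighted_picard_bcontfun:
  assumes "0 < a"
  shows "weighted_picard F x a z \<in> bcontfun"
proof (rule bcontfun_normI)
  have "continuous_on {0..} (\<lambda>t. integral {0..t} (weighted_integrand F x a z))"
    unfolding continuous_on_eq_continuous_within
    by (blast intro: has_vector_derivative_continuous integral_has_vector_derivative_atLeast
        continuous_on_weighted_integrand)
  then have "continuous_on UNIV (\<lambda>t. integral {0..max 0 t} (weighted_integrand F x a z))"
    by (rule continuous_on_compose2) (auto intro!: continuous_intros)
  then show "continuous_on UNIV (weighted_picard F x a z)"
    unfolding weighted_picard_def by (intro continuous_intros)
next
  fix t
  have "norm (weighted_integrand F x a z s) \<le> (norm (F x) + L * norm z) * exp (a * s)" if "0 \<le> s" for s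
  proof -
    have "norm (weighted_integrand F x a z s)
        \<le> norm (weighted_integrand F x a 0 s) + L * norm z * exp (a * s)"
      using weighted_integrand_lipschitz[of x a z s 0]
        norm_triangle_sub[of "weighted_integrand F x a z s" "weighted_integrand F x a 0 s"]
      by (simp add: dist_norm)
    moreover have "norm (F x) * 1 \<le> norm (F x) * exp (a * s)"
      using assms that by (intro mult_left_mono) auto
    ultimately show ?thesis by (simp add: weighted_integrand_def distrib_right)
  qed
  then show "norm (weighted_picard F x a z t) \<le> (norm (F x) + L * norm z) / a"
    unfolding weighted_picard_def
    by (intro norm_exp_weighted_integral_le assms continuous_on_weighted_integrand) auto
qed

lemma weighted_picard_fixed_point:
  assumes "L < a"
  shows "\<exists>z. \<forall>t. apply_bcontfun z t = weighted_picard F x a z t"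
proof -
  have a: "0 < a" "0 \<le> L / a" "L / a < 1" using assms lipschitz_on_nonneg[OF L] by auto
  have "dist (Bcontfun (weighted_picard F x a z)) (Bcontfun (weighted_picard F x a w)) \<le> L / a * dist z w"
    for z w
  proof (rule dist_bound)
    fix t
    have "weighted_picard F x a z t - weighted_picard F x a w t = exp (- a * max 0 t) *\<^sub>R
        integral {0..max 0 t} (\<lambda>s. weighted_integrand F x a z s - weighted_integrand F x a w s)"
      unfolding weighted_picard_def
      by (subst Henstock_Kurzweil_Integration.integral_diff)
        (auto intro: integrable_continuous_real continuous_on_weighted_integrand
          simp: real_vector.scale_right_diff_distrib)
    also have "norm \<dots> \<le> L * dist z w / a"
      by (intro norm_exp_weighted_integral_le a continuous_intros continuous_on_weighted_integrand
          weighted_integrand_lipschitz) auto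
    finally show "dist (Bcontfun (weighted_picard F x a z) t) (Bcontfun (weighted_picard F x a w) t)
        \<le> L / a * dist z w"
      by (simp add: Bcontfun_inverse[OF weighted_picard_bcontfun[OF a(1)]] dist_norm)
  qed
  then have "\<exists>!z. Bcontfun (weighted_picard F x a z) = z"
    using a by (intro banach_fix_type[of "L / a"]) auto
  then obtain z where "Bcontfun (weighted_picard F x a z) = z" by blast
  then have "apply_bcontfun z = weighted_picard F x a z"
    using Bcontfun_inverse[OF weighted_picard_bcontfun[OF a(1)], of x z] by simp
  then show ?thesis by (intro exI[of _ z]) simp
qed

lemma lipschitz_ode_solution_exists:
  "\<exists>y. y 0 = x \<and> (\<forall>t\<ge>0. (y has_vector_derivative F (y t)) (at t within {0..}))"
proof -
  define a where "a = L + 1"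
  obtain z where z: "\<And>t. apply_bcontfun z t = weighted_picard F x a z t"
    using weighted_picard_fixed_point[of a x] by (auto simp: a_def)
  define y where "y t = x + exp (a * t) *\<^sub>R z t" for t
  have integrand: "weighted_integrand F x a z s = F (y s)" for s
    by (simp add: weighted_integrand_def y_def)
  have y_eq: "y t = x + integral {0..t} (weighted_integrand F x a z)" if "0 \<le> t" for t
    using that by (simp add: y_def z weighted_picard_def exp_minus)
  have "(y has_vector_derivative F (y t)) (at t within {0..})" if t: "0 \<le> t" for t
  proof -
    have "((\<lambda>u. x + integral {0..u} (weighted_integrand F x a z)) has_vector_derivative
        0 + weighted_integrand F x a z t) (at t within {0..})"
      by (intro has_vector_derivative_add has_vector_derivative_const
          integral_has_vector_derivative_atLeast continuous_on_weighted_integrand t)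
    then have "((\<lambda>u. x + integral {0..u} (weighted_integrand F x a z)) has_vector_derivative F (y t))
        (at t within {0..})"
      by (simp add: integrand)
    then show ?thesis
      by (rule has_vector_derivative_transform[rotated 2]) (use t y_eq in auto)
  qed
  then show ?thesis using y_eq[of 0] by auto
qed

end

lemma has_real_derivative_norm_square:
  fixes u :: "real \<Rightarrow> 'a::real_inner"
  assumes "(u has_vector_derivative u') (at t within S)"
  shows "((\<lambda>t. (norm (u t))\<^sup>2) has_real_derivative 2 * (u t \<bullet> u')) (at t within S)"
proof -
  have "((\<lambda>t. u t \<bullet> u t) has_derivative (\<lambda>h. u t \<bullet> (h *\<^sub>R u') + (h *\<^sub>R u') \<bullet> u t)) (at t within S)"
    using assms unfolding has_vector_derivative_def by (intro has_derivative_inner)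
  then show ?thesis unfolding has_field_derivative_def power2_norm_eq_inner
    by (rule has_derivative_eq_rhs) (auto simp: inner_commute fun_eq_iff)
qed

lemma lipschitz_on_inner_le:
  fixes F :: "'a::real_inner \<Rightarrow> 'a"
  assumes L: "L-lipschitz_on X F" and "u \<in> X" "v \<in> X"
  shows "(u - v) \<bullet> (F u - F v) \<le> L * (norm (u - v))\<^sup>2"
proof -
  have "(u - v) \<bullet> (F u - F v) \<le> norm (u - v) * norm (F u - F v)" by (rule norm_cauchy_schwarz)
  also have "\<dots> \<le> norm (u - v) * (L * norm (u - v))"
    using assms by (intro mult_left_mono lipschitz_on_normD[OF L]) auto
  finally show ?thesis by (simp add: power2_eq_square mult.left_commute)
qed

lemma lipschitz_ode_solutions_dist:
  fixes F :: "'a::real_inner \<Rightarrow> 'a"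
  assumes L: "L-lipschitz_on X F"
    and y: "\<And>t. 0 \<le> t \<Longrightarrow> y t \<in> X" "\<And>t. 0 \<le> t \<Longrightarrow> (y has_vector_derivative F (y t)) (at t within {0..})"
    and z: "\<And>t. 0 \<le> t \<Longrightarrow> z t \<in> X" "\<And>t. 0 \<le> t \<Longrightarrow> (z has_vector_derivative F (z t)) (at t within {0..})"
    and "0 \<le> t"
  shows "dist (y t) (z t) \<le> exp (L * t) * dist (y 0) (z 0)"
proof -
  have "(norm (y t - z t))\<^sup>2 \<le> (norm (y 0 - z 0))\<^sup>2 * exp (2 * L * t)"
  proof (rule gronwall_exp[OF _ _ \<open>0 \<le> t\<close>])
    fix s :: real assume s: "0 \<le> s"
    show "((\<lambda>s. (norm (y s - z s))\<^sup>2) has_real_derivative 2 * ((y s - z s) \<bullet> (F (y s) - F (z s))))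
        (at s within {0..})"
      by (intro has_real_derivative_norm_square has_vector_derivative_diff y(2) z(2) s)
    show "2 * ((y s - z s) \<bullet> (F (y s) - F (z s))) \<le> 2 * L * (norm (y s - z s))\<^sup>2"
      using lipschitz_on_inner_le[OF L y(1)[OF s] z(1)[OF s]] by simp
  qed
  also have "\<dots> = (exp (L * t) * norm (y 0 - z 0))\<^sup>2"
    by (simp add: power_mult_distrib exp_double[symmetric] mult_ac)
  finally show ?thesis
    unfolding dist_norm by (rule power2_le_imp_le) simp
qed

lemma convex_set_attracted_invariant:
  fixes y z :: "real \<Rightarrow> 'a::euclidean_space"
  assumes C: "closed C" "convex C" and "y 0 \<in> C" and z: "\<And>s. 0 \<le> s \<Longrightarrow> z s \<in> C" and "0 \<le> k"
    and deriv: "\<And>s. 0 \<le> s \<Longrightarrow> (y has_vector_derivative k *\<^sub>R (z s - y s)) (at s within {0..})"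
    and "0 \<le> t"
  shows "y t \<in> C"
proof (rule ccontr)
  assume "y t \<notin> C"
  then obtain n \<beta> where n: "n \<bullet> y t < \<beta>" "\<And>u. u \<in> C \<Longrightarrow> \<beta> < n \<bullet> u"
    using separating_hyperplane_closed_point[OF C(2,1) \<open>y t \<notin> C\<close>] by blast
  have "\<beta> - n \<bullet> y t \<le> (\<beta> - n \<bullet> y 0) * exp (- k * t)"
  proof (rule gronwall_exp[OF _ _ \<open>0 \<le> t\<close>])
    fix s :: real assume s: "0 \<le> s"
    have "((\<lambda>s. n \<bullet> y s) has_vector_derivative n \<bullet> (k *\<^sub>R (z s - y s))) (at s within {0..})"
      by (rule bounded_linear.has_vector_derivative[OF bounded_linear_inner_right deriv[OF s]])
    then show "((\<lambda>s. \<beta> - n \<bullet> y s) has_real_derivative 0 - n \<bullet> (k *\<^sub>R (z s - y s))) (at s within {0..})"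
      unfolding has_real_derivative_iff_has_vector_derivative[symmetric] by (intro DERIV_diff DERIV_const)
    have "k * (\<beta> - n \<bullet> y s) \<le> k * (n \<bullet> z s - n \<bullet> y s)"
      using n(2)[OF z[OF s]] \<open>0 \<le> k\<close> by (intro mult_left_mono) auto
    then show "0 - n \<bullet> (k *\<^sub>R (z s - y s)) \<le> - k * (\<beta> - n \<bullet> y s)" by (simp add: inner_diff_right)
  qed
  moreover have "(\<beta> - n \<bullet> y 0) * exp (- k * t) < 0"
    using n(2)[OF \<open>y 0 \<in> C\<close>] by (simp add: mult_neg_pos)
  ultimately show False using n(1) by simp
qed

lemma convex_ode_solution_exists:
  fixes b :: "'a::euclidean_space \<Rightarrow> 'a"
  assumes C: "closed C" "convex C" and L: "L-lipschitz_on C b"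
    and "0 < h" and inward: "\<And>u. u \<in> C \<Longrightarrow> u + h *\<^sub>R b u \<in> C" and x: "x \<in> C"
  shows "\<exists>y. y 0 = x \<and> (\<forall>t\<ge>0. y t \<in> C \<and> (y has_vector_derivative b (y t)) (at t within {0..}))"
proof -
  define p where "p = closest_point C"
  have p: "p u \<in> C" for u unfolding p_def using C(1) x by (intro closest_point_in_set) auto
  have p_lipschitz: "1-lipschitz_on UNIV p"
    unfolding p_def using closest_point_lipschitz[OF C(2,1)] x by (intro lipschitz_onI) auto
  define F where "F u = b (p u) + (1 / h) *\<^sub>R (p u - u)" for u
  have F_lipschitz: "(L * 1 + 1 / h * (1 + 1))-lipschitz_on UNIV F"
    unfolding F_def using \<open>0 < h\<close> p
    by (intro lipschitz_on_add lipschitz_on_compose2[OF p_lipschitz] lipschitz_on_subset[OF L]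
          lipschitz_on_cmult_nonneg lipschitz_on_diff p_lipschitz lipschitz_on_id) auto
  obtain y where y: "y 0 = x"
    and y_deriv: "\<And>t. 0 \<le> t \<Longrightarrow> (y has_vector_derivative F (y t)) (at t within {0..})"
    using lipschitz_ode_solution_exists[OF F_lipschitz, of x] by blast
  have F_eq: "F u = (1 / h) *\<^sub>R ((p u + h *\<^sub>R b (p u)) - u)" for u
    using \<open>0 < h\<close> by (simp add: F_def algebra_simps)
  have in_C: "y t \<in> C" if "0 \<le> t" for t
    by (rule convex_set_attracted_invariant[where k = "1 / h" and z = "\<lambda>s. p (y s) + h *\<^sub>R b (p (y s))"])
       (use C x y \<open>0 < h\<close> that inward[OF p] y_deriv F_eq in auto)
  have "F u = b u" if "u \<in> C" for u using that by (simp add: F_def p_def closest_point_self)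
  then show ?thesis using y y_deriv in_C by metis
qed

locale semiflow =
  fixes X :: "'a::euclidean_space set" and b :: "'a \<Rightarrow> 'a" and \<Phi> :: "real \<Rightarrow> 'a \<Rightarrow> 'a"
  assumes continuous_flow: "continuous_on ({0..} \<times> UNIV) (\<lambda>(t, x). \<Phi> t x)"
    and flow_in: "0 \<le> t \<Longrightarrow> \<Phi> t x \<in> X"
    and flow_0: "x \<in> X \<Longrightarrow> \<Phi> 0 x = x"
    and flow_ode: "0 \<le> t \<Longrightarrow> ((\<lambda>t. \<Phi> t x) has_vector_derivative b (\<Phi> t x)) (at t within {0..})"
begin

lemma continuous_flow_time: "continuous_on {0..} (\<lambda>t. \<Phi> t x)"
  using flow_ode
  by (auto simp: continuous_on_eq_continuous_within intro: has_vector_derivative_continuous)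

lemma continuous_flow_space:
  assumes "0 \<le> t"
  shows "continuous_on A (\<Phi> t)"
proof -
  have "continuous_on A (\<lambda>x. case (t, x) of (t, x) \<Rightarrow> \<Phi> t x)"
    by (rule continuous_on_compose2[OF continuous_flow]) (use assms in \<open>auto intro!: continuous_intros\<close>)
  then show ?thesis by simp
qed

end

text \<open>Points outside \<open>C\<close> are first projected to \<open>C\<close>, so that the flow is defined everywhere and
  takes values in \<open>C\<close> only.\<close>

lemma semiflow_exists:
  fixes b :: "'a::euclidean_space \<Rightarrow> 'a"
  assumes C: "closed C" "convex C" "C \<noteq> {}" and L: "L-lipschitz_on C b"
    and "0 < h" and inward: "\<And>x. x \<in> C \<Longrightarrow> x + h *\<^sub>R b x \<in> C"
  shows "\<exists>\<Phi>. semiflow C b \<Phi>"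
proof -
  have "\<forall>x\<in>C. \<exists>y. y 0 = x \<and> (\<forall>t\<ge>0. y t \<in> C \<and> (y has_vector_derivative b (y t)) (at t within {0..}))"
    using convex_ode_solution_exists[OF C(1,2) L \<open>0 < h\<close> inward] by blast
  then obtain Y where Y: "\<And>x. x \<in> C \<Longrightarrow> Y x 0 = x" "\<And>x t. x \<in> C \<Longrightarrow> 0 \<le> t \<Longrightarrow> Y x t \<in> C"
    and Y_deriv: "\<And>x t. x \<in> C \<Longrightarrow> 0 \<le> t \<Longrightarrow> (Y x has_vector_derivative b (Y x t)) (at t within {0..})"
    by metis
  define p where "p = closest_point C"
  have p: "p x \<in> C" for x unfolding p_def using C by (intro closest_point_in_set)
  have Y_lipschitz: "(exp (L * t))-lipschitz_on A (\<lambda>x. Y (p x) t)" if "0 \<le> t" for t A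
  proof (rule lipschitz_onI)
    fix x z
    have "dist (Y (p x) t) (Y (p z) t) \<le> exp (L * t) * dist (Y (p x) 0) (Y (p z) 0)"
      using that by (intro lipschitz_ode_solutions_dist[OF L] Y p Y_deriv)
    also have "\<dots> \<le> exp (L * t) * dist x z"
      unfolding Y(1)[OF p] unfolding p_def by (intro mult_left_mono closest_point_lipschitz C) auto
    finally show "dist (Y (p x) t) (Y (p z) t) \<le> exp (L * t) * dist x z" .
  qed simp
  have "(exp (L * (t + 1)))-lipschitz_on A (\<lambda>x. Y (p x) s)" if "s \<in> cball t 1 \<inter> {0..}" for s t A
  proof (rule lipschitz_on_mono[OF _ subset_refl])
    have s: "0 \<le> s" "s \<le> t + 1" using that by (auto simp: dist_real_def)
    show "(exp (L * s))-lipschitz_on A (\<lambda>x. Y (p x) s)" by (rule Y_lipschitz[OF s(1)])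
    show "exp (L * s) \<le> exp (L * (t + 1))"
      using s lipschitz_on_nonneg[OF L] by (simp add: mult_left_mono)
  qed
  then have "local_lipschitz {0..} UNIV (\<lambda>t x. Y (p x) t)"
    unfolding local_lipschitz_def using zero_less_one by blast
  moreover have "continuous_on {0..} (\<lambda>t. Y (p x) t)" for x
    using Y_deriv[OF p]
    by (auto simp: continuous_on_eq_continuous_within intro: has_vector_derivative_continuous)
  ultimately have "continuous_on ({0..} \<times> UNIV) (\<lambda>(t, x). Y (p x) t)"
    by (intro continuous_on_TimesI)
  then have "semiflow C b (\<lambda>t x. Y (p x) t)"
    using Y p Y_deriv by unfold_locales (auto simp: p_def closest_point_self)
  then show ?thesis by (rule exI[of "semiflow C b" "\<lambda>t x. Y (p x) t"])
qed

subsection \<open>Measures transported by a flow\<close>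

locale transported_measure = semiflow X b \<Phi> + prob_space M
  for X :: "'a::euclidean_space set" and b \<Phi> and M :: "'a measure" +
  assumes compact_X: "compact X" and continuous_b: "continuous_on X b"
    and sets_M [measurable_cong, simp]: "sets M = sets borel"
    and AE_in_X: "AE x in M. x \<in> X"
begin

definition transport :: "real \<Rightarrow> 'a measure" where
  "transport t = distr M borel (\<Phi> t)"

lemma space_M [simp]: "space M = UNIV"
  using sets_eq_imp_space_eq[OF sets_M] by simp

lemma borel_X: "X \<in> sets borel"
  by (simp add: compact_X compact_imp_closed borel_closed)

lemma measurable_M: "f \<in> measurable M N \<longleftrightarrow> f \<in> measurable borel N"
  by (simp add: measurable_cong_sets[OF sets_M refl])

lemma measurable_flow: "0 \<le> t \<Longrightarrow> \<Phi> t \<in> borel_measurable M"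
  by (simp add: measurable_M borel_measurable_continuous_onI continuous_flow_space)

lemma integral_transport:
  fixes f :: "'a \<Rightarrow> real"
  assumes "0 \<le> t" "f \<in> borel_measurable borel"
  shows "integral\<^sup>L (transport t) f = (LINT x|M. f (\<Phi> t x))"
  unfolding transport_def using assms measurable_flow by (intro integral_distr) auto

lemma set_integral_transport:
  fixes f :: "'a \<Rightarrow> real"
  assumes "0 \<le> t" "continuous_on X f"
  shows "(LINT x:X|transport t. f x) = (LINT x|M. f (\<Phi> t x))"
proof -
  have "(\<lambda>x. indicator X x *\<^sub>R f x) \<in> borel_measurable borel"
    using borel_X assms(2) by (rule borel_measurable_continuous_on_indicator)
  then show ?thesis
    unfolding set_lebesgue_integral_def using assms(1) by (simp add: integral_transport flow_in)
qed

lemma integrable_flow: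
  fixes f :: "'a \<Rightarrow> real"
  assumes "0 \<le> t" and f: "continuous_on X f"
  shows "integrable M (\<lambda>x. f (\<Phi> t x))"
proof -
  obtain B where "\<And>x. x \<in> X \<Longrightarrow> norm (f x) \<le> B"
    using continuous_on_compact_bound[OF compact_X f] by blast
  moreover have "continuous_on UNIV (\<lambda>x. f (\<Phi> t x))"
    using assms by (intro continuous_on_compose2[OF f] continuous_flow_space) (auto simp: flow_in)
  ultimately show ?thesis
    using assms(1) flow_in
    by (intro integrable_const_bound[of _ B])
       (auto simp: borel_measurable_continuous_onI measurable_M)
qed

lemma prob_space_transport: "0 \<le> t \<Longrightarrow> prob_space (transport t)"
  unfolding transport_def by (intro prob_space_distr measurable_flow)

lemma sets_transport [simp]: "sets (transport t) = sets borel"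
  by (simp add: transport_def)

lemma emeasure_transport: "0 \<le> t \<Longrightarrow> emeasure (transport t) X = 1"
  unfolding transport_def using emeasure_space_1
  by (simp add: emeasure_distr measurable_flow borel_X flow_in vimage_def)

lemma transport_0: "transport 0 = M"
proof -
  have "transport 0 = distr M borel (\<lambda>x. x)"
    unfolding transport_def
  proof (rule distr_cong_AE)
    show "AE x in M. \<Phi> 0 x = x" using AE_in_X by eventually_elim (rule flow_0)
  qed (simp_all add: measurable_M measurable_flow[unfolded measurable_M])
  also have "\<dots> = M" by (rule distr_id2) simp
  finally show ?thesis .
qed

lemma transport_weakly_continuous:
  fixes f :: "'a \<Rightarrow> real"
  assumes "0 \<le> s" and f: "continuous_on UNIV f"
  shows "((\<lambda>t. integral\<^sup>L (transport t) f) \<longlongrightarrow> integral\<^sup>L (transport s) f) (at s within {0..})"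
  unfolding tendsto_at_iff_sequentially comp_def
proof (intro allI impI)
  fix t :: "nat \<Rightarrow> real"
  assume t: "\<forall>i. t i \<in> {0..} - {s}" "t \<longlonglongrightarrow> s"
  have fX: "continuous_on X f" using f continuous_on_subset by blast
  obtain B where B: "\<And>x. x \<in> X \<Longrightarrow> norm (f x) \<le> B"
    using continuous_on_compact_bound[OF compact_X fX] by blast
  have "(\<lambda>i. LINT x|M. f (\<Phi> (t i) x)) \<longlonglongrightarrow> (LINT x|M. f (\<Phi> s x))"
  proof (rule integral_dominated_convergence[where w = "\<lambda>_. B"])
    show "AE x in M. (\<lambda>i. f (\<Phi> (t i) x)) \<longlonglongrightarrow> f (\<Phi> s x)"
      using t \<open>0 \<le> s\<close>
      by (intro AE_I2 continuous_on_tendsto_compose[OF f]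
          continuous_on_tendsto_compose[OF continuous_flow_time]) auto
  qed (use t \<open>0 \<le> s\<close> B in
      \<open>auto simp: flow_in intro!: borel_measurable_integrable integrable_flow[OF _ fX]\<close>)
  then show "(\<lambda>i. integral\<^sup>L (transport (t i)) f) \<longlonglongrightarrow> integral\<^sup>L (transport s) f"
    using t \<open>0 \<le> s\<close> by (simp add: integral_transport borel_measurable_continuous_onI[OF f])
qed

end

locale transported_test_function = transported_measure +
  fixes \<phi> :: "real \<times> 'a \<Rightarrow> real" and \<phi>' :: "real \<times> 'a \<Rightarrow> (real \<times> 'a) \<Rightarrow>\<^sub>L real" and a T :: real
  assumes has_derivative_test: "(\<phi> has_derivative blinfun_apply (\<phi>' p)) (at p)"
    and continuous_test: "continuous_on UNIV \<phi>'"
    and time_bounds: "0 < a" "a \<le> T"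
    and test_eq_0: "t \<notin> {a<..<T} \<Longrightarrow> \<phi> (t, x) = 0" "t \<notin> {a<..<T} \<Longrightarrow> \<phi>' (t, x) = 0"
begin

definition material_derivative :: "real \<Rightarrow> 'a \<Rightarrow> real" where
  "material_derivative t x = blinfun_apply (\<phi>' (t, \<Phi> t x)) (1, b (\<Phi> t x))"

lemma continuous_test_derivative:
  "continuous_on ({0..} \<times> X) (\<lambda>(t, x). blinfun_apply (\<phi>' (t, x)) (1, b x))"
  unfolding case_prod_unfold
  by (intro continuous_intros continuous_on_compose2[OF continuous_test]
      continuous_on_compose2[OF continuous_b]) auto

lemma continuous_material_derivative:
  "continuous_on ({0..} \<times> UNIV) (\<lambda>p. material_derivative (fst p) (snd p))"
proof -
  have "continuous_on ({0..} \<times> UNIV) (\<lambda>p. (fst p, \<Phi> (fst p) (snd p)))"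
    using continuous_flow by (intro continuous_intros) (simp add: case_prod_unfold)
  then have "continuous_on ({0..} \<times> UNIV)
      (\<lambda>p. (\<lambda>(t, x). blinfun_apply (\<phi>' (t, x)) (1, b x)) (fst p, \<Phi> (fst p) (snd p)))"
    by (rule continuous_on_compose2[OF continuous_test_derivative]) (auto simp: flow_in)
  then show ?thesis by (simp add: material_derivative_def)
qed

lemma material_derivative_eq_0: "t \<notin> {a..T} \<Longrightarrow> material_derivative t x = 0"
  using test_eq_0(2)[of t "\<Phi> t x"] by (auto simp: material_derivative_def)

lemma material_derivative_bounded: "\<exists>B. \<forall>t x. norm (material_derivative t x) \<le> B"
proof -
  have "continuous_on ({a..T} \<times> X) (\<lambda>(t, x). blinfun_apply (\<phi>' (t, x)) (1, b x))"
    using time_bounds by (intro continuous_on_subset[OF continuous_test_derivative]) auto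
  then obtain B where B: "\<And>p. p \<in> {a..T} \<times> X
      \<Longrightarrow> norm (case p of (t, x) \<Rightarrow> blinfun_apply (\<phi>' (t, x)) (1, b x)) \<le> B"
    using continuous_on_compact_bound[OF compact_Times[OF compact_Icc compact_X]] by blast
  have "norm (material_derivative t x) \<le> max B 0" for t x
    using time_bounds flow_in[of t x] material_derivative_eq_0[of t x] B[of "(t, \<Phi> t x)"]
    by (cases "t \<in> {a..T}") (auto simp: material_derivative_def le_max_iff_disj)
  then show ?thesis by blast
qed

lemma material_derivative_integral_eq_0: "(LINT t|lborel. material_derivative t x) = 0"
proof -
  have "(LINT t|lborel. material_derivative t x)
      = (LBINT t. indicator {a..T} t *\<^sub>R material_derivative t x)"
    using material_derivative_eq_0 by (intro Bochner_Integration.integral_cong) (auto simp: indicator_def)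
  also have "\<dots> = \<phi> (T, \<Phi> T x) - \<phi> (a, \<Phi> a x)"
  proof (rule integral_FTC_atLeastAtMost[where F = "\<lambda>t. \<phi> (t, \<Phi> t x)"])
    fix t assume t: "a \<le> t" "t \<le> T"
    have "((\<lambda>t. \<Phi> t x) has_vector_derivative b (\<Phi> t x)) (at t within {a..T})"
      using t time_bounds by (intro has_vector_derivative_within_subset[OF flow_ode]) auto
    then have "((\<lambda>t. (t, \<Phi> t x)) has_derivative (\<lambda>h. (h, h *\<^sub>R b (\<Phi> t x)))) (at t within {a..T})"
      unfolding has_vector_derivative_def by (intro has_derivative_Pair has_derivative_ident)
    then have "((\<lambda>t. \<phi> (t, \<Phi> t x)) has_derivative
        (\<lambda>h. blinfun_apply (\<phi>' (t, \<Phi> t x)) (h, h *\<^sub>R b (\<Phi> t x)))) (at t within {a..T})"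
      by (rule has_derivative_compose[where f = "\<lambda>t. (t, \<Phi> t x)", OF _ has_derivative_test])
    moreover have "blinfun_apply (\<phi>' (t, \<Phi> t x)) (h, h *\<^sub>R b (\<Phi> t x))
        = h *\<^sub>R material_derivative t x" for h
      using blinfun.scaleR_right[of "\<phi>' (t, \<Phi> t x)" h "(1, b (\<Phi> t x))"]
      by (simp add: material_derivative_def)
    ultimately show "((\<lambda>t. \<phi> (t, \<Phi> t x))
        has_vector_derivative material_derivative t x) (at t within {a..T})"
      unfolding has_vector_derivative_def by simp
  next
    have "continuous_on {a..T} (\<lambda>t. (\<lambda>p. material_derivative (fst p) (snd p)) (t, x))"
      using time_bounds
      by (intro continuous_on_compose2[OF continuous_material_derivative])
          (auto intro!: continuous_intros)
    then show "continuous_on {a..T} (\<lambda>t. material_derivative t x)" by simp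
  qed (rule time_bounds)
  also have "\<dots> = 0" by (simp add: test_eq_0)
  finally show ?thesis .
qed

lemma integrable_material_derivative: "integrable (lborel \<Otimes>\<^sub>M M) (\<lambda>(t, x). material_derivative t x)"
proof -
  obtain B where B: "\<And>t x. norm (material_derivative t x) \<le> B" using material_derivative_bounded by blast
  have sets_prod: "sets (lborel \<Otimes>\<^sub>M M) = sets (borel :: (real \<times> 'a) measure)"
    unfolding borel_prod[symmetric] by (intro sets_pair_measure_cong) auto
  have strip: "{a..T} \<times> (UNIV :: 'a set) \<in> sets borel" by (intro borel_closed closed_Times) auto
  show ?thesis
  proof (rule integrableI_bounded_set[where A = "{a..T} \<times> UNIV" and B = B])
    have "(\<lambda>p. indicator ({a..T} \<times> UNIV) p *\<^sub>R material_derivative (fst p) (snd p))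
        \<in> borel_measurable borel"
      using strip time_bounds
      by (intro borel_measurable_continuous_on_indicator
          continuous_on_subset[OF continuous_material_derivative]) auto
    moreover have "(\<lambda>p. indicator ({a..T} \<times> UNIV) p *\<^sub>R material_derivative (fst p) (snd p))
        = (\<lambda>(t, x). material_derivative t x)"
      using material_derivative_eq_0 by (auto simp: fun_eq_iff indicator_def)
    ultimately show "(\<lambda>(t, x). material_derivative t x) \<in> borel_measurable (lborel \<Otimes>\<^sub>M M)"
      by (simp add: measurable_cong_sets[OF sets_prod refl])
    have "emeasure (lborel \<Otimes>\<^sub>M M) ({a..T} \<times> UNIV) = emeasure lborel {a..T} * emeasure M UNIV"
      by (rule emeasure_pair_measure_Times) auto
    then show "emeasure (lborel \<Otimes>\<^sub>M M) ({a..T} \<times> UNIV) < \<infinity>"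
      using emeasure_space_1 time_bounds by (simp add: ennreal_mult_less_top)
    show "AE p in lborel \<Otimes>\<^sub>M M. p \<notin> {a..T} \<times> UNIV \<longrightarrow> (case p of (t, x) \<Rightarrow> material_derivative t x) = 0"
      by (intro AE_I2)
         (use material_derivative_eq_0 in \<open>simp only: mem_Times_iff case_prod_unfold, blast\<close>)
    show "{a..T} \<times> UNIV \<in> sets (lborel \<Otimes>\<^sub>M M)" unfolding sets_prod by (rule strip)
    show "AE p in lborel \<Otimes>\<^sub>M M. p \<in> {a..T} \<times> UNIV \<longrightarrow> norm (case p of (t, x) \<Rightarrow> material_derivative t x) \<le> B"
      using B by (intro AE_I2) (simp add: case_prod_unfold)
  qed
qed

lemma liouville_equation:
  "(LBINT t:{0<..}. (LINT x:X|transport t. blinfun_apply (\<phi>' (t, x)) (1, b x))) = 0"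
proof -
  interpret pair_sigma_finite lborel M by unfold_locales
  have "(LBINT t:{0<..}. (LINT x:X|transport t. blinfun_apply (\<phi>' (t, x)) (1, b x)))
      = (LINT t|lborel. LINT x|M. material_derivative t x)"
    unfolding set_lebesgue_integral_def[of lborel]
  proof (intro Bochner_Integration.integral_cong refl)
    fix t :: real
    have "(LINT x:X|transport t. blinfun_apply (\<phi>' (t, x)) (1, b x))
        = (LINT x|M. material_derivative t x)"
      if "0 < t"
      unfolding material_derivative_def using that
      by (intro set_integral_transport continuous_intros continuous_b
          continuous_on_compose2[OF continuous_test]) auto
    then show "indicator {0<..} t *\<^sub>R (LINT x:X|transport t. blinfun_apply (\<phi>' (t, x)) (1, b x))
        = (LINT x|M. material_derivative t x)"
      using material_derivative_eq_0[of t] time_bounds by (cases "0 < t") auto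
  qed
  also have "\<dots> = (LINT x|M. LINT t|lborel. material_derivative t x)"
    by (rule Fubini_integral[OF integrable_material_derivative, symmetric])
  also have "\<dots> = 0" by (simp add: material_derivative_integral_eq_0)
  finally show ?thesis .
qed

end

subsection \<open>The simplex and empirical measures\<close>

lemma convex_PX: "convex (PX :: (real^'x::finite) set)"
  unfolding convex_def PX_def
  by (auto simp: sum.distrib sum_distrib_left[symmetric] intro!: add_nonneg_nonneg)

lemma PX_nth_bounds:
  assumes "\<mu> \<in> PX"
  shows "0 \<le> \<mu> $ x" "\<mu> $ x \<le> 1"
proof -
  show "0 \<le> \<mu> $ x" using assms by (simp add: PX_def)
  have "\<mu> $ x \<le> (\<Sum>x\<in>UNIV. \<mu> $ x)" using assms by (intro member_le_sum) (auto simp: PX_def)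
  then show "\<mu> $ x \<le> 1" using assms by (simp add: PX_def)
qed

lemma compact_PX: "compact (PX :: (real^'x::finite) set)"
  unfolding compact_eq_bounded_closed
proof
  have "norm \<mu> \<le> 1" if "\<mu> \<in> PX" for \<mu> :: "real^'x"
    using norm_le_l1_cart[of \<mu>] that by (simp add: PX_def)
  then show "bounded (PX :: (real^'x) set)" by (auto simp: bounded_iff)
  have "PX = (\<Inter>x. {\<mu>::real^'x. 0 \<le> \<mu> $ x}) \<inter> {\<mu>. (\<Sum>x\<in>UNIV. \<mu> $ x) = 1}"
    by (auto simp: PX_def)
  also have "closed \<dots>"
    by (intro closed_Int closed_INT ballI closed_Collect_le closed_Collect_eq continuous_intros)
  finally show "closed (PX :: (real^'x) set)" .
qed

lemma finite_configs [simp]: "finite (configs N)"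
  unfolding configs_def by (intro finite_PiE) auto

lemma configs_nonempty: "configs N \<noteq> {}"
  by (simp add: configs_def PiE_eq_empty_iff)

lemma configs_upd: "c \<in> configs N \<Longrightarrow> i < N \<Longrightarrow> c(i := y) \<in> configs N"
  unfolding configs_def by (auto simp: PiE_def extensional_def)

lemma LN_nth_sum: "LN N c $ x = (\<Sum>j<N. if c j = x then 1 else 0) / real N"
proof -
  have "(\<Sum>j<N. if c j = x then 1 else 0) = real (card {i \<in> {..<N}. c i = x})"
    by (subst sum.inter_filter[symmetric]) simp_all
  then show ?thesis by (simp add: LN_def)
qed

lemma sum_sites_eq_LN:
  fixes f :: "'x::finite \<Rightarrow> real"
  assumes "0 < N"
  shows "(\<Sum>i<N. f (c i)) = real N * (\<Sum>x\<in>UNIV. LN N c $ x * f x)"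
proof -
  have "real N * (\<Sum>x\<in>UNIV. LN N c $ x * f x) = (\<Sum>x\<in>UNIV. \<Sum>j<N. if c j = x then f x else 0)"
    using assms
    by (simp add: LN_nth_sum sum_distrib_left sum_distrib_right sum_divide_distrib
        if_distrib[of "\<lambda>a. a * _"] cong: if_cong)
  also have "\<dots> = (\<Sum>j<N. \<Sum>x\<in>UNIV. if c j = x then f x else 0)" by (rule sum.swap)
  finally show ?thesis by simp
qed

lemma LN_in_PX:
  assumes "0 < N"
  shows "LN N c \<in> PX"
  using sum_sites_eq_LN[OF assms, of "\<lambda>_. 1" c] assms by (auto simp: PX_def LN_def)

lemma PX_nonempty: "(PX :: (real^'x::finite) set) \<noteq> {}"
  using LN_in_PX[of 1] by auto

lemma LN_upd:
  assumes "i < N"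
  shows "LN N (c(i := y)) = LN N c + (1 / real N) *\<^sub>R (axis y 1 - axis (c i) 1)"
proof (rule vec_eq_iff[THEN iffD2], rule)
  fix x
  have "(\<Sum>j<N. if (c(i := y)) j = x then 1 else (0::real))
      = (if y = x then 1 else 0) + (\<Sum>j\<in>{..<N} - {i}. if c j = x then 1 else 0)"
    using assms by (subst sum.remove[of _ i]) (auto intro!: sum.cong)
  also have "(\<Sum>j\<in>{..<N} - {i}. if c j = x then 1 else 0)
      = (\<Sum>j<N. if c j = x then 1 else 0) - (if c i = x then 1 else (0::real))"
    using assms by (subst sum.remove[of "{..<N}" i]) auto
  finally show "LN N (c(i := y)) $ x = (LN N c + (1 / real N) *\<^sub>R (axis y 1 - axis (c i) 1)) $ x"
    unfolding LN_nth_sum vector_add_component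
    by (auto simp: axis_def add_divide_distrib diff_divide_distrib)
qed

lemma count_mset_map_upt: "count (mset (map c [0..<N])) x = card {i \<in> {..<N}. c i = x}"
proof -
  have "count (mset (map c [0..<N])) x = card {i. i < N \<and> map c [0..<N] ! i = x}"
    unfolding count_mset count_list_eq_length_filter length_filter_conv_card
    by (rule arg_cong[of _ _ card]) auto
  also have "{i. i < N \<and> map c [0..<N] ! i = x} = {i \<in> {..<N}. c i = x}" by auto
  finally show ?thesis .
qed

lemma LN_eq_iff_mset:
  assumes "0 < N"
  shows "LN N c = LN N c' \<longleftrightarrow> mset (map c [0..<N]) = mset (map c' [0..<N])"
  unfolding multiset_eq_iff count_mset_map_upt using assms by (simp add: LN_def vec_eq_iff)

lemma configs_of_list:
  assumes "length xs = N"
  shows "\<exists>c\<in>configs N. map c [0..<N] = xs"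
proof
  show "restrict ((!) xs) {..<N} \<in> configs N" by (simp add: configs_def)
  show "map (restrict ((!) xs) {..<N}) [0..<N] = xs"
    using assms by (intro nth_equalityI) auto
qed

lemma configs_eqI:
  assumes "c \<in> configs N" "c' \<in> configs N" "map c [0..<N] = map c' [0..<N]"
  shows "c = c'"
  using assms by (intro extensionalityI[of _ "{..<N}"]) (auto simp: configs_def PiE_def)

lemma ex_config_with_counts:
  fixes n :: "'x::finite \<Rightarrow> nat"
  assumes "(\<Sum>x\<in>UNIV. n x) = N"
  shows "\<exists>c\<in>configs N. \<forall>x. LN N c $ x = real (n x) / real N"
proof -
  define A where "A = (\<Sum>x\<in>UNIV. replicate_mset (n x) x)"
  obtain xs where xs: "mset xs = A" using ex_mset by blast
  have "size A = N" using assms by (simp add: A_def size_multiset_sum)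
  then have "length xs = N" using xs by (metis size_mset)
  then obtain c where c: "c \<in> configs N" "map c [0..<N] = xs" using configs_of_list by metis
  have "card {i \<in> {..<N}. c i = x} = n x" for x
    using count_mset_map_upt[of c N x] unfolding c(2) xs A_def by (simp add: count_sum)
  then show ?thesis using c(1) by (auto simp: LN_def)
qed

lemma ex_rounding_of_PX:
  fixes \<nu> :: "real^'x::finite"
  assumes \<nu>: "\<nu> \<in> PX"
  shows "\<exists>n :: 'x \<Rightarrow> nat. (\<Sum>x\<in>UNIV. n x) = N \<and> (\<forall>x. \<bar>real (n x) - real N * \<nu> $ x\<bar> \<le> CARD('x))"
proof -
  define a :: 'x where "a = undefined"
  define k where "k x = nat \<lfloor>real N * \<nu> $ x\<rfloor>" for x
  have k: "real (k x) \<le> real N * \<nu> $ x" "real N * \<nu> $ x \<le> real (k x) + 1" for x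
    using PX_nth_bounds(1)[OF \<nu>, of x] unfolding k_def by (auto simp: of_nat_nat)
  have N: "(\<Sum>x\<in>UNIV. real N * \<nu> $ x) = real N"
    using \<nu> by (simp add: PX_def sum_distrib_left[symmetric])
  have lower: "real (\<Sum>x\<in>UNIV. k x) \<le> real N"
    using sum_mono[of UNIV "\<lambda>x. real (k x)" "\<lambda>x. real N * \<nu> $ x"] k N by simp
  have upper: "real N \<le> real (\<Sum>x\<in>UNIV. k x) + CARD('x)"
    using sum_mono[of UNIV "\<lambda>x. real N * \<nu> $ x" "\<lambda>x. real (k x) + 1"] k N by (simp add: sum.distrib)
  define r where "r = N - (\<Sum>x\<in>UNIV. k x)"
  have r: "real r = real N - real (\<Sum>x\<in>UNIV. k x)"
    unfolding r_def using lower by (simp add: of_nat_diff del: of_nat_sum)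
  define n where "n x = k x + (if x = a then r else 0)" for x
  have "(\<Sum>x\<in>UNIV. n x) = (\<Sum>x\<in>UNIV. k x) + r" by (simp add: n_def sum.distrib)
  then have "(\<Sum>x\<in>UNIV. n x) = N" using lower by (simp add: r_def)
  moreover have "\<bar>real (n x) - real N * \<nu> $ x\<bar> \<le> CARD('x)" for x
  proof -
    have "1 \<le> real (CARD('x))" by (simp add: Suc_leI)
    then show ?thesis
      unfolding abs_le_iff n_def using k[of x] r lower upper
      by (cases "x = a") (simp_all only: if_True if_False simp_thms of_nat_add of_nat_0, linarith+)
  qed
  ultimately show ?thesis by blast
qed

lemma empirical_measures_dense:
  fixes \<nu> :: "real^'x::finite"
  assumes "\<nu> \<in> PX"
  shows "\<exists>c. (\<forall>N. c N \<in> configs N) \<and> (\<lambda>N. LN N (c N)) \<longlonglongrightarrow> \<nu>"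
proof -
  obtain n :: "nat \<Rightarrow> 'x \<Rightarrow> nat" where n: "\<And>N. (\<Sum>x\<in>UNIV. n N x) = N"
    "\<And>N x. \<bar>real (n N x) - real N * \<nu> $ x\<bar> \<le> CARD('x)"
    using ex_rounding_of_PX[OF assms] by metis
  then have "\<forall>N. \<exists>c\<in>configs N. \<forall>x. LN N c $ x = real (n N x) / real N"
    by (intro allI ex_config_with_counts)
  then obtain c where c: "\<And>N. c N \<in> configs N" "\<And>N x. LN N (c N) $ x = real (n N x) / real N"
    by metis
  have "(\<lambda>N. LN N (c N) $ x - \<nu> $ x) \<longlonglongrightarrow> 0" for x
  proof (rule Lim_null_comparison[OF _ lim_const_over_n])
    show "\<forall>\<^sub>F N in sequentially. norm (LN N (c N) $ x - \<nu> $ x) \<le> real CARD('x) / real N"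
      using eventually_gt_at_top[of 0]
    proof eventually_elim
      case (elim N)
      then have "LN N (c N) $ x - \<nu> $ x = (real (n N x) - real N * \<nu> $ x) / real N"
        by (simp add: c(2) field_simps)
      then show ?case using n(2)[of N x] by (simp add: abs_divide divide_right_mono)
    qed
  qed
  then have "(\<lambda>N. LN N (c N)) \<longlonglongrightarrow> \<nu>" by (intro vec_tendstoI) (simp add: LIM_zero_iff)
  then show ?thesis using c(1) by blast
qed

subsection \<open>Method of types\<close>

lemma ln_fact_lower: "real n * ln (real n) - real n \<le> ln (fact n)"
proof (induction n)
  case (Suc n)
  show ?case
  proof (cases "n = 0")
    case False
    then have n: "0 < real n" by simp
    have "ln (1 + 1 / real n) \<le> 1 / real n" using n by (intro ln_add_one_self_le_self) simp
    moreover have "1 + 1 / real n = real (Suc n) / real n" using n by (simp add: field_simps)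
    ultimately have "ln (real (Suc n)) - ln (real n) \<le> 1 / real n" using n by (simp add: ln_div)
    then have "real n * (ln (real (Suc n)) - ln (real n)) \<le> 1" using n by (simp add: field_simps)
    moreover have "ln (fact (Suc n) :: real) = ln (real (Suc n)) + ln (fact n)"
      by (simp add: ln_mult del: of_nat_Suc)
    ultimately show ?thesis using Suc by (simp add: algebra_simps)
  qed simp
qed simp

lemma ln_fact_upper:
  assumes "n \<noteq> 0"
  shows "ln (fact n) \<le> (real n + 1) * ln (real n) - real n + 1"
proof -
  from assms have "1 \<le> n" by simp
  then show ?thesis
  proof (induction n rule: dec_induct)
    case (step n)
    then have n: "0 < real n" by simp
    have "ln (real n / real (Suc n)) \<le> real n / real (Suc n) - 1"
      using n by (intro ln_le_minus_one) simp
    then have "ln (real n) - ln (real (Suc n)) \<le> - 1 / real (Suc n)"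
      using n by (simp add: ln_div field_simps)
    then have "(real n + 1) * (ln (real n) - ln (real (Suc n))) \<le> - 1"
      by (simp add: field_simps)
    moreover have "ln (fact (Suc n) :: real) = ln (real (Suc n)) + ln (fact n)"
      by (simp add: ln_mult del: of_nat_Suc)
    ultimately show ?case using step by (simp add: algebra_simps)
  qed simp
qed

lemma ln_fact_upper_uniform:
  assumes "n \<le> N"
  shows "ln (fact n) \<le> real n * ln (real n) - real n + (1 + ln (real N + 1))"
proof (cases "n = 0")
  case False
  have "ln (real n) \<le> ln (real N + 1)" using False assms by (intro ln_mono) auto
  then show ?thesis using ln_fact_upper[OF False] by (simp add: algebra_simps)
qed simp

lemma continuous_on_x_ln_x: "continuous_on {0..} (\<lambda>x::real. x * ln x)"
  unfolding continuous_on_def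
proof (intro ballI)
  fix x :: real assume x: "x \<in> {0..}"
  show "((\<lambda>x. x * ln x) \<longlongrightarrow> x * ln x) (at x within {0..})"
  proof (cases "x = 0")
    case True
    have "((\<lambda>x::real. x * ln x) \<longlongrightarrow> 0) (at_right 0)" by real_asymp
    moreover have "at (0::real) within {0..} = at_right 0"
      unfolding at_within_def by (rule arg_cong[of _ _ "\<lambda>S. inf (nhds 0) (principal S)"]) auto
    ultimately show ?thesis using True by simp
  next
    case False
    with x have "isCont (\<lambda>x. x * ln x) x" by (auto intro!: continuous_intros)
    then show ?thesis unfolding isCont_def by (rule tendsto_within_subset) simp
  qed
qed

definition shannon :: "real^'x::finite \<Rightarrow> real" where
  "shannon \<mu> = - (\<Sum>x\<in>UNIV. \<mu> $ x * ln (\<mu> $ x))"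

lemma continuous_on_shannon: "continuous_on PX shannon"
  unfolding shannon_def
  by (intro continuous_intros continuous_on_compose2[OF continuous_on_x_ln_x])
     (auto simp: PX_nth_bounds)

definition configs_of_type :: "nat \<Rightarrow> real^'x::finite \<Rightarrow> (nat \<Rightarrow> 'x) set" where
  "configs_of_type N \<mu> = {c \<in> configs N. LN N c = \<mu>}"

definition num_types :: "'x::finite itself \<Rightarrow> nat \<Rightarrow> nat" where
  "num_types _ N = card (LN N ` (configs N :: (nat \<Rightarrow> 'x) set))"

definition counting_error :: "'x::finite itself \<Rightarrow> nat \<Rightarrow> real" where
  "counting_error _ N = CARD('x) * (1 + ln (real N + 1))"

lemma counting_error_tendsto: "(\<lambda>N. counting_error TYPE('x::finite) N / real N) \<longlonglongrightarrow> 0"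
  unfolding counting_error_def by real_asymp

lemma card_configs_of_type_pos: "c \<in> configs N \<Longrightarrow> 0 < card (configs_of_type N (LN N c))"
  by (auto simp: card_gt_0_iff configs_of_type_def)

lemma sum_configs_by_type:
  fixes f :: "(nat \<Rightarrow> 'x::finite) \<Rightarrow> real"
  shows "(\<Sum>c\<in>configs N. f c) = (\<Sum>\<mu>\<in>LN N ` configs N. \<Sum>c\<in>configs_of_type N \<mu>. f c)"
  unfolding configs_of_type_def by (rule sum.image_gen[OF finite_configs])

lemma card_configs_of_type_multinomial:
  fixes c :: "nat \<Rightarrow> 'x::finite"
  assumes "0 < N"
  shows "card (configs_of_type N (LN N c)) * (\<Prod>x\<in>UNIV. fact (card {i \<in> {..<N}. c i = x})) = fact N"
proof -
  define A where "A = mset (map c [0..<N])"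
  have "bij_betw (\<lambda>c. map c [0..<N]) (configs_of_type N (LN N c)) (permutations_of_multiset A)"
  proof (rule bij_betwI')
    fix a b assume "a \<in> configs_of_type N (LN N c)" "b \<in> configs_of_type N (LN N c)"
    then show "(map a [0..<N] = map b [0..<N]) = (a = b)"
      using configs_eqI by (auto simp: configs_of_type_def)
  next
    fix a assume "a \<in> configs_of_type N (LN N c)"
    then show "map a [0..<N] \<in> permutations_of_multiset A"
      unfolding permutations_of_multiset_def A_def configs_of_type_def
      using LN_eq_iff_mset[OF assms, of a c] by simp
  next
    fix xs assume "xs \<in> permutations_of_multiset A"
    then have xs: "mset xs = A" by (simp add: permutations_of_multiset_def)
    then have "length xs = N" unfolding A_def by (metis length_map length_upt minus_nat.diff_0 size_mset)
    then obtain a where a: "a \<in> configs N" "map a [0..<N] = xs" using configs_of_list by metis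
    then have "LN N a = LN N c" using LN_eq_iff_mset[OF assms, of a c] xs A_def by simp
    then show "\<exists>a\<in>configs_of_type N (LN N c). xs = map a [0..<N]"
      using a unfolding configs_of_type_def by blast
  qed
  then have "card (configs_of_type N (LN N c)) = card (permutations_of_multiset A)"
    by (rule bij_betw_same_card)
  moreover have "(\<Prod>x\<in>set_mset A. fact (count A x)) = (\<Prod>x\<in>UNIV. fact (count A x) :: nat)"
    by (rule prod.mono_neutral_left) (auto simp: not_in_iff)
  moreover have "size A = N" by (simp add: A_def)
  ultimately show ?thesis
    using card_permutations_of_multiset_aux[of A] unfolding A_def count_mset_map_upt by simp
qed

lemma sum_counts_ln_counts:
  fixes c :: "nat \<Rightarrow> 'x::finite"
  assumes "0 < N"
  defines "n \<equiv> \<lambda>x. card {i \<in> {..<N}. c i = x}"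
  shows "(\<Sum>x\<in>UNIV. real (n x) * ln (real (n x)) - real (n x))
    = real N * ln (real N) - real N - real N * shannon (LN N c)"
proof -
  have nth: "LN N c $ x = real (n x) / real N" for x by (simp add: LN_def n_def)
  have sum_n: "(\<Sum>x\<in>UNIV. real (n x)) = real N"
    using LN_in_PX[OF assms(1), of c] assms(1) by (simp add: PX_def nth sum_divide_distrib[symmetric])
  have "real (n x) * ln (real (n x))
      = real (n x) * ln (real N) + real N * (LN N c $ x * ln (LN N c $ x))" for x
    using assms(1) by (cases "n x = 0") (simp_all add: nth ln_div field_simps)
  then have "(\<Sum>x\<in>UNIV. real (n x) * ln (real (n x)))
     = (\<Sum>x\<in>UNIV. real (n x)) * ln (real N) + real N * (\<Sum>x\<in>UNIV. LN N c $ x * ln (LN N c $ x))"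
    by (simp add: sum.distrib sum_distrib_left sum_distrib_right)
  then show ?thesis unfolding shannon_def sum_subtractf sum_n by simp
qed

lemma ln_card_configs_of_type:
  fixes c :: "nat \<Rightarrow> 'x::finite"
  assumes "0 < N" "c \<in> configs N"
  shows "\<bar>ln (card (configs_of_type N (LN N c))) - real N * shannon (LN N c)\<bar> \<le> counting_error TYPE('x) N"
proof -
  define n where "n x = card {i \<in> {..<N}. c i = x}" for x
  define T where "T = card (configs_of_type N (LN N c))"
  have le_N: "n x \<le> N" for x
    unfolding n_def using card_mono[of "{..<N}" "{i \<in> {..<N}. c i = x}"] by auto
  have counts: "(\<Sum>x\<in>UNIV. real (n x) * ln (real (n x)) - real (n x))
      = real N * ln (real N) - real N - real N * shannon (LN N c)"
    unfolding n_def by (rule sum_counts_ln_counts[OF assms(1)])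
  have "real T * (\<Prod>x\<in>UNIV. fact (n x)) = fact N"
    using arg_cong[OF card_configs_of_type_multinomial[OF assms(1), of c], of real]
    unfolding n_def T_def by simp
  then have "ln (real T) + ln (\<Prod>x\<in>UNIV. fact (n x)) = ln (fact N :: real)"
    using card_configs_of_type_pos[OF assms(2)] prod_pos[of UNIV "\<lambda>x. fact (n x) :: real"]
    unfolding T_def by (metis fact_gt_zero ln_mult_pos of_nat_0_less_iff)
  moreover have "ln (\<Prod>x\<in>UNIV. fact (n x) :: real) = (\<Sum>x\<in>UNIV. ln (fact (n x)))"
    by (rule ln_prod) auto
  ultimately have ln_T: "ln T = ln (fact N) - (\<Sum>x\<in>UNIV. ln (fact (n x)))" by simp
  have "(\<Sum>x\<in>UNIV. ln (fact (n x)))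
      \<le> (\<Sum>x\<in>UNIV. real (n x) * ln (real (n x)) - real (n x) + (1 + ln (real N + 1)))"
    using ln_fact_upper_uniform[OF le_N] by (intro sum_mono)
  then have upper: "(\<Sum>x\<in>UNIV. ln (fact (n x)))
      \<le> real N * ln (real N) - real N - real N * shannon (LN N c) + counting_error TYPE('x) N"
    unfolding sum.distrib counts by (simp add: counting_error_def distrib_left)
  have lower: "real N * ln (real N) - real N - real N * shannon (LN N c) \<le> (\<Sum>x\<in>UNIV. ln (fact (n x)))"
    unfolding counts[symmetric] by (intro sum_mono ln_fact_lower)
  have "1 * (1 + ln (real N + 1)) \<le> counting_error TYPE('x) N"
    unfolding counting_error_def by (intro mult_right_mono) (simp_all add: Suc_leI)
  then show ?thesis
    using upper lower ln_fact_lower[of N] ln_fact_upper_uniform[of N N]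
    unfolding T_def[symmetric] ln_T abs_le_iff by simp
qed

lemma num_types_pos: "0 < num_types TYPE('x::finite) N"
  by (simp add: num_types_def card_gt_0_iff configs_nonempty)

lemma num_types_le: "num_types TYPE('x::finite) N \<le> (N + 1) ^ CARD('x)"
proof -
  let ?F = "PiE (UNIV :: 'x set) (\<lambda>_. {..N})"
  have "LN N ` (configs N :: (nat \<Rightarrow> 'x) set) \<subseteq> (\<lambda>f. \<chi> y. real (f y) / real N) ` ?F"
  proof
    fix \<mu> assume "\<mu> \<in> LN N ` (configs N :: (nat \<Rightarrow> 'x) set)"
    then obtain c :: "nat \<Rightarrow> 'x" where c: "\<mu> = LN N c" by blast
    have "(\<lambda>y. card {i \<in> {..<N}. c i = y}) \<in> ?F"
      using card_mono[of "{..<N}" "{i \<in> {..<N}. c i = y}" for y] by (auto simp: PiE_def)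
    then show "\<mu> \<in> (\<lambda>f. \<chi> y. real (f y) / real N) ` ?F"
      unfolding c LN_def by (intro image_eqI) auto
  qed
  then have "num_types TYPE('x) N \<le> card ?F"
    unfolding num_types_def by (intro surj_card_le) (auto intro: finite_PiE)
  also have "\<dots> = (N + 1) ^ CARD('x)" by (simp add: card_PiE)
  finally show ?thesis .
qed

lemma ln_num_types_le: "ln (num_types TYPE('x::finite) N) \<le> counting_error TYPE('x) N"
proof -
  have "real (num_types TYPE('x) N) \<le> (real N + 1) ^ CARD('x)"
    using num_types_le[where 'x = 'x, of N]
    by (metis of_nat_le_iff of_nat_power of_nat_Suc Suc_eq_plus1 add.commute)
  then have "ln (num_types TYPE('x) N) \<le> ln ((real N + 1) ^ CARD('x))"
    using num_types_pos[where 'x = 'x] by (intro ln_mono) auto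
  also have "\<dots> = CARD('x) * ln (real N + 1)" by (simp add: ln_realpow)
  also have "\<dots> \<le> counting_error TYPE('x) N"
    unfolding counting_error_def by (intro mult_left_mono) auto
  finally show ?thesis .
qed

subsection \<open>Entropy and free energy of configuration laws\<close>

definition empirical_mean :: "nat \<Rightarrow> ((nat \<Rightarrow> 'x::finite) \<Rightarrow> real) \<Rightarrow> (real^'x \<Rightarrow> real) \<Rightarrow> real" where
  "empirical_mean N m f = (\<Sum>c\<in>configs N. m c * f (LN N c))"

definition neg_entropy :: "nat \<Rightarrow> ((nat \<Rightarrow> 'x::finite) \<Rightarrow> real) \<Rightarrow> real" where
  "neg_entropy N m = (\<Sum>c\<in>configs N. m c * ln (m c))"

lemma is_prob_configsD:
  assumes "is_prob_configs N m"
  shows "\<And>c. c \<in> configs N \<Longrightarrow> 0 \<le> m c" "(\<Sum>c\<in>configs N. m c) = 1"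
  using assms by (auto simp: is_prob_configs_def)

lemma empirical_mean_diff:
  "empirical_mean N m (\<lambda>\<mu>. f \<mu> - g \<mu>) = empirical_mean N m f - empirical_mean N m g"
  by (simp add: empirical_mean_def right_diff_distrib sum_subtractf)

lemma empirical_mean_ge:
  assumes "is_prob_configs N m" "0 < N" "\<And>\<mu>. \<mu> \<in> PX \<Longrightarrow> k \<le> f \<mu>"
  shows "k \<le> empirical_mean N m f"
proof -
  have "(\<Sum>c\<in>configs N. m c) * k \<le> empirical_mean N m f"
    unfolding empirical_mean_def sum_distrib_right
    using assms is_prob_configsD(1)[OF assms(1)] by (intro sum_mono mult_left_mono) (auto simp: LN_in_PX)
  then show ?thesis using is_prob_configsD(2)[OF assms(1)] by simp
qed

lemma integral_pushLN:
  fixes f :: "real^'x::finite \<Rightarrow> real"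
  assumes m: "is_prob_configs N m" and f: "f \<in> borel_measurable borel"
  shows "integral\<^sup>L (pushLN N m) f = empirical_mean N m f"
proof -
  have "integral\<^sup>L (pushLN N m) f
      = integral\<^sup>L (point_measure (configs N) (\<lambda>c. ennreal (m c))) (\<lambda>c. f (LN N c))"
    unfolding pushLN_def by (rule integral_distr) (use f in auto)
  also have "\<dots> = (\<Sum>c\<in>configs N. m c *\<^sub>R f (LN N c))"
    using m by (intro lebesgue_integral_point_measure_finite) (auto simp: is_prob_configs_def)
  finally show ?thesis by (simp add: empirical_mean_def)
qed

definition type_uniform :: "nat \<Rightarrow> (nat \<Rightarrow> 'x::finite) \<Rightarrow> real" where
  "type_uniform N c = 1 / (real (num_types TYPE('x) N) * real (card (configs_of_type N (LN N c))))"

lemma type_uniform_pos: "c \<in> configs N \<Longrightarrow> 0 < type_uniform N c"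
  by (simp add: type_uniform_def num_types_pos card_configs_of_type_pos)

lemma sum_type_uniform: "(\<Sum>c\<in>configs N. type_uniform N (c :: nat \<Rightarrow> 'x::finite)) = 1"
proof -
  let ?J = "real (num_types TYPE('x) N)"
  have "(\<Sum>c\<in>configs_of_type N \<mu>. type_uniform N c) = 1 / ?J"
    if "\<mu> \<in> LN N ` (configs N :: (nat \<Rightarrow> 'x) set)" for \<mu>
  proof -
    have "(\<Sum>c\<in>configs_of_type N \<mu>. type_uniform N c)
        = (\<Sum>c\<in>configs_of_type N \<mu>. 1 / (?J * real (card (configs_of_type N \<mu>))))"
      by (intro sum.cong) (auto simp: type_uniform_def configs_of_type_def)
    then show ?thesis using that card_configs_of_type_pos by fastforce
  qed
  then have "(\<Sum>c\<in>configs N. type_uniform N (c :: nat \<Rightarrow> 'x)) = ?J * (1 / ?J)"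
    unfolding sum_configs_by_type by (simp add: num_types_def)
  then show ?thesis using num_types_pos[where 'x = 'x, of N] by simp
qed

lemma ln_type_uniform_ge:
  fixes c :: "nat \<Rightarrow> 'x::finite"
  assumes "0 < N" "c \<in> configs N"
  shows "- real N * shannon (LN N c) - 2 * counting_error TYPE('x) N \<le> ln (type_uniform N c)"
proof -
  have "0 < real (num_types TYPE('x) N)" "0 < real (card (configs_of_type N (LN N c)))"
    using num_types_pos card_configs_of_type_pos[OF assms(2)] by simp_all
  then have "ln (type_uniform N c)
      = - ln (num_types TYPE('x) N) - ln (card (configs_of_type N (LN N c)))"
    by (simp add: type_uniform_def ln_div ln_mult_pos)
  then show ?thesis
    using ln_num_types_le[where 'x = 'x, of N] ln_card_configs_of_type[OF assms] by (simp add: abs_le_iff)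
qed

lemma neg_entropy_lower_bound:
  fixes m :: "(nat \<Rightarrow> 'x::finite) \<Rightarrow> real"
  assumes "0 < N" and prob: "is_prob_configs N m"
  shows "- real N * empirical_mean N m shannon - 2 * counting_error TYPE('x) N \<le> neg_entropy N m"
proof -
  note m = is_prob_configsD[OF prob]
  have "(\<Sum>c\<in>configs N. m c * (- real N * shannon (LN N c) - 2 * counting_error TYPE('x) N))
      = - real N * empirical_mean N m shannon - (\<Sum>c\<in>configs N. m c) * (2 * counting_error TYPE('x) N)"
    by (simp add: empirical_mean_def right_diff_distrib sum_subtractf sum_negf sum_distrib_left
        sum_distrib_right mult.left_commute)
  then have "- real N * empirical_mean N m shannon - 2 * counting_error TYPE('x) N
      = (\<Sum>c\<in>configs N. m c * (- real N * shannon (LN N c) - 2 * counting_error TYPE('x) N))"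
    using m(2) by simp
  also have "\<dots> \<le> (\<Sum>c\<in>configs N. m c * ln (type_uniform N c))"
    using assms(1) by (intro sum_mono mult_left_mono ln_type_uniform_ge m(1))
  also have "\<dots> \<le> neg_entropy N m"
  proof -
    have "0 \<le> relative_entropy (configs N) m (type_uniform N)"
      using m sum_type_uniform[where 'x = 'x, of N]
      by (intro relative_entropy_nonneg) (auto dest: type_uniform_pos)
    also have "\<dots> = neg_entropy N m - (\<Sum>c\<in>configs N. m c * ln (type_uniform N c))"
      unfolding neg_entropy_def using m(1)
      by (intro relative_entropy_eq_diff) (auto dest: type_uniform_pos)
    finally show ?thesis by simp
  qed
  finally show ?thesis .
qed

lemma ZN_pos: "0 < ZN K N"
  unfolding ZN_def using configs_nonempty by (intro sum_pos) auto

lemma piN_pos: "0 < piN K N c"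
  by (simp add: piN_def ZN_pos)

lemma is_prob_configs_piN: "is_prob_configs N (piN K N)"
proof -
  have "(\<Sum>c\<in>configs N. piN K N c) = ZN K N / ZN K N"
    unfolding piN_def sum_divide_distrib[symmetric] ZN_def[symmetric] ..
  then show ?thesis
    using ZN_pos[of K N] by (simp add: is_prob_configs_def less_imp_le[OF piN_pos])
qed

lemma FN_eq:
  assumes m: "is_prob_configs N m"
  shows "FN K N m = neg_entropy N m + real N * empirical_mean N m (UU K) + ln (ZN K N)"
proof -
  have "FN K N m = relative_entropy (configs N) m (piN K N)"
    by (simp add: FN_def relative_entropy_def)
  also have "\<dots> = neg_entropy N m - (\<Sum>c\<in>configs N. m c * ln (piN K N c))"
    unfolding neg_entropy_def using is_prob_configsD(1)[OF m] piN_pos[of K N]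
    by (intro relative_entropy_eq_diff) (metis less_imp_le less_irrefl)+
  also have "(\<Sum>c\<in>configs N. m c * ln (piN K N c))
      = - (\<Sum>c\<in>configs N. real N * (m c * UU K (LN N c)) + m c * ln (ZN K N))"
    unfolding sum_negf[symmetric] piN_def using ZN_pos[of K N]
    by (intro sum.cong) (auto simp: ln_div algebra_simps)
  finally show ?thesis
    using is_prob_configsD(2)[OF m]
    by (simp add: empirical_mean_def sum.distrib sum_distrib_left[symmetric] sum_distrib_right[symmetric])
qed

lemma FE_eq: "FE K \<mu> = UU K \<mu> - shannon \<mu>"
  by (simp add: FE_def shannon_def)

lemma continuous_on_FE:
  assumes "continuous_on PX (UU K)"
  shows "continuous_on PX (FE K)"
  using continuous_on_diff[OF assms continuous_on_shannon] by (simp add: FE_eq[abs_def])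

lemma FE0_attained:
  fixes K :: "'x::finite \<Rightarrow> real^'x \<Rightarrow> real"
  assumes "continuous_on PX (UU K)"
  obtains \<nu> where "\<nu> \<in> PX" "FE K \<nu> = FE0 K" "\<And>\<mu>. \<mu> \<in> PX \<Longrightarrow> FE0 K \<le> FE K \<mu>"
proof -
  obtain \<nu> where \<nu>: "\<nu> \<in> PX" "\<And>\<mu>. \<mu> \<in> PX \<Longrightarrow> FE K \<nu> \<le> FE K \<mu>"
    using continuous_attains_inf[OF compact_PX PX_nonempty continuous_on_FE[OF assms]] by blast
  then have "FE K \<nu> = FE0 K"
    unfolding FE0_def by (intro cInf_eq_minimum[symmetric]) auto
  then show ?thesis using that \<nu> by metis
qed

lemma ln_ZN_lower:
  fixes c :: "nat \<Rightarrow> 'x::finite"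
  assumes "0 < N" and c: "c \<in> configs N"
  shows "- real N * FE K (LN N c) - counting_error TYPE('x) N \<le> ln (ZN K N)"
proof -
  let ?T = "configs_of_type N (LN N c)"
  have T: "0 < real (card ?T)" using card_configs_of_type_pos[OF c] by simp
  have "real (card ?T) * exp (- real N * UU K (LN N c)) = (\<Sum>c'\<in>?T. exp (- real N * UU K (LN N c')))"
    by (simp add: configs_of_type_def)
  also have "\<dots> \<le> ZN K N"
    unfolding ZN_def by (intro sum_mono2) (auto simp: configs_of_type_def)
  finally have "ln (real (card ?T) * exp (- real N * UU K (LN N c))) \<le> ln (ZN K N)"
    using T by (intro ln_mono) auto
  then have "ln (card ?T) - real N * UU K (LN N c) \<le> ln (ZN K N)"
    unfolding ln_mult_pos[OF T exp_gt_zero] by simp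
  then show ?thesis
    using ln_card_configs_of_type[OF assms] by (simp add: FE_eq abs_le_iff algebra_simps)
qed

lemma ln_ZN_upper:
  fixes K :: "'x::finite \<Rightarrow> real^'x \<Rightarrow> real"
  assumes "continuous_on PX (UU K)" "0 < N"
  shows "ln (ZN K N) \<le> - real N * FE0 K + 2 * counting_error TYPE('x) N"
proof -
  note prob = is_prob_configs_piN[of N K]
  have "FN K N (piN K N :: (nat \<Rightarrow> 'x) \<Rightarrow> real) = 0"
    unfolding FN_def using piN_pos[of K N] by (intro sum.neutral) (simp add: less_le)
  then have "ln (ZN K N) = - neg_entropy N (piN K N) - real N * empirical_mean N (piN K N) (UU K)"
    using FN_eq[OF prob, of K] by simp
  also have "\<dots> \<le> - real N * empirical_mean N (piN K N) (FE K) + 2 * counting_error TYPE('x) N"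
    using neg_entropy_lower_bound[OF assms(2) prob]
    by (simp add: FE_eq[abs_def] empirical_mean_diff algebra_simps)
  also have "FE0 K \<le> empirical_mean N (piN K N) (FE K)"
    using FE0_attained[OF assms(1)] by (intro empirical_mean_ge[OF prob assms(2)]) metis
  then have "- real N * empirical_mean N (piN K N) (FE K) \<le> - real N * FE0 K"
    by (intro mult_left_mono_neg) auto
  finally show ?thesis by simp
qed

lemma ln_ZN_tendsto:
  fixes K :: "'x::finite \<Rightarrow> real^'x \<Rightarrow> real"
  assumes U: "continuous_on PX (UU K)"
  shows "(\<lambda>N. ln (ZN K N) / real N) \<longlonglongrightarrow> - FE0 K"
proof -
  obtain \<nu> where \<nu>: "\<nu> \<in> PX" "FE K \<nu> = FE0 K" using FE0_attained[OF U] by metis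
  obtain c where c: "\<And>N. c N \<in> configs N" "(\<lambda>N. LN N (c N)) \<longlonglongrightarrow> \<nu>"
    using empirical_measures_dense[OF \<nu>(1)] by blast
  let ?e = "\<lambda>N. counting_error TYPE('x) N / real N"
  have lower: "\<forall>\<^sub>F N in sequentially. - FE K (LN N (c N)) - ?e N \<le> ln (ZN K N) / real N"
    using eventually_gt_at_top[of 0]
  proof eventually_elim
    case (elim N)
    then have "(- real N * FE K (LN N (c N)) - counting_error TYPE('x) N) / real N \<le> ln (ZN K N) / real N"
      using ln_ZN_lower[OF _ c(1)] by (intro divide_right_mono) auto
    then show ?case using elim by (simp add: diff_divide_distrib)
  qed
  have upper: "\<forall>\<^sub>F N in sequentially. ln (ZN K N) / real N \<le> - FE0 K + 2 * ?e N"
    using eventually_gt_at_top[of 0]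
  proof eventually_elim
    case (elim N)
    then have "ln (ZN K N) / real N \<le> (- real N * FE0 K + 2 * counting_error TYPE('x) N) / real N"
      using ln_ZN_upper[OF U] by (intro divide_right_mono) auto
    then show ?case using elim by (simp add: diff_divide_distrib)
  qed
  have "\<forall>\<^sub>F N in sequentially. LN N (c N) \<in> PX"
    using eventually_gt_at_top[of 0] by eventually_elim (rule LN_in_PX)
  then have "(\<lambda>N. FE K (LN N (c N))) \<longlonglongrightarrow> FE0 K"
    using continuous_on_tendsto_compose[OF continuous_on_FE[OF U] c(2) \<nu>(1)] \<nu>(2) by simp
  then have "(\<lambda>N. - FE K (LN N (c N)) - ?e N) \<longlonglongrightarrow> - FE0 K - 0"
    by (intro tendsto_intros counting_error_tendsto)
  moreover have "(\<lambda>N. - FE0 K + 2 * ?e N) \<longlonglongrightarrow> - FE0 K + 2 * 0"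
    by (intro tendsto_intros counting_error_tendsto)
  ultimately show ?thesis by (intro tendsto_sandwich[OF lower upper]) simp_all
qed

subsection \<open>Exchangeable laws\<close>

definition exchangeable :: "nat \<Rightarrow> ((nat \<Rightarrow> 'x::finite) \<Rightarrow> 'b) \<Rightarrow> bool" where
  "exchangeable N m \<longleftrightarrow> (\<forall>c\<in>configs N. \<forall>\<sigma>. \<sigma> permutes {..<N} \<longrightarrow> m (c \<circ> \<sigma>) = m c)"

definition symmetrize :: "nat \<Rightarrow> ((nat \<Rightarrow> 'x::finite) \<Rightarrow> real) \<Rightarrow> (nat \<Rightarrow> 'x) \<Rightarrow> real" where
  "symmetrize N m c = (\<Sum>\<sigma> | \<sigma> permutes {..<N}. m (c \<circ> \<sigma>)) / fact N"

lemma configs_comp: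
  assumes "\<sigma> permutes {..<N}" "c \<in> configs N"
  shows "c \<circ> \<sigma> \<in> configs N"
  using assms permutes_not_in[OF assms(1)] by (auto simp: configs_def PiE_def extensional_def)

lemma bij_betw_comp_configs:
  assumes \<sigma>: "\<sigma> permutes {..<N}"
  shows "bij_betw (\<lambda>c. c \<circ> \<sigma>) (configs N) (configs N)"
proof (rule bij_betw_byWitness[where f' = "\<lambda>c. c \<circ> inv \<sigma>"])
  show "\<forall>c\<in>configs N. (c \<circ> \<sigma>) \<circ> inv \<sigma> = c" "\<forall>c\<in>configs N. (c \<circ> inv \<sigma>) \<circ> \<sigma> = c"
    using permutes_inv_o[OF \<sigma>] by (simp_all add: comp_assoc)
qed (use configs_comp[OF \<sigma>] configs_comp[OF permutes_inv[OF \<sigma>]] in auto)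

lemma sum_configs_comp:
  assumes "\<sigma> permutes {..<N}"
  shows "(\<Sum>c\<in>configs N. f (c \<circ> \<sigma>)) = (\<Sum>c\<in>configs N. f c)"
  using sum.reindex_bij_betw[OF bij_betw_comp_configs[OF assms]] .

lemma LN_comp:
  assumes \<sigma>: "\<sigma> permutes {..<N}"
  shows "LN N (c \<circ> \<sigma>) = LN N c"
proof -
  have "(\<Sum>j<N. if (c \<circ> \<sigma>) j = x then 1 else 0) = (\<Sum>j<N. if c j = x then 1 else (0::real))" for x
    using sum.permute[OF \<sigma>, of "\<lambda>j. if c j = x then 1 else (0::real)"] by (simp add: comp_def)
  then show ?thesis by (simp add: vec_eq_iff LN_nth_sum)
qed

lemma exchangeable_eqI_type:
  assumes "exchangeable N m" "0 < N" and c: "c \<in> configs N" "c' \<in> configs N" and "LN N c = LN N c'"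
  shows "m c = m c'"
proof -
  have "mset (map c' [0..<N]) = mset (map c [0..<N])"
    using assms(2,5) LN_eq_iff_mset by metis
  then obtain \<sigma> where \<sigma>: "\<sigma> permutes {..<N}" "permute_list \<sigma> (map c [0..<N]) = map c' [0..<N]"
    by (rule mset_eq_permutation) simp
  have "map (c \<circ> \<sigma>) [0..<N] = map c' [0..<N]"
    unfolding \<sigma>(2)[symmetric] permute_list_def using permutes_in_image[OF \<sigma>(1)] by auto
  then have "c \<circ> \<sigma> = c'" by (rule configs_eqI[OF configs_comp[OF \<sigma>(1) c(1)] c(2)])
  then show ?thesis using assms(1) c(1) \<sigma>(1) by (auto simp: exchangeable_def)
qed

lemma neg_entropy_exchangeable_upper_bound:
  fixes m :: "(nat \<Rightarrow> 'x::finite) \<Rightarrow> real"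
  assumes "0 < N" and prob: "is_prob_configs N m" and "exchangeable N m"
  shows "neg_entropy N m \<le> - real N * empirical_mean N m shannon + counting_error TYPE('x) N"
proof -
  note m = is_prob_configsD[OF prob]
  have "m c * ln (m c) \<le> m c * (counting_error TYPE('x) N - real N * shannon (LN N c))"
    if c: "c \<in> configs N" for c
  proof (cases "m c = 0")
    case False
    then have pos: "0 < m c" using m(1)[OF c] by simp
    let ?T = "configs_of_type N (LN N c)"
    have T: "0 < real (card ?T)" using card_configs_of_type_pos[OF c] by simp
    have "(\<Sum>c'\<in>?T. m c) = (\<Sum>c'\<in>?T. m c')"
      by (intro sum.cong refl exchangeable_eqI_type[OF assms(3,1) c]) (auto simp: configs_of_type_def)
    then have "real (card ?T) * m c = (\<Sum>c'\<in>?T. m c')" by simp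
    also have "\<dots> \<le> (\<Sum>c\<in>configs N. m c)"
      using m(1) by (intro sum_mono2) (auto simp: configs_of_type_def)
    finally have "ln (real (card ?T) * m c) \<le> ln 1"
      using m(2) pos T by (intro ln_mono) auto
    then have "ln (m c) \<le> - ln (card ?T)"
      unfolding ln_mult_pos[OF T pos] by simp
    then have "ln (m c) \<le> counting_error TYPE('x) N - real N * shannon (LN N c)"
      using ln_card_configs_of_type[OF assms(1) c] by (simp add: abs_le_iff)
    then show ?thesis using pos by (intro mult_left_mono) auto
  qed simp
  then have "neg_entropy N m
      \<le> (\<Sum>c\<in>configs N. m c * (counting_error TYPE('x) N - real N * shannon (LN N c)))"
    unfolding neg_entropy_def by (rule sum_mono)
  also have "\<dots> = (\<Sum>c\<in>configs N. m c) * counting_error TYPE('x) N - real N * empirical_mean N m shannon"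
    by (simp add: empirical_mean_def right_diff_distrib sum_subtractf sum_distrib_left
        sum_distrib_right mult.left_commute)
  finally show ?thesis by (simp add: m(2))
qed

lemma exchangeable_symmetrize: "exchangeable N (symmetrize N m)"
  unfolding exchangeable_def symmetrize_def
  using setum_permutations_compose_left[where f = "\<lambda>\<sigma>. m (_ \<circ> \<sigma>)"] by (simp add: comp_assoc)

lemma exchangeable_LN: "exchangeable N (\<lambda>c. f (LN N c))"
  by (simp add: exchangeable_def LN_comp)

lemma sum_symmetrize:
  assumes v: "exchangeable N v"
  shows "(\<Sum>c\<in>configs N. symmetrize N m c * v c) = (\<Sum>c\<in>configs N. m c * v c)"
proof -
  have "(\<Sum>c\<in>configs N. symmetrize N m c * v c)
      = (\<Sum>\<sigma> | \<sigma> permutes {..<N}. \<Sum>c\<in>configs N. m (c \<circ> \<sigma>) * v c) / fact N"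
    by (subst sum.swap) (simp add: symmetrize_def sum_distrib_right sum_divide_distrib)
  also have "(\<Sum>\<sigma> | \<sigma> permutes {..<N}. \<Sum>c\<in>configs N. m (c \<circ> \<sigma>) * v c)
      = (\<Sum>\<sigma> | \<sigma> permutes {..<N}. \<Sum>c\<in>configs N. m c * v c)"
  proof (rule sum.cong[OF refl])
    fix \<sigma> assume "\<sigma> \<in> {\<sigma>. \<sigma> permutes {..<N}}"
    then show "(\<Sum>c\<in>configs N. m (c \<circ> \<sigma>) * v c) = (\<Sum>c\<in>configs N. m c * v c)"
      using v sum_configs_comp[of \<sigma> N "\<lambda>c. m c * v c"] by (simp add: exchangeable_def)
  qed
  finally show ?thesis using card_permutations[of "{..<N}" N] by simp
qed

lemma empirical_mean_symmetrize: "empirical_mean N (symmetrize N m) f = empirical_mean N m f"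
  unfolding empirical_mean_def by (rule sum_symmetrize[OF exchangeable_LN])

lemma symmetrize_nonneg:
  assumes "\<And>c. c \<in> configs N \<Longrightarrow> 0 \<le> m c" "c \<in> configs N"
  shows "0 \<le> symmetrize N m c"
  unfolding symmetrize_def using assms configs_comp by (intro divide_nonneg_nonneg sum_nonneg) auto

lemma is_prob_configs_symmetrize:
  assumes "is_prob_configs N m"
  shows "is_prob_configs N (symmetrize N m)"
  using is_prob_configsD[OF assms] sum_symmetrize[of N "\<lambda>_. 1" m]
  by (auto simp: is_prob_configs_def exchangeable_def symmetrize_nonneg)

lemma symmetrize_eq_0:
  assumes "\<And>c. c \<in> configs N \<Longrightarrow> 0 \<le> m c" "c \<in> configs N" "symmetrize N m c = 0"
  shows "m c = 0"
proof -
  have "(\<Sum>\<sigma> | \<sigma> permutes {..<N}. m (c \<circ> \<sigma>)) = 0" using assms(3) by (simp add: symmetrize_def)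
  then have "\<forall>\<sigma>\<in>{\<sigma>. \<sigma> permutes {..<N}}. m (c \<circ> \<sigma>) = 0"
    using assms configs_comp by (subst (asm) sum_nonneg_eq_0_iff) (auto simp: finite_permutations)
  then have "m (c \<circ> id) = 0" using permutes_id by blast
  then show ?thesis by simp
qed

lemma relative_entropy_symmetrize:
  assumes "is_prob_configs N m"
  shows "relative_entropy (configs N) m (symmetrize N m)
      = neg_entropy N m - neg_entropy N (symmetrize N m)"
proof -
  note m = is_prob_configsD(1)[OF assms]
  have "exchangeable N (\<lambda>c. ln (symmetrize N m c))"
    using exchangeable_symmetrize[of N m] by (simp add: exchangeable_def)
  then have "neg_entropy N (symmetrize N m) = (\<Sum>c\<in>configs N. m c * ln (symmetrize N m c))"
    unfolding neg_entropy_def by (rule sum_symmetrize)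
  moreover have "relative_entropy (configs N) m (symmetrize N m)
      = neg_entropy N m - (\<Sum>c\<in>configs N. m c * ln (symmetrize N m c))"
    unfolding neg_entropy_def
    by (rule relative_entropy_eq_diff) (use m symmetrize_nonneg[OF m] symmetrize_eq_0[OF m] in auto)
  ultimately show ?thesis by simp
qed

subsection \<open>Lipschitz functions on compact sets\<close>

definition lipschitzian_on :: "'a::metric_space set \<Rightarrow> ('a \<Rightarrow> 'b::metric_space) \<Rightarrow> bool" where
  "lipschitzian_on X f \<longleftrightarrow> (\<exists>L. L-lipschitz_on X f)"

lemma lipschitzian_on_continuous: "lipschitzian_on X f \<Longrightarrow> continuous_on X f"
  unfolding lipschitzian_on_def using lipschitz_on_continuous_on by blast

lemma lipschitzian_on_const: "lipschitzian_on X (\<lambda>x. k)"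
  unfolding lipschitzian_on_def using lipschitz_on_constant by blast

lemma lipschitzian_on_nth: "lipschitzian_on X (\<lambda>x. x $ i)"
  unfolding lipschitzian_on_def by (intro exI[of _ 1] lipschitz_onI) (auto simp: dist_vec_nth_le)

lemma lipschitzian_on_add:
  fixes f g :: "'a::metric_space \<Rightarrow> 'b::real_normed_vector"
  shows "lipschitzian_on X f \<Longrightarrow> lipschitzian_on X g \<Longrightarrow> lipschitzian_on X (\<lambda>x. f x + g x)"
  unfolding lipschitzian_on_def using lipschitz_on_add by blast

lemma lipschitzian_on_diff:
  fixes f g :: "'a::metric_space \<Rightarrow> 'b::real_normed_vector"
  shows "lipschitzian_on X f \<Longrightarrow> lipschitzian_on X g \<Longrightarrow> lipschitzian_on X (\<lambda>x. f x - g x)"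
  unfolding lipschitzian_on_def using lipschitz_on_diff by blast

lemma lipschitzian_on_minus:
  fixes f :: "'a::metric_space \<Rightarrow> 'b::real_normed_vector"
  shows "lipschitzian_on X f \<Longrightarrow> lipschitzian_on X (\<lambda>x. - f x)"
  unfolding lipschitzian_on_def by simp

lemma lipschitzian_on_sum:
  fixes f :: "'i \<Rightarrow> 'a::metric_space \<Rightarrow> 'b::real_normed_vector"
  shows "(\<And>i. i \<in> I \<Longrightarrow> lipschitzian_on X (f i)) \<Longrightarrow> lipschitzian_on X (\<lambda>x. \<Sum>i\<in>I. f i x)"
  by (induction I rule: infinite_finite_induct) (auto intro: lipschitzian_on_const lipschitzian_on_add)

lemma lipschitzian_on_bounded_linear:
  assumes "bounded_linear h" "lipschitzian_on X f"
  shows "lipschitzian_on X (\<lambda>x. h (f x))"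
proof -
  obtain L where L: "L-lipschitz_on X f" using assms(2) unfolding lipschitzian_on_def by blast
  obtain B where "B-lipschitz_on (f ` X) h" by (rule bounded_linear.lipschitz_boundE[OF assms(1)])
  then show ?thesis unfolding lipschitzian_on_def using lipschitz_on_compose2[OF L] by blast
qed

lemma lipschitzian_on_vec:
  fixes f :: "'a::metric_space \<Rightarrow> real^'n"
  assumes "\<And>i. lipschitzian_on X (\<lambda>x. f x $ i)"
  shows "lipschitzian_on X f"
proof -
  obtain L where L: "\<And>i. (L i)-lipschitz_on X (\<lambda>x. f x $ i)"
    using assms unfolding lipschitzian_on_def by metis
  have "(\<Sum>i\<in>UNIV. L i)-lipschitz_on X f"
  proof (rule lipschitz_onI)
    fix x y assume "x \<in> X" "y \<in> X"
    have "dist (f x) (f y) \<le> (\<Sum>i\<in>UNIV. \<bar>(f x - f y) $ i\<bar>)"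
      unfolding dist_norm by (rule norm_le_l1_cart)
    also have "\<dots> \<le> (\<Sum>i\<in>UNIV. L i * dist x y)"
      using lipschitz_onD[OF L \<open>x \<in> X\<close> \<open>y \<in> X\<close>] by (intro sum_mono) (simp add: dist_real_def)
    finally show "dist (f x) (f y) \<le> (\<Sum>i\<in>UNIV. L i) * dist x y"
      by (simp add: sum_distrib_right)
  qed (intro sum_nonneg lipschitz_on_nonneg[OF L])
  then show ?thesis unfolding lipschitzian_on_def by blast
qed

lemma abs_mult_diff_mult_le:
  fixes x y u v :: real
  shows "\<bar>x * y - u * v\<bar> \<le> \<bar>x\<bar> * \<bar>y - v\<bar> + \<bar>x - u\<bar> * \<bar>v\<bar>"
  unfolding mult_diff_mult abs_mult[symmetric] by (rule abs_triangle_ineq)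

lemma lipschitzian_on_mult:
  fixes f g :: "'a::metric_space \<Rightarrow> real"
  assumes "compact X" and f: "lipschitzian_on X f" and g: "lipschitzian_on X g"
  shows "lipschitzian_on X (\<lambda>x. f x * g x)"
proof -
  obtain L M where L: "L-lipschitz_on X f" and M: "M-lipschitz_on X g"
    using f g unfolding lipschitzian_on_def by blast
  obtain B where B: "0 \<le> B" "\<And>x. x \<in> X \<Longrightarrow> norm (f x) \<le> B"
    using continuous_on_compact_bound[OF assms(1) lipschitzian_on_continuous[OF f]] by blast
  obtain C where C: "0 \<le> C" "\<And>x. x \<in> X \<Longrightarrow> norm (g x) \<le> C"
    using continuous_on_compact_bound[OF assms(1) lipschitzian_on_continuous[OF g]] by blast
  have "(B * M + C * L)-lipschitz_on X (\<lambda>x. f x * g x)"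
  proof (rule lipschitz_onI)
    fix x y assume xy: "x \<in> X" "y \<in> X"
    have "dist (f x * g x) (f y * g y) \<le> \<bar>f x\<bar> * dist (g x) (g y) + dist (f x) (f y) * \<bar>g y\<bar>"
      unfolding dist_real_def by (rule abs_mult_diff_mult_le)
    also have "\<dots> \<le> B * (M * dist x y) + (L * dist x y) * C"
      using xy B C lipschitz_onD[OF L] lipschitz_onD[OF M] lipschitz_on_nonneg[OF L]
      by (intro add_mono mult_mono) auto
    finally show "dist (f x * g x) (f y * g y) \<le> (B * M + C * L) * dist x y"
      by (simp add: algebra_simps)
  qed (use B C lipschitz_on_nonneg[OF L] lipschitz_on_nonneg[OF M] in auto)
  then show ?thesis unfolding lipschitzian_on_def by blast
qed

lemma lipschitzian_on_exp:
  fixes f :: "'a::metric_space \<Rightarrow> real"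
  assumes "compact X" and f: "lipschitzian_on X f"
  shows "lipschitzian_on X (\<lambda>x. exp (f x))"
proof -
  obtain L where L: "L-lipschitz_on X f" using f unfolding lipschitzian_on_def by blast
  obtain B where B: "\<And>x. x \<in> X \<Longrightarrow> norm (f x) \<le> B"
    using continuous_on_compact_bound[OF assms(1) lipschitzian_on_continuous[OF f]] by blast
  have "(exp B)-lipschitz_on {..B} (exp :: real \<Rightarrow> real)"
  proof (rule bounded_derivative_imp_lipschitz)
    fix r :: real assume "r \<in> {..B}"
    then show "onorm (\<lambda>h. h * exp r) \<le> exp B"
      by (intro onorm_bound) (auto simp: abs_mult mult.commute intro!: mult_left_mono)
  qed (auto intro!: derivative_eq_intros simp: fun_eq_iff)
  then have "(exp B)-lipschitz_on (f ` X) exp"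
    by (rule lipschitz_on_subset) (use B in \<open>auto simp: abs_le_iff\<close>)
  then show ?thesis unfolding lipschitzian_on_def using lipschitz_on_compose2[OF L] by blast
qed

lemma lipschitzian_on_C1:
  fixes f :: "'a::real_normed_vector \<Rightarrow> 'b::real_normed_vector"
  assumes "compact X" "convex X" and deriv: "\<And>x. x \<in> X \<Longrightarrow> (f has_derivative blinfun_apply (f' x)) (at x)"
    and "continuous_on X f'"
  shows "lipschitzian_on X f"
proof -
  obtain B where "0 \<le> B" "\<And>x. x \<in> X \<Longrightarrow> norm (f' x) \<le> B"
    using continuous_on_compact_bound[OF assms(1,4)] by blast
  then have "B-lipschitz_on X f"
    using assms(2) deriv
    by (intro bounded_derivative_imp_lipschitz[where f' = "\<lambda>x. blinfun_apply (f' x)"])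
       (auto simp: norm_blinfun.rep_eq intro: has_derivative_at_withinI)
  then show ?thesis unfolding lipschitzian_on_def by blast
qed

lemma C2_on_lipschitzian:
  assumes "C2_on S f" "compact X" "convex X" "X \<subseteq> S"
  shows "\<exists>f'. (\<forall>x\<in>X. (f has_derivative blinfun_apply (f' x)) (at x)) \<and> lipschitzian_on X f
      \<and> lipschitzian_on X f'"
proof -
  obtain f' f'' where f': "\<And>x. x \<in> S \<Longrightarrow> (f has_derivative blinfun_apply (f' x)) (at x)"
    and f'': "\<And>x. x \<in> S \<Longrightarrow> (f' has_derivative blinfun_apply (f'' x)) (at x)"
    and "continuous_on S f''"
    using assms(1) unfolding C2_on_def by blast
  then have "lipschitzian_on X f'"
    using assms by (intro lipschitzian_on_C1[of X f' f'']) (auto intro: continuous_on_subset)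
  moreover from this have "lipschitzian_on X f"
    using f' assms by (intro lipschitzian_on_C1[of X f f'] lipschitzian_on_continuous) auto
  ultimately show ?thesis using f' assms(4) by blast
qed

lemma ex_uniform_bound:
  fixes f :: "'i::finite \<Rightarrow> 'a::topological_space \<Rightarrow> real"
  assumes "compact X" "\<And>i. continuous_on X (f i)"
  shows "\<exists>B>0. \<forall>i. \<forall>x\<in>X. \<bar>f i x\<bar> \<le> B"
proof -
  have "\<forall>\<^sub>F B in at_top. \<forall>x\<in>X. \<bar>f i x\<bar> \<le> B" for i
  proof -
    obtain B where B: "\<And>x. x \<in> X \<Longrightarrow> norm (f i x) \<le> B"
      using continuous_on_compact_bound[OF assms(1,2)] by blast
    show ?thesis using eventually_ge_at_top[of B] by eventually_elim (use B in force)
  qed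
  then have "\<forall>\<^sub>F B in at_top. \<forall>i. \<forall>x\<in>X. \<bar>f i x\<bar> \<le> B" by (rule eventually_all_finite)
  then have "\<forall>\<^sub>F B in at_top. 0 < B \<and> (\<forall>i. \<forall>x\<in>X. \<bar>f i x\<bar> \<le> B)"
    using eventually_gt_at_top[of 0] by eventually_elim simp
  then show ?thesis using eventually_happens'[OF trivial_limit_at_top_linorder] by blast
qed

lemma continuous_on_compact_square_modulus:
  fixes f :: "'a::real_normed_vector \<Rightarrow> real"
  assumes "compact X" and f: "continuous_on X f" and "0 < e"
  shows "\<exists>M\<ge>0. \<forall>x\<in>X. \<forall>y\<in>X. \<bar>f x - f y\<bar> \<le> e + M * (norm (x - y))\<^sup>2"
proof -
  obtain d where d: "0 < d" "\<And>x y. x \<in> X \<Longrightarrow> y \<in> X \<Longrightarrow> dist y x < d \<Longrightarrow> dist (f y) (f x) < e"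
    using compact_uniformly_continuous[OF f assms(1)] \<open>0 < e\<close>
    unfolding uniformly_continuous_on_def by metis
  obtain B where B: "0 \<le> B" "\<And>x. x \<in> X \<Longrightarrow> norm (f x) \<le> B"
    using continuous_on_compact_bound[OF assms(1) f] by blast
  have "\<bar>f x - f y\<bar> \<le> e + 2 * B / d\<^sup>2 * (norm (x - y))\<^sup>2" if xy: "x \<in> X" "y \<in> X" for x y
  proof (cases "norm (x - y) < d")
    case True
    then have "\<bar>f x - f y\<bar> < e" using d(2)[OF xy(2,1)] by (simp add: dist_norm)
    moreover have "0 \<le> 2 * B / d\<^sup>2 * (norm (x - y))\<^sup>2" using B by simp
    ultimately show ?thesis by linarith
  next
    case False
    then have "2 * B / d\<^sup>2 * d\<^sup>2 \<le> 2 * B / d\<^sup>2 * (norm (x - y))\<^sup>2"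
      using d(1) B by (intro mult_left_mono power_mono) auto
    moreover have "2 * B / d\<^sup>2 * d\<^sup>2 = 2 * B" using d(1) by simp
    moreover have "\<bar>f x - f y\<bar> \<le> 2 * B" using B(2)[OF xy(1)] B(2)[OF xy(2)] by (simp add: abs_le_iff)
    ultimately show ?thesis using \<open>0 < e\<close> by linarith
  qed
  then show ?thesis using B(1) by (intro exI[of _ "2 * B / d\<^sup>2"]) auto
qed

lemma mean_value_on_convex:
  fixes f :: "'a::real_normed_vector \<Rightarrow> real"
  assumes "convex X" "u \<in> X" "v \<in> X" and deriv: "\<And>x. x \<in> X \<Longrightarrow> (f has_derivative f' x) (at x)"
  shows "\<exists>\<xi>\<in>X. dist \<xi> u \<le> dist v u \<and> f v - f u = f' \<xi> (v - u)"
proof -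
  define \<gamma> where "\<gamma> r = u + r *\<^sub>R (v - u)" for r
  have \<gamma>_in: "\<gamma> r \<in> X" if "0 \<le> r" "r \<le> 1" for r
    using convexD_alt[OF assms(1-3) that] by (simp add: \<gamma>_def algebra_simps)
  have "\<exists>r\<in>{0<..<1}. f (\<gamma> 1) - f (\<gamma> 0) = f' (\<gamma> r) ((1 - 0) *\<^sub>R (v - u))"
  proof (rule mvt_simple)
    fix r :: real assume "0 \<le> r" "r \<le> 1"
    have "(\<gamma> has_derivative (\<lambda>h. h *\<^sub>R (v - u))) (at r within {0..1})"
      unfolding \<gamma>_def by (auto intro!: derivative_eq_intros)
    then show "((\<lambda>r. f (\<gamma> r)) has_derivative (\<lambda>h. f' (\<gamma> r) (h *\<^sub>R (v - u)))) (at r within {0..1})"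
      by (rule has_derivative_compose[where f = \<gamma>, OF _ deriv[OF \<gamma>_in[OF \<open>0 \<le> r\<close> \<open>r \<le> 1\<close>]]])
  qed simp
  then obtain r where r: "0 < r" "r < 1" "f v - f u = f' (\<gamma> r) (v - u)" by (auto simp: \<gamma>_def)
  moreover have "dist (\<gamma> r) u \<le> dist v u"
    using r by (simp add: \<gamma>_def dist_norm mult_left_le_one_le)
  ultimately show ?thesis using \<gamma>_in[of r] by auto
qed

subsection \<open>The limiting vector field\<close>

definition sqrt_gibbs_ratio :: "('x::finite \<Rightarrow> real^'x \<Rightarrow> real) \<Rightarrow> 'x \<Rightarrow> 'x \<Rightarrow> real^'x \<Rightarrow> real" where
  "sqrt_gibbs_ratio K x y \<mu> = exp ((HH K x \<mu> - HH K y \<mu>) / 2)"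

lemma Qlim_off_diag:
  assumes "x \<noteq> y"
  shows "Qlim K A x y \<mu> = sqrt_gibbs_ratio K x y \<mu> * A \<mu> x y"
proof -
  have "0 < (\<Sum>z\<in>UNIV. exp (- HH K z \<mu>))" by (intro sum_pos) auto
  then have "piK K y \<mu> / piK K x \<mu> = exp (HH K x \<mu> - HH K y \<mu>)"
    unfolding piK_def by (simp add: exp_diff[symmetric] field_simps)
  moreover have "sqrt (exp r) = exp (r / 2)" for r :: real
    by (rule real_sqrt_unique) (simp_all add: exp_double[symmetric])
  ultimately show ?thesis using assms by (simp only: Qlim_def sqrt_gibbs_ratio_def if_False)
qed

lemma Qlim_diag: "Qlim K A x x \<mu> = - (\<Sum>z\<in>UNIV - {x}. Qlim K A x z \<mu>)"
  unfolding Qlim_def by simp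

lemma inner_bfield:
  "w \<bullet> bfield K A \<nu> = (\<Sum>x\<in>UNIV. \<nu> $ x * (\<Sum>y\<in>UNIV - {x}. Qlim K A x y \<nu> * (w $ y - w $ x)))"
proof -
  have "(\<Sum>y\<in>UNIV. Qlim K A x y \<nu> * w $ y) = (\<Sum>y\<in>UNIV - {x}. Qlim K A x y \<nu> * (w $ y - w $ x))" for x
    by (subst sum.remove[of UNIV x])
       (simp_all add: Qlim_diag right_diff_distrib sum_subtractf sum_distrib_right)
  moreover have "w \<bullet> bfield K A \<nu> = (\<Sum>x\<in>UNIV. \<nu> $ x * (\<Sum>y\<in>UNIV. Qlim K A x y \<nu> * w $ y))"
    unfolding inner_vec_def bfield_def
    by (simp add: sum_distrib_left, subst sum.swap) (simp add: ac_simps)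
  ultimately show ?thesis by simp
qed

lemma sum_bfield: "(\<Sum>x\<in>UNIV. bfield K A \<nu> $ x) = 0"
  using inner_bfield[of "\<chi> x. 1" K A \<nu>] by (simp add: inner_vec_def)

locale mean_field =
  fixes K :: "'x::finite \<Rightarrow> real^'x \<Rightarrow> real"
    and A :: "real^'x \<Rightarrow> 'x \<Rightarrow> 'x \<Rightarrow> real"
    and AN :: "nat \<Rightarrow> real^'x \<Rightarrow> 'x \<Rightarrow> 'x \<Rightarrow> real"
  assumes K_C2: "\<exists>S. open S \<and> PX \<subseteq> S \<and> (\<forall>x. C2_on S (K x))"
    and A_good: "\<forall>\<mu>\<in>PX. good_mat (A \<mu>)"
    and A_lip: "\<forall>x y. \<exists>L. L-lipschitz_on PX (\<lambda>\<mu>. A \<mu> x y)"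
    and AN_good: "\<forall>N. \<forall>\<mu>\<in>PX. good_mat (AN N \<mu>)"
    and AN_conv: "\<forall>x y. uniform_limit PX (\<lambda>N \<mu>. AN N \<mu> x y) (\<lambda>\<mu>. A \<mu> x y) sequentially"
begin

lemma ex_UU_gradient:
  "\<exists>D. (\<forall>x. lipschitzian_on PX (D x)) \<and>
    (\<forall>\<nu>\<in>PX. (UU K has_derivative (\<lambda>h. \<Sum>x\<in>UNIV. h $ x * D x \<nu>)) (at \<nu>))"
proof -
  have "\<forall>x. \<exists>f'. (\<forall>\<nu>\<in>PX. (K x has_derivative blinfun_apply (f' \<nu>)) (at \<nu>)) \<and>
      lipschitzian_on PX (K x) \<and> lipschitzian_on PX f'"
    using K_C2 C2_on_lipschitzian[OF _ compact_PX convex_PX] by blast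
  then obtain K' where K': "\<And>x \<nu>. \<nu> \<in> PX \<Longrightarrow> (K x has_derivative blinfun_apply (K' x \<nu>)) (at \<nu>)"
    and K_lip: "\<And>x. lipschitzian_on PX (K x)" and K'_lip: "\<And>x. lipschitzian_on PX (K' x)"
    by metis
  define D where "D x \<nu> = K x \<nu> + (\<Sum>z\<in>UNIV. \<nu> $ z * blinfun_apply (K' z \<nu>) (axis x 1))" for x \<nu>
  have "lipschitzian_on PX (D x)" for x
    unfolding D_def
    by (intro lipschitzian_on_add lipschitzian_on_sum lipschitzian_on_mult compact_PX
        lipschitzian_on_nth K_lip
        lipschitzian_on_bounded_linear[OF blinfun.bounded_linear_left K'_lip])
  moreover have "(UU K has_derivative (\<lambda>h. \<Sum>x\<in>UNIV. h $ x * D x \<nu>)) (at \<nu>)" if "\<nu> \<in> PX" for \<nu>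
  proof -
    have "(UU K has_derivative (\<lambda>h. \<Sum>z\<in>UNIV. \<nu> $ z * blinfun_apply (K' z \<nu>) h + h $ z * K z \<nu>)) (at \<nu>)"
      unfolding UU_def[abs_def] using that
      by (intro has_derivative_sum has_derivative_mult K' bounded_linear_imp_has_derivative
          bounded_linear_vec_nth)
    moreover have "(\<Sum>z\<in>UNIV. \<nu> $ z * blinfun_apply (K' z \<nu>) h + h $ z * K z \<nu>)
        = (\<Sum>x\<in>UNIV. h $ x * D x \<nu>)" for h
    proof -
      have "blinfun_apply (K' z \<nu>) h = (\<Sum>x\<in>UNIV. h $ x * blinfun_apply (K' z \<nu>) (axis x 1))" for z
        using arg_cong[OF basis_expansion[of h], of "blinfun_apply (K' z \<nu>)"]
        by (simp add: blinfun.sum_right blinfun.scaleR_right scalar_mult_eq_scaleR)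
      then have "(\<Sum>z\<in>UNIV. \<nu> $ z * blinfun_apply (K' z \<nu>) h)
          = (\<Sum>x\<in>UNIV. h $ x * (\<Sum>z\<in>UNIV. \<nu> $ z * blinfun_apply (K' z \<nu>) (axis x 1)))"
        by (simp add: sum_distrib_left, subst sum.swap) (simp add: mult.left_commute)
      then show ?thesis by (simp add: D_def sum.distrib distrib_left)
    qed
    ultimately show ?thesis by simp
  qed
  ultimately show ?thesis by blast
qed

lemma HH_eq_gradient:
  assumes "(UU K has_derivative (\<lambda>h. \<Sum>x\<in>UNIV. h $ x * D x)) (at \<nu>)"
  shows "HH K x \<nu> = D x"
  unfolding HH_def frechet_derivative_at[OF assms, symmetric]
  by (simp add: axis_def if_distrib[of "\<lambda>a. a * _"] cong: if_cong)

lemma UU_has_derivative: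
  assumes "\<nu> \<in> PX"
  shows "(UU K has_derivative (\<lambda>h. \<Sum>x\<in>UNIV. h $ x * HH K x \<nu>)) (at \<nu>)"
proof -
  obtain D where D: "(UU K has_derivative (\<lambda>h. \<Sum>x\<in>UNIV. h $ x * D x \<nu>)) (at \<nu>)"
    using ex_UU_gradient assms by blast
  then show ?thesis unfolding HH_eq_gradient[OF D] .
qed

lemma continuous_on_UU: "continuous_on PX (UU K)"
  by (intro continuous_at_imp_continuous_on ballI has_derivative_continuous[OF UU_has_derivative])

lemma lipschitzian_on_HH: "lipschitzian_on PX (HH K x)"
proof -
  obtain D L where L: "L-lipschitz_on PX (D x)"
    and D: "\<And>\<nu>. \<nu> \<in> PX \<Longrightarrow> (UU K has_derivative (\<lambda>h. \<Sum>x\<in>UNIV. h $ x * D x \<nu>)) (at \<nu>)"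
    using ex_UU_gradient unfolding lipschitzian_on_def by blast
  have "L-lipschitz_on PX (HH K x)"
    by (rule lipschitz_on_transform[OF L]) (rule HH_eq_gradient[OF D])
  then show ?thesis unfolding lipschitzian_on_def by blast
qed

lemma lipschitzian_on_sqrt_gibbs_ratio: "lipschitzian_on PX (sqrt_gibbs_ratio K x y)"
  unfolding sqrt_gibbs_ratio_def
  by (intro lipschitzian_on_exp lipschitzian_on_bounded_linear[OF bounded_linear_divide]
      lipschitzian_on_diff lipschitzian_on_HH compact_PX)

lemma lipschitzian_on_A: "lipschitzian_on PX (\<lambda>\<mu>. A \<mu> x y)"
  using A_lip unfolding lipschitzian_on_def by blast

lemma lipschitzian_on_Qlim: "lipschitzian_on PX (Qlim K A x y)"
proof -
  have off: "lipschitzian_on PX (Qlim K A x y)" if "x \<noteq> y" for x y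
    unfolding Qlim_off_diag[OF that, abs_def]
    by (intro lipschitzian_on_mult compact_PX lipschitzian_on_sqrt_gibbs_ratio lipschitzian_on_A)
  show ?thesis
  proof (cases "x = y")
    case True
    have "lipschitzian_on PX (\<lambda>\<mu>. - (\<Sum>z\<in>UNIV - {x}. Qlim K A x z \<mu>))"
      by (intro lipschitzian_on_minus lipschitzian_on_sum off) auto
    moreover have "Qlim K A x y = (\<lambda>\<mu>. - (\<Sum>z\<in>UNIV - {x}. Qlim K A x z \<mu>))"
      unfolding True[symmetric] by (rule ext, rule Qlim_diag)
    ultimately show ?thesis by simp
  qed (rule off)
qed

lemma Qlim_bounded: "\<exists>B>0. \<forall>x y. \<forall>\<mu>\<in>PX. \<bar>Qlim K A x y \<mu>\<bar> \<le> B"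
  using ex_uniform_bound[OF compact_PX lipschitzian_on_continuous[OF lipschitzian_on_Qlim], of fst snd]
  by simp

lemma Qlim_nonneg: "\<mu> \<in> PX \<Longrightarrow> x \<noteq> y \<Longrightarrow> 0 \<le> Qlim K A x y \<mu>"
  using A_good by (simp add: Qlim_off_diag good_mat_def sqrt_gibbs_ratio_def)

lemma lipschitzian_on_bfield: "lipschitzian_on PX (bfield K A)"
proof (rule lipschitzian_on_vec)
  show "lipschitzian_on PX (\<lambda>\<nu>. bfield K A \<nu> $ x)" for x
    unfolding bfield_def vec_lambda_beta
    by (intro lipschitzian_on_sum lipschitzian_on_mult compact_PX lipschitzian_on_nth
        lipschitzian_on_Qlim)
qed

lemma bfield_inward: "\<exists>h>0. \<forall>\<nu>\<in>PX. \<nu> + h *\<^sub>R bfield K A \<nu> \<in> PX"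
proof -
  obtain B where B: "0 < B" "\<And>x y \<mu>. \<mu> \<in> PX \<Longrightarrow> \<bar>Qlim K A x y \<mu>\<bar> \<le> B" using Qlim_bounded by blast
  have "\<nu> + (1 / B) *\<^sub>R bfield K A \<nu> \<in> PX" if \<nu>: "\<nu> \<in> PX" for \<nu>
  proof -
    have "0 \<le> \<nu> $ x + 1 / B * bfield K A \<nu> $ x" for x
    proof -
      have "- B * \<nu> $ x \<le> Qlim K A x x \<nu> * \<nu> $ x"
        using B(2)[OF \<nu>, of x x] PX_nth_bounds(1)[OF \<nu>] by (intro mult_right_mono) auto
      also have "\<dots> \<le> \<nu> $ x * Qlim K A x x \<nu> + (\<Sum>y\<in>UNIV - {x}. \<nu> $ y * Qlim K A y x \<nu>)"
        using sum_nonneg[of "UNIV - {x}" "\<lambda>y. \<nu> $ y * Qlim K A y x \<nu>"]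
        by (simp add: PX_nth_bounds(1)[OF \<nu>] Qlim_nonneg[OF \<nu>])
      also have "\<dots> = bfield K A \<nu> $ x" by (simp add: bfield_def sum.remove[of UNIV x])
      finally have "1 / B * (- B * \<nu> $ x) \<le> 1 / B * bfield K A \<nu> $ x"
        using B(1) by (intro mult_left_mono) auto
      then show ?thesis using B(1) by simp
    qed
    then show ?thesis
      using \<nu> by (simp add: PX_def sum.distrib sum_distrib_left[symmetric]
          sum_divide_distrib[symmetric] sum_bfield)
  qed
  then show ?thesis using B(1) by (intro exI[of _ "1 / B"]) auto
qed

definition flow :: "real \<Rightarrow> real^'x \<Rightarrow> real^'x" where
  "flow = (SOME \<Phi>. semiflow PX (bfield K A) \<Phi>)"

sublocale semiflow PX "bfield K A" flow
proof -
  obtain L h where "L-lipschitz_on PX (bfield K A)" "0 < h" "\<And>\<nu>. \<nu> \<in> PX \<Longrightarrow> \<nu> + h *\<^sub>R bfield K A \<nu> \<in> PX"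
    using lipschitzian_on_bfield bfield_inward unfolding lipschitzian_on_def by blast
  from semiflow_exists[OF compact_imp_closed[OF compact_PX] convex_PX PX_nonempty this]
  show "semiflow PX (bfield K A) flow" unfolding flow_def by (rule someI_ex)
qed

end

subsection \<open>The particle generator\<close>

lemma sum_single_site_changes:
  fixes g :: "(nat \<Rightarrow> 'x::finite) \<Rightarrow> real"
  assumes c: "c \<in> configs N" and i: "i < N"
  shows "(\<Sum>c'\<in>configs N. if c' i \<noteq> c i \<and> c' = c(i := c' i) then g c' else 0)
    = (\<Sum>y\<in>UNIV - {c i}. g (c(i := y)))"
proof -
  have "(\<Sum>c'\<in>configs N. if c' i \<noteq> c i \<and> c' = c(i := c' i) then g c' else 0)
     = (\<Sum>c'\<in>{c' \<in> configs N. c' i \<noteq> c i \<and> c' = c(i := c' i)}. g c')"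
    by (rule sum.inter_filter[symmetric]) simp
  also have "{c' \<in> configs N. c' i \<noteq> c i \<and> c' = c(i := c' i)} = (\<lambda>y. c(i := y)) ` (UNIV - {c i})"
  proof (intro equalityI subsetI)
    fix c' assume "c' \<in> {c' \<in> configs N. c' i \<noteq> c i \<and> c' = c(i := c' i)}"
    then show "c' \<in> (\<lambda>y. c(i := y)) ` (UNIV - {c i})" by (intro image_eqI[of _ _ "c' i"]) auto
  qed (use configs_upd[OF c i] in auto)
  also have "(\<Sum>c'\<in>(\<lambda>y. c(i := y)) ` (UNIV - {c i}). g c') = (\<Sum>y\<in>UNIV - {c i}. g (c(i := y)))"
    by (subst sum.reindex) (auto intro!: inj_onI dest: fun_upd_eqD)
  finally show ?thesis .
qed

lemma sum_QBoff:
  assumes "c \<in> configs N"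
  shows "(\<Sum>c'\<in>configs N. QBoff K AN N c c' * f c')
    = (\<Sum>i<N. \<Sum>y\<in>UNIV - {c i}. QsN K AN N (c i) y (LN N c) * f (c(i := y)))"
proof -
  have "(\<Sum>c'\<in>configs N. QBoff K AN N c c' * f c')
    = (\<Sum>i<N. \<Sum>c'\<in>configs N. if c' i \<noteq> c i \<and> c' = c(i := c' i)
          then QsN K AN N (c i) (c' i) (LN N c) * f c' else 0)"
    unfolding QBoff_def sum_distrib_right by (subst sum.swap) (intro sum.cong, auto)
  also have "\<dots> = (\<Sum>i<N. \<Sum>y\<in>UNIV - {c i}. QsN K AN N (c i) y (LN N c) * f (c(i := y)))"
    using sum_single_site_changes[OF assms, where g = "\<lambda>c'. QsN K AN N (c i) (c' i) (LN N c) * f c'"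
        and i = i for i]
    by (intro sum.cong) auto
  finally show ?thesis .
qed

lemma QBoff_self: "QBoff K AN N c c = 0"
  unfolding QBoff_def by simp

lemma QB_eq: "QB K AN N c c' = QBoff K AN N c c' - (if c = c' then \<Sum>d\<in>configs N. QBoff K AN N c d else 0)"
  using sum.mono_neutral_left[of "configs N" "configs N - {c}" "QBoff K AN N c"]
  by (auto simp: QB_def QBoff_self)

lemma sum_QB:
  assumes "c \<in> configs N"
  shows "(\<Sum>c'\<in>configs N. QB K AN N c c' * f c')
    = (\<Sum>i<N. \<Sum>y\<in>UNIV - {c i}. QsN K AN N (c i) y (LN N c) * (f (c(i := y)) - f c))"
proof -
  have "(\<Sum>c'\<in>configs N. QB K AN N c c' * f c')
      = (\<Sum>c'\<in>configs N. QBoff K AN N c c' * f c') - (\<Sum>c'\<in>configs N. QBoff K AN N c c' * f c)"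
    using assms
    by (simp add: QB_eq left_diff_distrib sum_subtractf sum_distrib_right if_distrib[of "\<lambda>a. a * _"]
        cong: if_cong)
  then show ?thesis
    unfolding sum_QBoff[OF assms] by (simp add: right_diff_distrib sum_subtractf)
qed

lemma comp_permutes_eq_iff: "\<sigma> permutes S \<Longrightarrow> f \<circ> \<sigma> = g \<circ> \<sigma> \<longleftrightarrow> f = g"
  by (metis comp_assoc comp_id permutes_inv_o(1))

lemma QBoff_comp:
  assumes \<sigma>: "\<sigma> permutes {..<N}"
  shows "QBoff K AN N (c \<circ> \<sigma>) (c' \<circ> \<sigma>) = QBoff K AN N c c'"
proof -
  have "(c' \<circ> \<sigma> = (c \<circ> \<sigma>)(i := c' (\<sigma> i))) = (c' = c(\<sigma> i := c' (\<sigma> i)))" for i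
  proof -
    have "(c \<circ> \<sigma>)(i := c' (\<sigma> i)) = c(\<sigma> i := c' (\<sigma> i)) \<circ> \<sigma>"
      using permutes_inj[OF \<sigma>] by (auto simp: fun_eq_iff inj_eq)
    then show ?thesis by (simp only: comp_permutes_eq_iff[OF \<sigma>])
  qed
  then have "QBoff K AN N (c \<circ> \<sigma>) (c' \<circ> \<sigma>) = (\<Sum>i<N. if c' (\<sigma> i) \<noteq> c (\<sigma> i) \<and> c' = c(\<sigma> i := c' (\<sigma> i))
      then QsN K AN N (c (\<sigma> i)) (c' (\<sigma> i)) (LN N c) else 0)"
    by (simp add: QBoff_def LN_comp[OF \<sigma>] cong: if_cong)
  also have "\<dots> = QBoff K AN N c c'"
    unfolding QBoff_def by (rule sum.permute[OF \<sigma>, symmetric, unfolded comp_def])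
  finally show ?thesis .
qed

lemma QB_comp:
  assumes \<sigma>: "\<sigma> permutes {..<N}"
  shows "QB K AN N (c \<circ> \<sigma>) (c' \<circ> \<sigma>) = QB K AN N c c'"
proof -
  have "(\<Sum>d\<in>configs N. QBoff K AN N (c \<circ> \<sigma>) d) = (\<Sum>d\<in>configs N. QBoff K AN N c d)"
    by (subst sum_configs_comp[OF \<sigma>, symmetric]) (simp add: QBoff_comp[OF \<sigma>])
  then show ?thesis by (simp only: QB_eq QBoff_comp[OF \<sigma>] comp_permutes_eq_iff[OF \<sigma>])
qed

lemma square_distance_jump:
  assumes "i < N" "y \<noteq> c i"
  shows "(norm (LN N (c(i := y)) - v))\<^sup>2 - (norm (LN N c - v))\<^sup>2
    = (2 * ((LN N c - v) $ y - (LN N c - v) $ c i) + 2 / real N) / real N"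
proof -
  define u where "u = LN N c - v"
  define d where "d = axis y 1 - axis (c i) (1::real)"
  have "LN N (c(i := y)) - v = u + (1 / real N) *\<^sub>R d"
    using assms(1) by (simp add: LN_upd u_def d_def)
  then have "(norm (LN N (c(i := y)) - v))\<^sup>2 = (norm u)\<^sup>2 + 2 * (u \<bullet> d) / real N + (d \<bullet> d) / (real N)\<^sup>2"
    unfolding power2_norm_eq_inner
    by (simp add: inner_add_left inner_add_right inner_commute power2_eq_square)
  moreover have "u \<bullet> d = u $ y - u $ c i" by (simp add: d_def inner_diff_right inner_axis)
  moreover have "d \<bullet> d = 2"
    using assms(2) by (simp add: d_def inner_diff_left inner_diff_right inner_axis_axis)
  ultimately show ?thesis unfolding u_def by (simp add: add_divide_distrib power2_eq_square)
qed

lemma jump_rate_estimate: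
  fixes q Q z n :: real
  assumes "\<bar>q - Q\<bar> \<le> e" "\<bar>Q\<bar> \<le> B" "\<bar>z\<bar> \<le> 2" "0 \<le> n"
  shows "q * (2 * z + 2 / n) \<le> Q * (2 * z) + (4 * e + 2 * (B + e) / n)"
proof -
  have "(q - Q) * (2 * z) \<le> \<bar>q - Q\<bar> * \<bar>2 * z\<bar>" by (metis abs_ge_self abs_mult)
  also have "\<dots> \<le> e * 4" using assms(1,3) by (intro mult_mono) auto
  finally have "(q - Q) * (2 * z) \<le> 4 * e" by simp
  moreover have "q * (2 / n) \<le> (B + e) * (2 / n)"
    using assms by (intro mult_right_mono) auto
  moreover have "q * (2 * z + 2 / n) = Q * (2 * z) + (q - Q) * (2 * z) + q * (2 / n)"
    by (simp add: algebra_simps)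
  moreover have "(B + e) * (2 / n) = 2 * (B + e) / n" by simp
  ultimately show ?thesis by linarith
qed

context mean_field
begin

lemma finite_generator_QB:
  assumes "0 < N"
  shows "finite_generator (configs N) (QB K AN N)"
proof
  fix c c' :: "nat \<Rightarrow> 'x" assume "c \<noteq> c'"
  have "0 \<le> AN N (LN N c) x y" for x y
    using AN_good LN_in_PX[OF assms] unfolding good_mat_def by blast
  then show "0 \<le> QB K AN N c c'"
    using \<open>c \<noteq> c'\<close> unfolding QB_def QBoff_def QsN_def by (auto intro!: sum_nonneg)
next
  fix c :: "nat \<Rightarrow> 'x" assume "c \<in> configs N"
  then show "(\<Sum>c'\<in>configs N. QB K AN N c c') = 0"
    using sum_QB[of c N K AN "\<lambda>_. 1"] by simp
qed simp

abbreviation particle_kernel :: "nat \<Rightarrow> real \<Rightarrow> (nat \<Rightarrow> 'x) \<Rightarrow> (nat \<Rightarrow> 'x) \<Rightarrow> real" where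
  "particle_kernel N \<equiv> finite_generator.trans_prob (configs N) (QB K AN N)"

abbreviation particle_solution :: "nat \<Rightarrow> (real \<Rightarrow> (nat \<Rightarrow> 'x) \<Rightarrow> real) \<Rightarrow> bool" where
  "particle_solution N \<equiv> finite_generator.forward_solution (configs N) (QB K AN N)"

lemma particle_solution_symmetrize:
  assumes "0 < N" and u: "particle_solution N u"
  shows "particle_solution N (\<lambda>t. symmetrize N (u t))"
proof -
  interpret finite_generator "configs N" "QB K AN N" by (rule finite_generator_QB[OF assms(1)])
  have "((\<lambda>s. symmetrize N (u s) c) has_real_derivative
      (\<Sum>d\<in>configs N. symmetrize N (u t) d * QB K AN N d c)) (at t within {0..})"
    if t: "0 \<le> t" and c: "c \<in> configs N" for t c
  proof -
    have "((\<lambda>s. symmetrize N (u s) c) has_real_derivative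
        (\<Sum>\<sigma> | \<sigma> permutes {..<N}. \<Sum>d\<in>configs N. u t d * QB K AN N d (c \<circ> \<sigma>)) / fact N) (at t within {0..})"
      unfolding symmetrize_def using u t configs_comp[OF _ c]
      by (intro DERIV_cdivide DERIV_sum) (auto simp: forward_solution_def)
    moreover have "(\<Sum>d\<in>configs N. u t d * QB K AN N d (c \<circ> \<sigma>))
        = (\<Sum>d\<in>configs N. u t (d \<circ> \<sigma>) * QB K AN N d c)"
      if "\<sigma> permutes {..<N}" for \<sigma>
      using sum_configs_comp[OF that, of "\<lambda>d. u t d * QB K AN N d (c \<circ> \<sigma>)"]
      by (simp add: QB_comp[OF that])
    moreover have "(\<Sum>\<sigma> | \<sigma> permutes {..<N}. \<Sum>d\<in>configs N. u t (d \<circ> \<sigma>) * QB K AN N d c) / fact N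
        = (\<Sum>d\<in>configs N. symmetrize N (u t) d * QB K AN N d c)"
      by (subst sum.swap) (simp add: symmetrize_def sum_distrib_right sum_divide_distrib)
    ultimately show ?thesis by simp
  qed
  then show ?thesis by (simp add: forward_solution_def)
qed

text \<open>The entropy lost by symmetrization is a relative entropy between two solutions, hence can only
  decrease.\<close>

lemma neg_entropy_propagation:
  assumes N: "0 < N" and u: "particle_solution N u" and prob: "\<And>t. 0 \<le> t \<Longrightarrow> is_prob_configs N (u t)"
    and t: "0 \<le> t"
  shows "neg_entropy N (u t) \<le> neg_entropy N (u 0)
    + real N * (empirical_mean N (u 0) shannon - empirical_mean N (u t) shannon)
    + 3 * counting_error TYPE('x) N"
proof -
  interpret finite_generator "configs N" "QB K AN N" by (rule finite_generator_QB[OF N])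
  have u0: "is_prob_configs N (u 0)" using prob by simp
  have "relative_entropy (configs N) (u t) (symmetrize N (u t))
      \<le> relative_entropy (configs N) (u 0) (symmetrize N (u 0))"
  proof (rule relative_entropy_forward_decreasing[OF u particle_solution_symmetrize[OF N u] t])
    fix c :: "nat \<Rightarrow> 'x" assume c: "c \<in> configs N"
    show "0 \<le> u 0 c" by (rule is_prob_configsD(1)[OF u0 c])
    show "0 \<le> symmetrize N (u 0) c" by (rule symmetrize_nonneg[OF is_prob_configsD(1)[OF u0] c])
    show "u 0 c = 0" if "symmetrize N (u 0) c = 0"
      by (rule symmetrize_eq_0[OF is_prob_configsD(1)[OF u0] c that])
  qed
  then have "neg_entropy N (u t) - neg_entropy N (symmetrize N (u t))
      \<le> neg_entropy N (u 0) - neg_entropy N (symmetrize N (u 0))"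
    unfolding relative_entropy_symmetrize[OF prob[OF t]] relative_entropy_symmetrize[OF u0] .
  moreover have "neg_entropy N (symmetrize N (u t))
      \<le> - real N * empirical_mean N (u t) shannon + counting_error TYPE('x) N"
    using neg_entropy_exchangeable_upper_bound[OF N is_prob_configs_symmetrize[OF prob[OF t]]
        exchangeable_symmetrize]
    by (simp add: empirical_mean_symmetrize)
  moreover have "- real N * empirical_mean N (u 0) shannon - 2 * counting_error TYPE('x) N
      \<le> neg_entropy N (symmetrize N (u 0))"
    using neg_entropy_lower_bound[OF N is_prob_configs_symmetrize[OF u0]]
    by (simp add: empirical_mean_symmetrize)
  ultimately show ?thesis by (simp add: right_diff_distrib)
qed

definition rates_within :: "nat \<Rightarrow> real \<Rightarrow> bool" where
  "rates_within N e \<longleftrightarrow> (\<forall>c. \<forall>i<N. \<forall>y. y \<noteq> c i \<longrightarrow>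
     \<bar>QsN K AN N (c i) y (LN N c) - Qlim K A (c i) y (LN N c)\<bar> \<le> e)"

lemma ex_QsN_eq_sqrt_gibbs_ratio:
  assumes "i < N"
  shows "\<exists>\<xi>\<in>PX. dist \<xi> (LN N c) \<le> 2 / real N \<and>
    QsN K AN N (c i) y (LN N c) = sqrt_gibbs_ratio K (c i) y \<xi> * AN N (LN N c) (c i) y"
proof -
  have N: "0 < N" using assms by simp
  define d :: "real^'x" where "d = axis y 1 - axis (c i) 1"
  have jump: "LN N (c(i := y)) = LN N c + (1 / real N) *\<^sub>R d"
    unfolding d_def by (rule LN_upd[OF assms])
  obtain \<xi> where \<xi>: "\<xi> \<in> PX" "dist \<xi> (LN N c) \<le> dist (LN N (c(i := y))) (LN N c)"
    "UU K (LN N (c(i := y))) - UU K (LN N c) = (\<Sum>x\<in>UNIV. (LN N (c(i := y)) - LN N c) $ x * HH K x \<xi>)"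
    using mean_value_on_convex[OF convex_PX LN_in_PX[OF N] LN_in_PX[OF N] UU_has_derivative] by blast
  have "norm d \<le> 2"
    using norm_triangle_ineq4[of "axis y 1 :: real^'x" "axis (c i) 1"] by (simp add: d_def)
  then have "dist (LN N (c(i := y))) (LN N c) \<le> 2 / real N"
    by (simp add: jump dist_norm divide_right_mono)
  with \<xi>(2) have "dist \<xi> (LN N c) \<le> 2 / real N" by (rule order_trans)
  moreover have "(\<Sum>x\<in>UNIV. d $ x * HH K x \<xi>) = HH K y \<xi> - HH K (c i) \<xi>"
    by (simp add: d_def axis_def left_diff_distrib sum_subtractf if_distrib[of "\<lambda>a. a * _"] cong: if_cong)
  then have "real N * (UU K (LN N (c(i := y))) - UU K (LN N c)) = HH K y \<xi> - HH K (c i) \<xi>"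
    unfolding \<xi>(3) using N by (simp add: jump sum_divide_distrib[symmetric])
  then have "- (real N / 2) * (UU K (LN N (c(i := y))) - UU K (LN N c)) = (HH K (c i) \<xi> - HH K y \<xi>) / 2"
    by (simp add: field_simps)
  ultimately show ?thesis
    using \<xi>(1) unfolding QsN_def sqrt_gibbs_ratio_def d_def[symmetric] jump[symmetric] by metis
qed

lemma rate_error_le:
  assumes "i < N" "y \<noteq> c i" and L: "L-lipschitz_on PX (sqrt_gibbs_ratio K (c i) y)"
    and W: "\<And>\<mu>. \<mu> \<in> PX \<Longrightarrow> norm (sqrt_gibbs_ratio K (c i) y \<mu>) \<le> W"
    and B: "\<And>\<mu>. \<mu> \<in> PX \<Longrightarrow> norm (A \<mu> (c i) y) \<le> B"
    and \<delta>: "\<And>\<mu>. \<mu> \<in> PX \<Longrightarrow> dist (AN N \<mu> (c i) y) (A \<mu> (c i) y) \<le> \<delta>"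
  shows "\<bar>QsN K AN N (c i) y (LN N c) - Qlim K A (c i) y (LN N c)\<bar> \<le> W * \<delta> + L * 2 * B / real N"
proof -
  define \<mu> where "\<mu> = LN N c"
  define w where "w = sqrt_gibbs_ratio K (c i) y"
  have \<mu>: "\<mu> \<in> PX" using assms(1) by (simp add: \<mu>_def LN_in_PX)
  obtain \<xi> where \<xi>: "\<xi> \<in> PX" "dist \<xi> \<mu> \<le> 2 / real N" "QsN K AN N (c i) y \<mu> = w \<xi> * AN N \<mu> (c i) y"
    using ex_QsN_eq_sqrt_gibbs_ratio[OF assms(1), of c y] unfolding \<mu>_def w_def by blast
  have "\<bar>w \<xi> - w \<mu>\<bar> \<le> L * dist \<xi> \<mu>"
    using lipschitz_onD[OF L \<xi>(1) \<mu>] by (simp add: w_def dist_real_def)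
  also have "\<dots> \<le> L * (2 / real N)" using \<xi>(2) lipschitz_on_nonneg[OF L] by (rule mult_left_mono)
  finally have w_diff: "\<bar>w \<xi> - w \<mu>\<bar> \<le> L * (2 / real N)" .
  have "\<bar>QsN K AN N (c i) y \<mu> - Qlim K A (c i) y \<mu>\<bar>
      \<le> \<bar>w \<xi>\<bar> * \<bar>AN N \<mu> (c i) y - A \<mu> (c i) y\<bar> + \<bar>w \<xi> - w \<mu>\<bar> * \<bar>A \<mu> (c i) y\<bar>"
    unfolding \<xi>(3) Qlim_off_diag[OF assms(2)[symmetric]] w_def by (rule abs_mult_diff_mult_le)
  also have "\<dots> \<le> W * \<delta> + L * (2 / real N) * B"
    using w_diff W[OF \<xi>(1)] B[OF \<mu>] \<delta>[OF \<mu>] lipschitz_on_nonneg[OF L] W[OF \<mu>]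
    by (intro add_mono mult_mono) (auto simp: w_def dist_real_def intro: order_trans[OF abs_ge_zero])
  finally show ?thesis by (simp add: \<mu>_def)
qed

lemma eventually_rate_within:
  assumes "0 < e" "x \<noteq> y"
  shows "\<forall>\<^sub>F N in sequentially. \<forall>c. \<forall>i<N. c i = x \<longrightarrow>
    \<bar>QsN K AN N x y (LN N c) - Qlim K A x y (LN N c)\<bar> \<le> e"
proof -
  let ?w = "sqrt_gibbs_ratio K x y"
  obtain L where L: "L-lipschitz_on PX ?w"
    using lipschitzian_on_sqrt_gibbs_ratio unfolding lipschitzian_on_def by blast
  obtain W where W: "0 \<le> W" "\<And>\<mu>. \<mu> \<in> PX \<Longrightarrow> norm (?w \<mu>) \<le> W"
    using continuous_on_compact_bound[OF compact_PX
        lipschitzian_on_continuous[OF lipschitzian_on_sqrt_gibbs_ratio]]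
    by blast
  obtain B where B: "\<And>\<mu>. \<mu> \<in> PX \<Longrightarrow> norm (A \<mu> x y) \<le> B"
    using continuous_on_compact_bound[OF compact_PX
        lipschitzian_on_continuous[OF lipschitzian_on_A]] by blast
  define \<delta> where "\<delta> = e / (2 * (W + 1))"
  have "0 < \<delta>" "W * \<delta> \<le> e / 2" using W(1) assms(1) by (simp_all add: \<delta>_def field_simps)
  then have "\<forall>\<^sub>F N in sequentially. \<forall>\<mu>\<in>PX. dist (AN N \<mu> x y) (A \<mu> x y) < \<delta>"
    using AN_conv by (intro uniform_limitD) auto
  moreover have "\<forall>\<^sub>F N in sequentially. L * 2 * B / real N < e / 2"
    using assms(1) by (intro order_tendstoD(2)[OF lim_const_over_n]) auto
  ultimately show ?thesis
  proof eventually_elim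
    case (elim N)
    show ?case
    proof (intro allI impI)
      fix c :: "nat \<Rightarrow> 'x" and i assume i: "i < N" "c i = x"
      have "\<bar>QsN K AN N x y (LN N c) - Qlim K A x y (LN N c)\<bar> \<le> W * \<delta> + L * 2 * B / real N"
        using rate_error_le[of i N y c L W B \<delta>] i assms(2) L W(2) B elim(1) by (auto intro: less_imp_le)
      then show "\<bar>QsN K AN N x y (LN N c) - Qlim K A x y (LN N c)\<bar> \<le> e"
        using elim(2) \<open>W * \<delta> \<le> e / 2\<close> by linarith
    qed
  qed
qed

lemma eventually_rates_within:
  assumes "0 < e"
  shows "\<forall>\<^sub>F N in sequentially. rates_within N e"
proof -
  have "\<forall>\<^sub>F N in sequentially. x \<noteq> y \<longrightarrow> (\<forall>c. \<forall>i<N. c i = x \<longrightarrow>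
      \<bar>QsN K AN N x y (LN N c) - Qlim K A x y (LN N c)\<bar> \<le> e)" for x y
    using eventually_rate_within[OF assms, of x y] by (cases "x = y") auto
  then have "\<forall>\<^sub>F N in sequentially. \<forall>x y. x \<noteq> y \<longrightarrow> (\<forall>c. \<forall>i<N. c i = x \<longrightarrow>
      \<bar>QsN K AN N x y (LN N c) - Qlim K A x y (LN N c)\<bar> \<le> e)"
    by (intro eventually_all_finite)
  then show ?thesis unfolding rates_within_def by (rule eventually_mono) metis
qed

subsection \<open>Propagation of the mean square distance to the flow\<close>

lemma generator_square_distance:
  assumes N: "0 < N" and c: "c \<in> configs N" and v: "v \<in> PX" and rates: "rates_within N e"
    and B: "\<And>x y. \<bar>Qlim K A x y (LN N c)\<bar> \<le> B" and "0 \<le> e"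
  shows "(\<Sum>c'\<in>configs N. QB K AN N c c' * (norm (LN N c' - v))\<^sup>2)
    \<le> 2 * ((LN N c - v) \<bullet> bfield K A (LN N c)) + CARD('x) * (4 * e + 2 * (B + e) / real N)"
proof -
  define \<mu> where "\<mu> = LN N c"
  define u where "u = \<mu> - v"
  define \<eta> where "\<eta> = 4 * e + 2 * (B + e) / real N"
  have \<mu>: "\<mu> \<in> PX" unfolding \<mu>_def by (rule LN_in_PX[OF N])
  have "0 \<le> B" using B[of undefined undefined] by (meson abs_ge_zero order_trans)
  then have \<eta>: "0 \<le> \<eta>" unfolding \<eta>_def using \<open>0 \<le> e\<close> by simp
  have u_diff: "\<bar>u $ y - u $ x\<bar> \<le> 2" for x y
    using PX_nth_bounds[OF \<mu>, of y] PX_nth_bounds[OF \<mu>, of x] PX_nth_bounds[OF v, of y]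
        PX_nth_bounds[OF v, of x]
    unfolding u_def by (simp add: abs_le_iff)
  define G where "G x = (\<Sum>y\<in>UNIV - {x}. Qlim K A x y \<mu> * (2 * (u $ y - u $ x)))" for x
  have "(\<Sum>c'\<in>configs N. QB K AN N c c' * (norm (LN N c' - v))\<^sup>2)
      = (\<Sum>i<N. \<Sum>y\<in>UNIV - {c i}. QsN K AN N (c i) y \<mu> * (2 * (u $ y - u $ c i) + 2 / real N) / real N)"
    unfolding sum_QB[OF c] \<mu>_def u_def by (intro sum.cong) (auto simp: square_distance_jump)
  also have "\<dots> \<le> (\<Sum>i<N. \<Sum>y\<in>UNIV - {c i}. (Qlim K A (c i) y \<mu> * (2 * (u $ y - u $ c i)) + \<eta>) / real N)"
    unfolding \<eta>_def using rates B u_diff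
    by (intro sum_mono divide_right_mono jump_rate_estimate) (auto simp: rates_within_def \<mu>_def)
  also have "\<dots> = (\<Sum>i<N. G (c i) / real N + real (card (UNIV - {c i})) * (\<eta> / real N))"
    unfolding G_def by (simp add: add_divide_distrib sum.distrib sum_divide_distrib)
  also have "\<dots> \<le> (\<Sum>i<N. G (c i) / real N + real CARD('x) * (\<eta> / real N))"
    using \<eta> by (intro sum_mono add_left_mono mult_right_mono) (auto intro: card_mono)
  also have "\<dots> = (\<Sum>i<N. G (c i)) / real N + real CARD('x) * \<eta>"
    using N by (simp add: sum.distrib sum_divide_distrib)
  also have "(\<Sum>i<N. G (c i)) = real N * (\<Sum>x\<in>UNIV. \<mu> $ x * G x)"
    unfolding \<mu>_def by (rule sum_sites_eq_LN[OF N])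
  also have "(\<Sum>x\<in>UNIV. \<mu> $ x * G x) = 2 * (u \<bullet> bfield K A \<mu>)"
    unfolding inner_bfield G_def sum_distrib_left by (intro sum.cong) (auto simp: algebra_simps)
  finally show ?thesis using N unfolding \<eta>_def u_def \<mu>_def by simp
qed

lemma square_distance_drift:
  assumes N: "0 < N" and c: "c \<in> configs N" and \<nu>: "\<nu> \<in> PX" and rates: "rates_within N e" and "0 \<le> e"
    and B: "\<And>x y. \<bar>Qlim K A x y (LN N c)\<bar> \<le> B" and L: "L-lipschitz_on PX (bfield K A)"
  shows "(\<Sum>c'\<in>configs N. QB K AN N c c' * (norm (LN N c' - \<nu>))\<^sup>2)
    + 2 * ((LN N c - \<nu>) \<bullet> (0 - bfield K A \<nu>))
    \<le> 2 * L * (norm (LN N c - \<nu>))\<^sup>2 + CARD('x) * (4 * e + 2 * (B + e) / real N)"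
  using generator_square_distance[OF N c \<nu> rates B \<open>0 \<le> e\<close>]
      lipschitz_on_inner_le[OF L LN_in_PX[OF N, of c] \<nu>]
  by (simp add: inner_diff_right)

lemma mean_square_distance_bound:
  assumes N: "0 < N" and x: "x \<in> configs N" and t: "0 \<le> t" and rates: "rates_within N e" and e: "0 \<le> e"
    and B: "\<And>x y \<mu>. \<mu> \<in> PX \<Longrightarrow> \<bar>Qlim K A x y \<mu>\<bar> \<le> B" and L: "L-lipschitz_on PX (bfield K A)"
  shows "(\<Sum>y\<in>configs N. particle_kernel N t x y * (norm (LN N y - flow t (LN N x)))\<^sup>2)
    \<le> CARD('x) * (4 * e + 2 * (B + e) / real N) / (2 * L + 1) * exp ((2 * L + 1) * t)"
proof -
  interpret finite_generator "configs N" "QB K AN N" by (rule finite_generator_QB[OF N])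
  define \<eta> where "\<eta> = CARD('x) * (4 * e + 2 * (B + e) / real N)"
  define a where "a = 2 * L + 1"
  define D where "D y s = LN N y - flow s (LN N x)" for y s
  have "0 \<le> B" using B[OF LN_in_PX[OF N], of undefined undefined] by (meson abs_ge_zero order_trans)
  then have \<eta>: "0 \<le> \<eta> / a" using e lipschitz_on_nonneg[OF L] by (simp add: \<eta>_def a_def)
  have a: "0 < a" using lipschitz_on_nonneg[OF L] by (simp add: a_def)
  have D_0: "D x 0 = 0" by (simp add: D_def flow_0[OF LN_in_PX[OF N]])
  have "(\<Sum>y\<in>configs N. trans_prob t x y * ((norm (D y t))\<^sup>2 + \<eta> / a))
      \<le> ((norm (D x 0))\<^sup>2 + \<eta> / a) * exp (a * t)"
  proof (rule gronwall_expectation[OF x t])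
    fix y :: "nat \<Rightarrow> 'x" and s :: real assume y: "y \<in> configs N" and s: "0 \<le> s"
    show "((\<lambda>s. (norm (D y s))\<^sup>2 + \<eta> / a) has_real_derivative
        2 * (D y s \<bullet> (0 - bfield K A (flow s (LN N x)))) + 0) (at s within {0..})"
      unfolding D_def
      by (intro DERIV_add DERIV_const has_real_derivative_norm_square has_vector_derivative_diff
          has_vector_derivative_const flow_ode s)
    have "(\<Sum>z\<in>configs N. QB K AN N y z * ((norm (D z s))\<^sup>2 + \<eta> / a))
        = (\<Sum>z\<in>configs N. QB K AN N y z * (norm (D z s))\<^sup>2)"
      by (simp add: sum_QB[OF y])
    also have "\<dots> + 2 * (D y s \<bullet> (0 - bfield K A (flow s (LN N x)))) \<le> 2 * L * (norm (D y s))\<^sup>2 + \<eta>"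
      unfolding D_def \<eta>_def
      by (rule square_distance_drift[OF N y flow_in[OF s] rates e B[OF LN_in_PX[OF N]] L])
    also have "2 * L * (norm (D y s))\<^sup>2 + \<eta> \<le> a * ((norm (D y s))\<^sup>2 + \<eta> / a)"
      using a lipschitz_on_nonneg[OF L] by (simp add: a_def field_simps)
    finally show "(\<Sum>z\<in>configs N. QB K AN N y z * ((norm (D z s))\<^sup>2 + \<eta> / a))
        + (2 * (D y s \<bullet> (0 - bfield K A (flow s (LN N x)))) + 0) \<le> a * ((norm (D y s))\<^sup>2 + \<eta> / a)"
      by simp
  qed
  moreover have "(\<Sum>y\<in>configs N. trans_prob t x y * ((norm (D y t))\<^sup>2 + \<eta> / a))
      = (\<Sum>y\<in>configs N. trans_prob t x y * (norm (D y t))\<^sup>2) + \<eta> / a"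
    by (simp only: distrib_left sum.distrib sum_trans_prob_const[OF x])
  ultimately show ?thesis using \<eta> unfolding D_0 unfolding \<eta>_def a_def D_def by simp
qed

lemma mean_square_distance_vanishes:
  assumes "0 < \<epsilon>" and t: "0 \<le> t"
  shows "\<forall>\<^sub>F N in sequentially. \<forall>x\<in>configs N.
    (\<Sum>y\<in>configs N. particle_kernel N t x y * (norm (LN N y - flow t (LN N x)))\<^sup>2) \<le> \<epsilon>"
proof -
  obtain L where L: "L-lipschitz_on PX (bfield K A)"
    using lipschitzian_on_bfield unfolding lipschitzian_on_def by blast
  obtain B where B: "0 < B" "\<And>x y \<mu>. \<mu> \<in> PX \<Longrightarrow> \<bar>Qlim K A x y \<mu>\<bar> \<le> B" using Qlim_bounded by blast
  define k where "k = CARD('x) / (2 * L + 1) * exp ((2 * L + 1) * t)"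
  have k: "0 < k" using lipschitz_on_nonneg[OF L] by (simp add: k_def)
  define e where "e = \<epsilon> / (8 * k)"
  have e: "0 < e" "k * (4 * e) = \<epsilon> / 2" using k \<open>0 < \<epsilon>\<close> by (simp_all add: e_def)
  have "\<forall>\<^sub>F N in sequentially. k * (2 * (B + e)) / real N < \<epsilon> / 2"
    using \<open>0 < \<epsilon>\<close> by (intro order_tendstoD(2)[OF lim_const_over_n]) auto
  then show ?thesis using eventually_rates_within[OF e(1)] eventually_gt_at_top[of 0]
  proof eventually_elim
    case (elim N)
    show ?case
    proof
      fix x :: "nat \<Rightarrow> 'x" assume x: "x \<in> configs N"
      have "(\<Sum>y\<in>configs N. particle_kernel N t x y * (norm (LN N y - flow t (LN N x)))\<^sup>2)
          \<le> CARD('x) * (4 * e + 2 * (B + e) / real N) / (2 * L + 1) * exp ((2 * L + 1) * t)"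
        using e(1) by (intro mean_square_distance_bound[OF elim(3) x t elim(2) _ B(2) L]) auto
      also have "\<dots> = k * (4 * e) + k * (2 * (B + e)) / real N"
        unfolding k_def by (simp add: field_simps add_divide_distrib)
      finally show "(\<Sum>y\<in>configs N. particle_kernel N t x y * (norm (LN N y - flow t (LN N x)))\<^sup>2) \<le> \<epsilon>"
        using elim(1) e(2) by linarith
    qed
  qed
qed

lemma particle_expectation_follows_flow:
  assumes f: "continuous_on PX f" and "0 < \<epsilon>" and t: "0 \<le> t"
  shows "\<forall>\<^sub>F N in sequentially. \<forall>x\<in>configs N.
    \<bar>(\<Sum>y\<in>configs N. particle_kernel N t x y * f (LN N y)) - f (flow t (LN N x))\<bar> \<le> \<epsilon>"
proof -
  obtain M where M: "0 \<le> M" "\<And>\<mu> \<nu>. \<mu> \<in> PX \<Longrightarrow> \<nu> \<in> PX \<Longrightarrow> \<bar>f \<mu> - f \<nu>\<bar> \<le> \<epsilon> / 2 + M * (norm (\<mu> - \<nu>))\<^sup>2"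
    using continuous_on_compact_square_modulus[OF compact_PX f, of "\<epsilon> / 2"] \<open>0 < \<epsilon>\<close> by auto
  have "0 < \<epsilon> / (2 * (M + 1))" using \<open>0 < \<epsilon>\<close> M(1) by simp
  from mean_square_distance_vanishes[OF this t] eventually_gt_at_top[of 0] show ?thesis
  proof eventually_elim
    case (elim N)
    interpret finite_generator "configs N" "QB K AN N" by (rule finite_generator_QB[OF elim(2)])
    show ?case
    proof
      fix x :: "nat \<Rightarrow> 'x" assume x: "x \<in> configs N"
      define \<nu> where "\<nu> = flow t (LN N x)"
      have "(\<Sum>y\<in>configs N. trans_prob t x y * f (LN N y)) - f \<nu>
          = (\<Sum>y\<in>configs N. trans_prob t x y * (f (LN N y) - f \<nu>))"
        by (simp add: right_diff_distrib sum_subtractf sum_trans_prob_const[OF x])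
      also have "\<bar>\<dots>\<bar> \<le> (\<Sum>y\<in>configs N. trans_prob t x y * (\<epsilon> / 2 + M * (norm (LN N y - \<nu>))\<^sup>2))"
      proof (intro order_trans[OF sum_abs] sum_mono)
        fix y :: "nat \<Rightarrow> 'x" assume y: "y \<in> configs N"
        have "\<bar>f (LN N y) - f \<nu>\<bar> \<le> \<epsilon> / 2 + M * (norm (LN N y - \<nu>))\<^sup>2"
          unfolding \<nu>_def by (intro M(2) LN_in_PX elim(2) flow_in t)
        then show "\<bar>trans_prob t x y * (f (LN N y) - f \<nu>)\<bar>
            \<le> trans_prob t x y * (\<epsilon> / 2 + M * (norm (LN N y - \<nu>))\<^sup>2)"
          using trans_prob_nonneg[OF x y t] by (simp add: abs_mult mult_left_mono)
      qed
      also have "\<dots> = \<epsilon> / 2 + M * (\<Sum>y\<in>configs N. trans_prob t x y * (norm (LN N y - \<nu>))\<^sup>2)"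
        by (simp only: distrib_left sum.distrib sum_trans_prob_const[OF x] sum_distrib_left
            mult.left_commute)
      also have "\<dots> \<le> \<epsilon> / 2 + M * (\<epsilon> / (2 * (M + 1)))"
        using elim(1) x M(1) unfolding \<nu>_def by (intro add_left_mono mult_left_mono) auto
      also have "\<dots> \<le> \<epsilon>" using M(1) \<open>0 < \<epsilon>\<close> by (simp add: field_simps)
      finally show "\<bar>(\<Sum>y\<in>configs N. trans_prob t x y * f (LN N y)) - f (flow t (LN N x))\<bar> \<le> \<epsilon>"
        unfolding \<nu>_def .
    qed
  qed
qed

end

subsection \<open>Passage to the limit\<close>

lemma test_funE:
  fixes \<phi> :: "real \<times> (real^'x::finite) \<Rightarrow> real"
  assumes "test_fun \<phi>"
  obtains \<phi>' a T where "\<And>p. (\<phi> has_derivative blinfun_apply (\<phi>' p)) (at p)" "continuous_on UNIV \<phi>'"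
    "0 < a" "a \<le> T" "\<And>t \<nu>. t \<notin> {a<..<T} \<Longrightarrow> \<phi> (t, \<nu>) = 0" "\<And>t \<nu>. t \<notin> {a<..<T} \<Longrightarrow> \<phi>' (t, \<nu>) = 0"
proof -
  obtain \<phi>' :: "real \<times> (real^'x) \<Rightarrow> (real \<times> (real^'x)) \<Rightarrow>\<^sub>L real" and C where
    \<phi>': "\<And>p. (\<phi> has_derivative blinfun_apply (\<phi>' p)) (at p)" "continuous_on UNIV \<phi>'"
    and C: "compact C" "C \<subseteq> {0<..} \<times> UNIV" "\<And>p. p \<notin> C \<Longrightarrow> \<phi> p = 0"
    using assms unfolding test_fun_def by blast
  have "\<phi>' p = 0" if p: "p \<notin> C" for p
  proof -
    have "open (- C)" using C(1) by (simp add: compact_imp_closed open_Compl)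
    then have "(\<phi> has_derivative (\<lambda>h. 0)) (at p)"
      using p C(3) by (intro has_derivative_transform_within_open[OF has_derivative_const[of 0]]) auto
    then have "blinfun_apply (\<phi>' p) = (\<lambda>h. 0)" using has_derivative_unique[OF \<phi>'(1)] by blast
    then show ?thesis by (intro blinfun_eqI) simp
  qed
  moreover obtain a T where aT: "0 < a" "a \<le> T" "fst ` C \<subseteq> {a<..<T}"
  proof (cases "C = {}")
    case True
    then show ?thesis using that[of 1 1] by simp
  next
    case False
    have times: "compact (fst ` C)" "fst ` C \<noteq> {}"
      using False C(1) by (auto intro!: compact_continuous_image continuous_intros)
    obtain r where r: "r \<in> fst ` C" "\<And>t. t \<in> fst ` C \<Longrightarrow> r \<le> t"
      using compact_attains_inf[OF times] by blast
    obtain s where s: "s \<in> fst ` C" "\<And>t. t \<in> fst ` C \<Longrightarrow> t \<le> s"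
      using compact_attains_sup[OF times] by blast
    have "0 < r" using r(1) C(2) by auto
    then show ?thesis using that[of "r / 2" "s + 1"] r s by fastforce
  qed
  ultimately show ?thesis using that[OF \<phi>', of a T] C(3) by fastforce
qed

locale well_prepared_particles = mean_field K A AN
  for K :: "'x::finite \<Rightarrow> real^'x \<Rightarrow> real"
    and A :: "real^'x \<Rightarrow> 'x \<Rightarrow> 'x \<Rightarrow> real"
    and AN :: "nat \<Rightarrow> real^'x \<Rightarrow> 'x \<Rightarrow> 'x \<Rightarrow> real" +
  fixes c :: "nat \<Rightarrow> real \<Rightarrow> (nat \<Rightarrow> 'x) \<Rightarrow> real" and C0 :: "(real^'x) measure"
  assumes c_prob: "\<forall>N\<ge>1. \<forall>t\<ge>0. is_prob_configs N (c N t)"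
    and c_ode: "\<forall>N\<ge>1. \<forall>t\<ge>0. \<forall>cy\<in>configs N.
          ((\<lambda>s. c N s cy) has_real_derivative (\<Sum>cx\<in>configs N. c N t cx * QB K AN N cx cy))
            (at t within {0..})"
    and C0_prob: "prob_on_simplex C0"
    and wp_entropy: "(\<lambda>N. FN K N (c N 0) / real N) \<longlonglongrightarrow> FFbig K C0 - FE0 K"
    and wp_weak: "weak_conv_along sequentially (\<lambda>N. pushLN N (c N 0)) C0"
begin

sublocale transported_measure PX "bfield K A" flow C0
proof (rule transported_measure.intro)
  show C0: "prob_space C0" using C0_prob by (simp add: prob_on_simplex_def)
  show "transported_measure_axioms PX (bfield K A) C0"
  proof
    have "measure C0 PX = 1" using C0_prob by (simp add: prob_on_simplex_def measure_def)
    then show "AE \<nu> in C0. \<nu> \<in> PX" by (rule prob_space.AE_prob_1[OF C0])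
  qed (use C0_prob compact_PX lipschitzian_on_continuous[OF lipschitzian_on_bfield] in
      \<open>auto simp: prob_on_simplex_def\<close>)
qed unfold_locales

lemma particle_solution_c: "0 < N \<Longrightarrow> particle_solution N (c N)"
  using c_ode finite_generator.forward_solution_def[OF finite_generator_QB] by simp

lemma empirical_mean_c:
  assumes "0 < N" "0 \<le> t"
  shows "empirical_mean N (c N t) f
    = (\<Sum>x\<in>configs N. c N 0 x * (\<Sum>y\<in>configs N. particle_kernel N t x y * f (LN N y)))"
proof -
  have "empirical_mean N (c N t) f
      = (\<Sum>y\<in>configs N. (\<Sum>x\<in>configs N. c N 0 x * particle_kernel N t x y) * f (LN N y))"
    unfolding empirical_mean_def
    using finite_generator.forward_solution_eq[OF finite_generator_QB particle_solution_c] assms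
    by (intro sum.cong) auto
  also have "\<dots> = (\<Sum>x\<in>configs N. c N 0 x * (\<Sum>y\<in>configs N. particle_kernel N t x y * f (LN N y)))"
    by (simp add: sum_distrib_left sum_distrib_right mult.assoc, rule sum.swap)
  finally show ?thesis .
qed

lemma empirical_mean_follows_flow:
  assumes f: "continuous_on PX f" and t: "0 \<le> t"
  shows "(\<lambda>N. empirical_mean N (c N t) f - empirical_mean N (c N 0) (\<lambda>\<mu>. f (flow t \<mu>))) \<longlonglongrightarrow> 0"
  unfolding tendsto_iff
proof (intro allI impI)
  fix r :: real assume "0 < r"
  then have "0 < r / 2" by simp
  from particle_expectation_follows_flow[OF f this t] eventually_gt_at_top[of 0]
  show "\<forall>\<^sub>F N in sequentially.
      dist (empirical_mean N (c N t) f - empirical_mean N (c N 0) (\<lambda>\<mu>. f (flow t \<mu>))) 0 < r"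
  proof eventually_elim
    case (elim N)
    have "is_prob_configs N (c N 0)" using c_prob elim(2) by simp
    note prob = is_prob_configsD[OF this]
    define \<delta> where "\<delta> x = (\<Sum>y\<in>configs N. particle_kernel N t x y * f (LN N y))
        - f (flow t (LN N x))" for x
    have "empirical_mean N (c N t) f - empirical_mean N (c N 0) (\<lambda>\<mu>. f (flow t \<mu>))
        = (\<Sum>x\<in>configs N. c N 0 x * \<delta> x)"
      unfolding empirical_mean_c[OF elim(2) t] unfolding empirical_mean_def \<delta>_def
      by (simp add: right_diff_distrib sum_subtractf)
    also have "\<bar>\<dots>\<bar> \<le> (\<Sum>x\<in>configs N. c N 0 x * (r / 2))"
    proof (intro order_trans[OF sum_abs] sum_mono)
      fix x :: "nat \<Rightarrow> 'x" assume x: "x \<in> configs N"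
      then have "\<bar>\<delta> x\<bar> \<le> r / 2" using elim(1) by (simp add: \<delta>_def)
      then show "\<bar>c N 0 x * \<delta> x\<bar> \<le> c N 0 x * (r / 2)"
        using prob(1)[OF x] by (simp only: abs_mult abs_of_nonneg mult_left_mono)
    qed
    also have "\<dots> = r / 2" using prob(2) sum_distrib_right[of "c N 0" "configs N" "r / 2"] by simp
    finally show ?case using \<open>0 < r\<close> by simp
  qed
qed

lemma empirical_mean_tendsto:
  assumes f: "continuous_on PX f" and t: "0 \<le> t"
  shows "(\<lambda>N. empirical_mean N (c N t) f) \<longlonglongrightarrow> (LINT \<nu>|C0. f (flow t \<nu>))"
proof -
  have cont: "continuous_on UNIV (\<lambda>\<nu>. f (flow t \<nu>))"
    using t by (intro continuous_on_compose2[OF f] continuous_flow_space) (auto simp: flow_in)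
  obtain B where "\<And>\<nu>. \<nu> \<in> PX \<Longrightarrow> norm (f \<nu>) \<le> B"
    using continuous_on_compact_bound[OF compact_PX f] by blast
  then have "bounded (range (\<lambda>\<nu>. f (flow t \<nu>)))" using flow_in[OF t] by (auto simp: bounded_iff)
  then have "(\<lambda>N. integral\<^sup>L (pushLN N (c N 0)) (\<lambda>\<nu>. f (flow t \<nu>))) \<longlonglongrightarrow> (LINT \<nu>|C0. f (flow t \<nu>))"
    using wp_weak cont unfolding weak_conv_along_def by blast
  moreover have "\<forall>\<^sub>F N in sequentially. integral\<^sup>L (pushLN N (c N 0)) (\<lambda>\<nu>. f (flow t \<nu>))
      = empirical_mean N (c N 0) (\<lambda>\<nu>. f (flow t \<nu>))"
    using eventually_ge_at_top[of 1]
    by eventually_elim (use c_prob in \<open>auto intro!: integral_pushLN borel_measurable_continuous_onI cont\<close>)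
  ultimately have "(\<lambda>N. empirical_mean N (c N 0) (\<lambda>\<nu>. f (flow t \<nu>))) \<longlonglongrightarrow> (LINT \<nu>|C0. f (flow t \<nu>))"
    by (simp add: tendsto_cong)
  from tendsto_add[OF empirical_mean_follows_flow[OF f t] this] show ?thesis by simp
qed

lemma pushLN_weak_limit:
  assumes t: "0 \<le> t"
  shows "weak_conv_along sequentially (\<lambda>N. pushLN N (c N t)) (transport t)"
  unfolding weak_conv_along_def
proof (intro allI impI, elim conjE)
  fix f :: "real^'x \<Rightarrow> real" assume f: "continuous_on UNIV f"
  then have f_borel: "f \<in> borel_measurable borel" by (rule borel_measurable_continuous_onI)
  have "\<forall>\<^sub>F N in sequentially. integral\<^sup>L (pushLN N (c N t)) f = empirical_mean N (c N t) f"
    using eventually_ge_at_top[of 1]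
    by eventually_elim (use c_prob t f_borel in \<open>auto intro!: integral_pushLN\<close>)
  moreover have "(\<lambda>N. empirical_mean N (c N t) f) \<longlonglongrightarrow> integral\<^sup>L (transport t) f"
    unfolding integral_transport[OF t f_borel]
    using f continuous_on_subset by (intro empirical_mean_tendsto t) blast
  ultimately show "(\<lambda>N. integral\<^sup>L (pushLN N (c N t)) f) \<longlonglongrightarrow> integral\<^sup>L (transport t) f"
    by (simp add: tendsto_cong)
qed

lemma FFbig_transport:
  assumes t: "0 \<le> t"
  shows "FFbig K (transport t) = (LINT \<nu>|C0. UU K (flow t \<nu>)) - (LINT \<nu>|C0. shannon (flow t \<nu>))"
  unfolding FFbig_def set_integral_transport[OF t continuous_on_FE[OF continuous_on_UU]] FE_eq
  by (intro Bochner_Integration.integral_diff integrable_flow t continuous_on_UU continuous_on_shannon)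

lemma FN_tendsto_iff:
  assumes t: "0 \<le> t"
  shows "(\<lambda>N. FN K N (c N t) / real N) \<longlonglongrightarrow> FFbig K (transport t) - FE0 K
    \<longleftrightarrow> (\<lambda>N. neg_entropy N (c N t) / real N) \<longlonglongrightarrow> - (LINT \<nu>|C0. shannon (flow t \<nu>))"
    (is "?F \<longlonglongrightarrow> ?f \<longleftrightarrow> ?E \<longlonglongrightarrow> ?s")
proof -
  have "(\<lambda>N. empirical_mean N (c N t) (UU K) + ln (ZN K N) / real N)
      \<longlonglongrightarrow> (LINT \<nu>|C0. UU K (flow t \<nu>)) + - FE0 K"
    by (intro tendsto_add empirical_mean_tendsto continuous_on_UU t ln_ZN_tendsto)
  moreover have "\<forall>\<^sub>F N in sequentially. empirical_mean N (c N t) (UU K) + ln (ZN K N) / real N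
      = ?F N - ?E N"
    using eventually_ge_at_top[of 1]
    by eventually_elim (use c_prob t in \<open>auto simp: FN_eq field_simps\<close>)
  ultimately have diff: "(\<lambda>N. ?F N - ?E N) \<longlonglongrightarrow> ?f - ?s"
    by (simp add: tendsto_cong FFbig_transport[OF t])
  show ?thesis
  proof
    assume "?F \<longlonglongrightarrow> ?f"
    from tendsto_diff[OF this diff] show "?E \<longlonglongrightarrow> ?s" by simp
  next
    assume "?E \<longlonglongrightarrow> ?s"
    from tendsto_add[OF this diff] show "?F \<longlonglongrightarrow> ?f" by simp
  qed
qed

lemma neg_entropy_tendsto:
  assumes t: "0 \<le> t"
  shows "(\<lambda>N. neg_entropy N (c N t) / real N) \<longlonglongrightarrow> - (LINT \<nu>|C0. shannon (flow t \<nu>))"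
proof -
  let ?e = "\<lambda>N. counting_error TYPE('x) N / real N"
  let ?h = "\<lambda>s N. empirical_mean N (c N s) shannon"
  let ?S = "\<lambda>s. LINT \<nu>|C0. shannon (flow s \<nu>)"
  have h: "?h s \<longlonglongrightarrow> ?S s" if "0 \<le> s" for s
    by (rule empirical_mean_tendsto[OF continuous_on_shannon that])
  have initial: "(\<lambda>N. neg_entropy N (c N 0) / real N) \<longlonglongrightarrow> - ?S 0"
    using FN_tendsto_iff[of 0] wp_entropy by (simp add: transport_0)
  have lower: "\<forall>\<^sub>F N in sequentially. - ?h t N - 2 * ?e N \<le> neg_entropy N (c N t) / real N"
    using eventually_ge_at_top[of 1]
  proof eventually_elim
    case (elim N)
    then have "(- real N * ?h t N - 2 * counting_error TYPE('x) N) / real N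
        \<le> neg_entropy N (c N t) / real N"
      using c_prob t by (intro divide_right_mono neg_entropy_lower_bound) auto
    then show ?case using elim by (simp add: diff_divide_distrib)
  qed
  have upper: "\<forall>\<^sub>F N in sequentially. neg_entropy N (c N t) / real N
      \<le> neg_entropy N (c N 0) / real N + (?h 0 N - ?h t N) + 3 * ?e N"
    using eventually_ge_at_top[of 1]
  proof eventually_elim
    case (elim N)
    then have "neg_entropy N (c N t) / real N
        \<le> (neg_entropy N (c N 0) + real N * (?h 0 N - ?h t N) + 3 * counting_error TYPE('x) N) / real N"
      using c_prob t by (intro divide_right_mono neg_entropy_propagation particle_solution_c) auto
    then show ?case using elim by (simp add: add_divide_distrib)
  qed
  have "(\<lambda>N. - ?h t N - 2 * ?e N) \<longlonglongrightarrow> - ?S t - 2 * 0"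
    by (intro tendsto_intros counting_error_tendsto h t)
  moreover have "(\<lambda>N. neg_entropy N (c N 0) / real N + (?h 0 N - ?h t N) + 3 * ?e N)
      \<longlonglongrightarrow> - ?S 0 + (?S 0 - ?S t) + 3 * 0"
    by (intro tendsto_intros counting_error_tendsto h t initial) simp
  ultimately show ?thesis by (intro tendsto_sandwich[OF lower upper]) simp_all
qed

lemma FN_tendsto: "0 \<le> t \<Longrightarrow> (\<lambda>N. FN K N (c N t) / real N) \<longlonglongrightarrow> FFbig K (transport t) - FE0 K"
  using FN_tendsto_iff neg_entropy_tendsto by blast

lemma transport_liouville_equation:
  assumes "test_fun \<phi>"
  shows "(LBINT t:{0<..}. (LINT \<nu>:PX|transport t. frechet_derivative \<phi> (at (t, \<nu>)) (1, 0)
    + frechet_derivative \<phi> (at (t, \<nu>)) (0, bfield K A \<nu>))) = 0"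
proof -
  obtain \<phi>' a T where \<phi>: "\<And>p. (\<phi> has_derivative blinfun_apply (\<phi>' p)) (at p)" "continuous_on UNIV \<phi>'"
    "0 < a" "a \<le> T" "\<And>t \<nu>. t \<notin> {a<..<T} \<Longrightarrow> \<phi> (t, \<nu>) = 0" "\<And>t \<nu>. t \<notin> {a<..<T} \<Longrightarrow> \<phi>' (t, \<nu>) = 0"
    using test_funE[OF assms] by blast
  interpret transported_test_function PX "bfield K A" flow C0 \<phi> \<phi>' a T
    using \<phi> by unfold_locales
  have "frechet_derivative \<phi> (at p) (1, 0) + frechet_derivative \<phi> (at p) (0, v)
      = blinfun_apply (\<phi>' p) (1, v)" for p v
    unfolding frechet_derivative_at[OF \<phi>(1), symmetric] blinfun.add_right[symmetric] by simp
  then show ?thesis using liouville_equation by simp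
qed

lemma transport_liouville_weak_sol: "liouville_weak_sol K A transport C0"
  unfolding liouville_weak_sol_def prob_on_simplex_def weak_conv_along_def
  using transport_0 prob_space_transport emeasure_transport transport_weakly_continuous
    transport_liouville_equation by auto

end

theorem theorem3p12:
  fixes K :: "'x::finite \<Rightarrow> real^'x \<Rightarrow> real"
    and A :: "real^'x \<Rightarrow> 'x \<Rightarrow> 'x \<Rightarrow> real"
    and AN :: "nat \<Rightarrow> real^'x \<Rightarrow> 'x \<Rightarrow> 'x \<Rightarrow> real"
    and c :: "nat \<Rightarrow> real \<Rightarrow> (nat \<Rightarrow> 'x) \<Rightarrow> real"
    and C0 :: "(real^'x) measure"
  assumes K_C2: "\<exists>S. open S \<and> PX \<subseteq> S \<and> (\<forall>x. C2_on S (K x))"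
    and A_good: "\<forall>\<mu>\<in>PX. good_mat (A \<mu>)"
    and A_lip: "\<forall>x y. \<exists>L. L-lipschitz_on PX (\<lambda>\<mu>. A \<mu> x y)"
    and AN_good: "\<forall>N. \<forall>\<mu>\<in>PX. good_mat (AN N \<mu>)"
    and AN_conv: "\<forall>x y. uniform_limit PX (\<lambda>N \<mu>. AN N \<mu> x y) (\<lambda>\<mu>. A \<mu> x y) sequentially"
    and c_prob: "\<forall>N\<ge>1. \<forall>t\<ge>0. is_prob_configs N (c N t)"
    and c_ode: "\<forall>N\<ge>1. \<forall>t\<ge>0. \<forall>cy\<in>configs N.
          ((\<lambda>s. c N s cy) has_real_derivative (\<Sum>cx\<in>configs N. c N t cx * QB K AN N cx cy))
            (at t within {0..})"
    and C0_prob: "prob_on_simplex C0"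
    and wp_entropy: "(\<lambda>N. FN K N (c N 0) / real N) \<longlonglongrightarrow> FFbig K C0 - FE0 K"
    and wp_weak: "weak_conv_along sequentially (\<lambda>N. pushLN N (c N 0)) C0"
  shows "\<exists>C. liouville_weak_sol K A C C0
           \<and> (\<forall>t>0. weak_conv_along sequentially (\<lambda>N. pushLN N (c N t)) (C t))
           \<and> (\<forall>t>0. (\<lambda>N. FN K N (c N t) / real N) \<longlonglongrightarrow> FFbig K (C t) - FE0 K)"
proof -
  interpret well_prepared_particles K A AN c C0
    by unfold_locales (fact assms)+
  show ?thesis
    using transport_liouville_weak_sol pushLN_weak_limit FN_tendsto
    by (intro exI[of _ transport]) (simp add: less_imp_le)
qed

end
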